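(* Let $p$ be a Fermat prime or a safe prime and $G=\mathbb{Z}\times\mathbb{Z}_p=\langle z\rangle\times\langle a\rangle$. If $\mathcal{S}$ is a Schur ring over $G$ such that $\mathbb{Z}^{(p)}=\langle z^p\rangle$ is an $\mathcal{S}$-subgroup, then $\mathcal{S}$ is an automorphic Schur ring.
   Context: $F$ is a field of characteristic $0$; $\mathbb{Z}=\langle z\rangle$ infinite cyclic, $\mathbb{Z}_p=\langle a\rangle$ cyclic of order $p$, written multiplicatively. For finite $C\subseteq G$, $\overline{C}=\sum_{g\in C}g$ and $C^*=\{g^{-1}:g\in C\}$. A Schur ring over $G$ is a subspace $\mathcal{S}=\mathrm{Span}_F\{\overline{C}:C\in\mathcal{D}\}$ of $F[G]$, where $\mathcal{D}$ is a partition of $G$ into finite subsets with $\{1\}\in\mathcal{D}$, $C\in\mathcal{D}\Rightarrow C^*\in\mathcal{D}$, and each $\overline{C}\,\overline{D}$ a finite $F$-linear combination of the $\overline{E}$, $E\in\mathcal{D}$; an $\mathcal{S}$-subgroup is a subgroup that is a union of members of $\mathcal{D}$. $\mathcal{S}$ is automorphic if $\mathcal{S}=F[G]^{\mathcal{H}}$ (elements fixed by $\mathcal{H}$; classes the $\mathcal{H}$-orbits) for some finite $\mathcal{H}\le\operatorname{Aut}(G)$. A Fermat prime is a prime of the form $2^k+1$; a safe prime is a prime $p=2q+1$ with $q$ prime. *)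

theory Defs
  imports "HOL-Algebra.Algebra" "HOL-Library.Disjoint_Sets" "HOL-Computational_Algebra.Primes"
begin

definition fermat_prime :: "nat \<Rightarrow> bool" where
  "fermat_prime p \<longleftrightarrow> Factorial_Ring.prime p \<and> (\<exists>k::nat. p = 2 ^ k + 1)"

definition safe_prime :: "nat \<Rightarrow> bool" where
  "safe_prime p \<longleftrightarrow> Factorial_Ring.prime p \<and> (\<exists>q::nat. Factorial_Ring.prime q \<and> p = 2 * q + 1)"

text \<open>Coefficient of g in the group-ring product of the class sums of C and E.\<close>
definition prod_coeff :: "('g, 'b) monoid_scheme \<Rightarrow> 'g set \<Rightarrow> 'g set \<Rightarrow> 'g \<Rightarrow> nat" where
  "prod_coeff G C E g = card {(x, y). x \<in> C \<and> y \<in> E \<and> x \<otimes>\<^bsub>G\<^esub> y = g}"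

text \<open>D is the partition defining a Schur ring over G with coefficients in the field 'f:
  a partition of G into finite nonempty sets, containing {1}, closed under inversion, and such that
  every product of class sums is a finite 'f-linear combination of class sums.\<close>
definition Schur_partition :: "'f::field itself \<Rightarrow> ('g, 'b) monoid_scheme \<Rightarrow> 'g set set \<Rightarrow> bool" where
  "Schur_partition (F::'f itself) G D \<longleftrightarrow>
     partition_on (carrier G) D \<and>
     (\<forall>C\<in>D. finite C) \<and>
     {\<one>\<^bsub>G\<^esub>} \<in> D \<and>
     (\<forall>C\<in>D. (\<lambda>x. inv\<^bsub>G\<^esub> x) ` C \<in> D) \<and>
     (\<forall>C\<in>D. \<forall>E\<in>D. \<exists>c :: 'g set \<Rightarrow> 'f.
        finite {K \<in> D. c K \<noteq> 0} \<and>
        (\<forall>g\<in>carrier G. of_nat (prod_coeff G C E g) =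
            (\<Sum>K\<in>{K \<in> D. c K \<noteq> 0}. c K * (if g \<in> K then 1 else 0))))"

definition S_subgroup :: "('g, 'b) monoid_scheme \<Rightarrow> 'g set set \<Rightarrow> 'g set \<Rightarrow> bool" where
  "S_subgroup G D K \<longleftrightarrow> subgroup K G \<and> K = \<Union>{C \<in> D. C \<subseteq> K}"

definition automorphic :: "('g, 'b) monoid_scheme \<Rightarrow> 'g set set \<Rightarrow> bool" where
  "automorphic G D \<longleftrightarrow>
     (\<exists>H. subgroup H (AutoGroup G) \<and> finite H \<and>
          D = {{\<sigma> x | \<sigma>. \<sigma> \<in> H} | x. x \<in> carrier G})"

text \<open>G = Z x Z_p, written additively: (m, k) stands for z^m a^k.\<close>
definition ZxZp :: "nat \<Rightarrow> (int \<times> int) monoid" where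
  "ZxZp p = integer_group \<times>\<times> integer_mod_group p"

end

(*
  After adjoining z^p to the Schur ring S, every class lies on one level z^m Z_p (the ring of slices). There
  the classes at level 0 are the cosets of a group H of units modulo p, and raising a level 1 class to the
  p-th power modulo p shows that level 1 has at least as many classes as level 0. Their sizes k satisfy
  |H| dvd k (k - 1) and add up to p; for a Fermat or safe prime this forces level 1 to be a single class or
  to contain a singleton z a^b, so the slices are orbits of maps z |-> z a^b, a |-> a^i. If z^p is not itself
  a singleton class of S, each class of S is invariant under one further automorphism z |-> z^-1 a^c,
  a |-> a^j, found by pairing the slices at opposite levels.
*)
theory Submission
  imports Defs "HOL-Library.Poly_Mapping" "HOL-Library.Product_Plus"
begin

section \<open>The group ring\<close>

text \<open>Exponents are the main tool: for n not 0, x |-> x^n carries a finite union of classes to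
  a union of classes if it is injective there, because powers of class sums modulo the prime factors
  of n show it in their coefficients. The obstacle is that a unit n modulo p has no inverse acting
  on Z. But if n' n = 1 + p l, the exponent n' n fixes the torsion part and moves level m by the
  translation z^(p l m), so n permutes the classes as soon as translation by z^p does. This is what
  adjoining z^p buys; the hypothesis on <z^p> enters by forcing the class of z^p into {z^p, z^-p}.
  The relation |H| dvd k (k - 1) comes from K K^-1, whose coefficients are constant on the classes
  at level 0, all of size |H| except {1}. The form of p enters through the divisors of p - 1: a
  prime power dividing k (k - 1) is at most k once k > 1. The order that escapes is |H| = 2q for p =
  2q + 1, where level 1 could split into sizes q and q + 1; the piece of size q would be a
  difference set, and comparing its square in the group ring with its set of squares excludes
  it.\<close>

type_synonym gring = "(int \<times> int) \<Rightarrow>\<^sub>0 int"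

definition red :: "nat \<Rightarrow> int \<times> int \<Rightarrow> int \<times> int" where
  "red p x = (fst x, snd x mod int p)"

definition cyl :: "nat \<Rightarrow> (int \<times> int) set" where
  "cyl p = UNIV \<times> {0..<int p}"

text \<open>Additive form of the n-th power map; reducing the second component afterwards gives x
  |-> x^n on the group.\<close>

definition smul :: "int \<Rightarrow> int \<times> int \<Rightarrow> int \<times> int" where
  "smul n x = (n * fst x, n * snd x)"

text \<open>Elements of the integral group ring of \<open>Z \<times> Z\<^sub>p\<close> are represented by elements of that of \<open>Z \<times> Z\<close>;
  coefficients are summed over the fibres of the reduction \<open>red p\<close>.\<close>

definition cf :: "nat \<Rightarrow> gring \<Rightarrow> int \<times> int \<Rightarrow> int" where
  "cf p f g = (\<Sum>x\<in>Poly_Mapping.keys f. if red p x = g then Poly_Mapping.lookup f x else 0)"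

definition class_sum :: "(int \<times> int) set \<Rightarrow> gring" where
  "class_sum A = (\<Sum>x\<in>A. Poly_Mapping.single x 1)"

lemma red_simps [simp]:
  "red p (red p x) = red p x" "fst (red p x) = fst x"
  "red p (red p x + y) = red p (x + y)" "red p (x + red p y) = red p (x + y)"
  "red p (red p x - y) = red p (x - y)" "red p (x - red p y) = red p (x - y)"
  "red p (- red p x) = red p (- x)" "red p (smul n (red p x)) = red p (smul n x)"
  by (auto simp: red_def smul_def mod_simps)

lemma red_in_cyl: "p > 0 \<Longrightarrow> red p x \<in> cyl p"
  by (auto simp: red_def cyl_def)

lemma red_id: "x \<in> cyl p \<Longrightarrow> red p x = x"
  by (auto simp: red_def cyl_def)

lemma smul_simps [simp]:
  "smul n (x + y) = smul n x + smul n y" "smul 1 x = x" "smul (-1) x = - x" "smul 0 x = 0"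
  "smul n (- x) = - smul n x" "fst (smul n x) = n * fst x" "snd (smul n x) = n * snd x"
  "smul n (smul m x) = smul (n * m) x" "smul n 0 = 0"
  by (auto simp: smul_def prod_eq_iff algebra_simps)

lemma cf_superset:
  assumes "finite A" "Poly_Mapping.keys f \<subseteq> A"
  shows "cf p f g = (\<Sum>x\<in>A. if red p x = g then Poly_Mapping.lookup f x else 0)"
  unfolding cf_def
  by (rule sum.mono_neutral_left) (use assms in \<open>auto simp: in_keys_iff\<close>)

lemma cf_zero [simp]: "cf p 0 g = 0"
  by (simp add: cf_def)

lemma cf_add [simp]: "cf p (f + f') g = cf p f g + cf p f' g"
proof -
  let ?A = "Poly_Mapping.keys f \<union> Poly_Mapping.keys f'"
  have "cf p (f + f') g = (\<Sum>x\<in>?A. if red p x = g then Poly_Mapping.lookup (f + f') x else 0)"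
    by (rule cf_superset) (use Poly_Mapping.keys_add [of f f'] in auto)
  also have "\<dots> = (\<Sum>x\<in>?A. if red p x = g then Poly_Mapping.lookup f x else 0) +
                  (\<Sum>x\<in>?A. if red p x = g then Poly_Mapping.lookup f' x else 0)"
    unfolding sum.distrib [symmetric] by (rule sum.cong) (auto simp: lookup_add)
  also have "\<dots> = cf p f g + cf p f' g"
    by (intro arg_cong2 [where f = "(+)"]; rule cf_superset [symmetric]) auto
  finally show ?thesis .
qed

lemma cf_sum: "cf p (sum F A) g = (\<Sum>i\<in>A. cf p (F i) g)"
  by (induction A rule: infinite_finite_induct) auto

lemma cf_single: "cf p (Poly_Mapping.single x a) g = (if red p x = g then a else 0)"
  by (subst cf_superset [of "{x}"]) auto

lemma cf_uminus [simp]: "cf p (- f) g = - cf p f g"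
  using cf_add [of p f "-f" g] by simp

lemma cf_diff [simp]: "cf p (f - f') g = cf p f g - cf p f' g"
  using cf_add [of p f "-f'" g] by simp

lemma cf_outside: "red p g \<noteq> g \<Longrightarrow> cf p f g = 0"
  unfolding cf_def by (rule sum.neutral) auto

lemma sum_single: "(\<Sum>x\<in>Poly_Mapping.keys f. Poly_Mapping.single x (Poly_Mapping.lookup f x)) = (f :: gring)"
proof (rule poly_mapping_eqI)
  fix k
  show "Poly_Mapping.lookup (\<Sum>x\<in>Poly_Mapping.keys f. Poly_Mapping.single x (Poly_Mapping.lookup f x)) k = Poly_Mapping.lookup f k"
    by (auto simp: lookup_sum lookup_single when_def in_keys_iff sum.delta)
qed

lemma cf_mult_single:
  assumes "red p h = h"
  shows "cf p (Poly_Mapping.single x a * f) h = a * cf p f (red p (h - x))"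
proof -
  have eq: "red p (x + y) = h \<longleftrightarrow> red p y = red p (h - x)" for y
  proof
    assume "red p (x + y) = h"
    then have "red p (h - x) = red p (x + y - x)" by (metis red_simps(5))
    then show "red p y = red p (h - x)" by simp
  next
    assume "red p y = red p (h - x)"
    then have "red p (x + y) = red p (x + (h - x))" by (metis red_simps(4))
    then show "red p (x + y) = h" using assms by simp
  qed
  have "Poly_Mapping.single x a * f =
      (\<Sum>y\<in>Poly_Mapping.keys f. Poly_Mapping.single (x + y) (a * Poly_Mapping.lookup f y))"
    by (subst (1) sum_single [of f, symmetric]) (simp add: sum_distrib_left mult_single)
  then have "cf p (Poly_Mapping.single x a * f) h =
      (\<Sum>y\<in>Poly_Mapping.keys f. if red p (x + y) = h then a * Poly_Mapping.lookup f y else 0)"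
    by (simp add: cf_sum cf_single)
  also have "\<dots> = a * cf p f (red p (h - x))"
    unfolding cf_def eq sum_distrib_left by (rule sum.cong) auto
  finally show ?thesis .
qed

lemma cf_mult:
  assumes "red p h = h"
  shows "cf p (f * g) h = (\<Sum>x\<in>Poly_Mapping.keys f. Poly_Mapping.lookup f x * cf p g (red p (h - x)))"
proof -
  have "f * g = (\<Sum>x\<in>Poly_Mapping.keys f. Poly_Mapping.single x (Poly_Mapping.lookup f x) * g)"
    by (subst (1) sum_single [of f, symmetric]) (simp add: sum_distrib_right)
  then show ?thesis using assms by (simp add: cf_sum cf_mult_single)
qed

text \<open>The kernel of the reduction to the group ring of Z x Z_p is an ideal, so representatives
  may be exchanged inside a product.\<close>

lemma cf_mult_cong_right:
  assumes "cf p g = cf p g'"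
  shows "cf p (f * g) = cf p (f * g')"
proof
  fix h show "cf p (f * g) h = cf p (f * g') h"
    using assms by (cases "red p h = h") (auto simp: cf_mult cf_outside)
qed

lemma cf_mult_cong:
  assumes "cf p f = cf p f'" "cf p g = cf p g'"
  shows "cf p (f * g) = cf p (f' * g')"
  using cf_mult_cong_right [OF assms(2), of f] cf_mult_cong_right [OF assms(1), of g']
  by (simp add: mult.commute)

lemma cf_of_int_mult [simp]: "cf p (of_int a * f) g = a * cf p f g"
proof (cases "red p g = g")
  case True
  then show ?thesis by (simp flip: single_of_int add: cf_mult_single)
qed (simp add: cf_outside)

lemma cf_of_nat_mult [simp]: "cf p (of_nat a * f) g = int a * cf p f g"
  using cf_of_int_mult [of p "int a" f g] by simp

lemma cf_dvd_mult:
  assumes "\<And>g. n dvd cf p f g"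
  shows "n dvd cf p (f' * f) g"
proof (cases "red p g = g")
  case True
  then show ?thesis unfolding cf_mult [OF True] by (intro dvd_sum dvd_mult assms)
qed (simp add: cf_outside)

lemma cf_class_sum:
  assumes "finite A" "A \<subseteq> cyl p"
  shows "cf p (class_sum A) g = of_bool (g \<in> A)"
proof -
  have "cf p (class_sum A) g = (\<Sum>x\<in>A. if x = g then 1 else 0)"
    unfolding class_sum_def cf_sum cf_single by (rule sum.cong) (use assms red_id in auto)
  then show ?thesis using assms by (simp add: sum.delta')
qed

lemma class_sum_mult:
  "class_sum A * class_sum B = (\<Sum>(x, y)\<in>A \<times> B. Poly_Mapping.single (x + y) 1)"
  by (simp add: class_sum_def sum_product mult_single sum.cartesian_product)

lemma cf_class_sum_mult:
  assumes "finite A" "finite B"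
  shows "cf p (class_sum A * class_sum B) g = int (card {(x, y). x \<in> A \<and> y \<in> B \<and> red p (x + y) = g})"
proof -
  have "cf p (class_sum A * class_sum B) g = (\<Sum>z\<in>A \<times> B. if red p (fst z + snd z) = g then 1 else 0)"
    unfolding class_sum_mult cf_sum by (rule sum.cong) (auto simp: cf_single)
  also have "\<dots> = int (card ({z \<in> A \<times> B. red p (fst z + snd z) = g}))"
    using assms by (simp add: sum.If_cases Int_def)
  also have "{z \<in> A \<times> B. red p (fst z + snd z) = g} = {(x, y). x \<in> A \<and> y \<in> B \<and> red p (x + y) = g}"
    by auto
  finally show ?thesis .
qed

section \<open>Frobenius modulo a prime\<close>

lemma add_power_prime:
  fixes x y :: "'a :: comm_ring_1"
  assumes "Factorial_Ring.prime (q :: nat)"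
  shows "\<exists>w. (x + y) ^ q = x ^ q + y ^ q + of_nat q * w"
proof -
  have q: "q > 0" using assms by (simp add: prime_gt_0_nat)
  have "(x + y) ^ q = (\<Sum>k\<le>q. of_nat (q choose k) * x ^ k * y ^ (q - k))"
    by (rule binomial_ring)
  also have "{..q} = insert 0 (insert q {1..<q})" using q by auto
  also have "(\<Sum>k\<in>\<dots>. of_nat (q choose k) * x ^ k * y ^ (q - k)) =
      y ^ q + x ^ q + (\<Sum>k=1..<q. of_nat (q choose k) * x ^ k * y ^ (q - k))"
    using q by simp
  also have "(\<Sum>k=1..<q. of_nat (q choose k) * x ^ k * y ^ (q - k)) =
      (\<Sum>k=1..<q. of_nat q * (of_nat ((q choose k) div q) * x ^ k * y ^ (q - k)))"
  proof (rule sum.cong)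
    fix k assume "k \<in> {1..<q}"
    then have "q dvd (q choose k)" using assms by (intro dvd_choose_prime) auto
    then have "q choose k = q * ((q choose k) div q)" by simp
    then have "(of_nat (q choose k) :: 'a) = of_nat q * of_nat ((q choose k) div q)"
      by (metis of_nat_mult)
    then show "of_nat (q choose k) * x ^ k * y ^ (q - k) =
        of_nat q * (of_nat ((q choose k) div q) * x ^ k * y ^ (q - k))" by (simp add: mult.assoc)
  qed simp
  finally show ?thesis by (auto simp: sum_distrib_left [symmetric] add.commute)
qed

lemma sum_power_prime:
  fixes f :: "'b \<Rightarrow> 'a :: comm_ring_1"
  assumes "Factorial_Ring.prime (q :: nat)" "finite A"
  shows "\<exists>w. (\<Sum>x\<in>A. f x) ^ q = (\<Sum>x\<in>A. f x ^ q) + of_nat q * w"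
  using assms(2)
proof (induction A rule: finite_induct)
  case empty
  then show ?case using prime_gt_0_nat [OF assms(1)] by (auto intro!: exI [of _ 0] simp: power_0_left)
next
  case (insert x A)
  then obtain w where w: "(\<Sum>x\<in>A. f x) ^ q = (\<Sum>x\<in>A. f x ^ q) + of_nat q * w" by auto
  obtain w' where "(f x + (\<Sum>x\<in>A. f x)) ^ q = f x ^ q + (\<Sum>x\<in>A. f x) ^ q + of_nat q * w'"
    using add_power_prime [OF assms(1)] by blast
  with w insert show ?case by (auto intro!: exI [of _ "w + w'"] simp: algebra_simps)
qed

lemma single_power: "Poly_Mapping.single x (1::int) ^ n = Poly_Mapping.single (smul (int n) x) 1"
proof (induction n)
  case 0
  show ?case by (simp add: single_one)
next
  case (Suc n)
  have "x + smul (int n) x = smul (int (Suc n)) x" by (simp add: prod_eq_iff algebra_simps)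
  with Suc show ?case by (simp add: mult_single)
qed

lemma class_sum_power_prime:
  assumes "Factorial_Ring.prime (q :: nat)" "finite A"
  shows "\<exists>w. class_sum A ^ q = (\<Sum>x\<in>A. Poly_Mapping.single (smul (int q) x) 1) + of_nat q * w"
  using sum_power_prime [OF assms, of "\<lambda>x. Poly_Mapping.single x (1 :: int)"]
  by (simp only: class_sum_def single_power)

section \<open>Schur rings on the cylinder\<close>

definition sset :: "nat \<Rightarrow> (int \<times> int) set \<Rightarrow> (int \<times> int) set \<Rightarrow> (int \<times> int) set" where
  "sset p A B = {red p (x + y) | x y. x \<in> A \<and> y \<in> B}"

definition nmul :: "nat \<Rightarrow> int \<Rightarrow> (int \<times> int) set \<Rightarrow> (int \<times> int) set" where
  "nmul p n A = (\<lambda>x. red p (smul n x)) ` A"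

definition lev :: "nat \<Rightarrow> int \<Rightarrow> (int \<times> int) set" where
  "lev p m = {m} \<times> {0..<int p}"

lemma lev_iff: "x \<in> lev p m \<longleftrightarrow> x \<in> cyl p \<and> fst x = m"
  by (auto simp: lev_def cyl_def)

lemma finite_lev [simp]: "finite (lev p m)"
  by (simp add: lev_def)

lemma card_lev [simp]: "card (lev p m) = p"
  by (simp add: lev_def)

lemma inj_on_smul_coprime:
  assumes "coprime n (int p)" "n \<noteq> 0"
  shows "inj_on (\<lambda>x. red p (smul n x)) (cyl p)"
proof (rule inj_onI)
  fix x y assume x: "x \<in> cyl p" and y: "y \<in> cyl p" and eq: "red p (smul n x) = red p (smul n y)"
  from eq have "fst x = fst y" using assms(2) by (simp add: red_def)
  moreover have "int p dvd n * snd x - n * snd y"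
    using eq by (simp add: red_def mod_eq_dvd_iff)
  then have "int p dvd n * (snd x - snd y)" by (simp add: algebra_simps)
  then have "int p dvd snd x - snd y"
    using assms(1) by (simp add: coprime_commute coprime_dvd_mult_right_iff)
  then have "snd x mod int p = snd y mod int p" by (simp add: mod_eq_dvd_iff)
  with x y have "snd x = snd y" by (auto simp: cyl_def)
  ultimately show "x = y" by (simp add: prod_eq_iff)
qed

text \<open>Structure constants are stated as cardinalities, so no field appears: a product of two
  class sums has finite support, and it is a combination of class sums as soon as its coefficients
  are constant on every class.\<close>

locale schur_cyl =
  fixes p :: nat and D :: "(int \<times> int) set set"
  assumes prime_p: "Factorial_Ring.prime p"
    and partition: "partition_on (cyl p) D"
    and finite_class: "C \<in> D \<Longrightarrow> finite C"
    and zero_class: "{0} \<in> D"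
    and neg_class: "C \<in> D \<Longrightarrow> nmul p (-1) C \<in> D"
    and prod_const: "\<lbrakk>C \<in> D; E \<in> D; K \<in> D; g \<in> K; h \<in> K\<rbrakk> \<Longrightarrow>
        card {(x, y). x \<in> C \<and> y \<in> E \<and> red p (x + y) = g} =
        card {(x, y). x \<in> C \<and> y \<in> E \<and> red p (x + y) = h}"
begin

lemma p_gt_1: "p > 1" and p_pos [simp]: "p > 0"
  using prime_p prime_gt_1_nat prime_gt_0_nat by auto

section \<open>Unions of classes and the integral Schur ring\<close>

definition cls :: "int \<times> int \<Rightarrow> (int \<times> int) set" where
  "cls x = (THE C. C \<in> D \<and> x \<in> C)"

text \<open>Unions of classes may be infinite, so that subgroups such as <z^p> are covered.\<close>

definition S_set :: "(int \<times> int) set \<Rightarrow> bool" where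
  "S_set A \<longleftrightarrow> A \<subseteq> cyl p \<and> (\<forall>x\<in>A. cls x \<subseteq> A)"

text \<open>The Schur ring over the integers; finite support makes these elements the integral
  combinations of class sums.\<close>

definition S :: "gring \<Rightarrow> bool" where
  "S f \<longleftrightarrow> (\<forall>C\<in>D. \<forall>g\<in>C. \<forall>h\<in>C. cf p f g = cf p f h)"

lemma class_subset: "C \<in> D \<Longrightarrow> C \<subseteq> cyl p"
  using partition by (auto simp: partition_on_def)

lemma class_nonempty: "C \<in> D \<Longrightarrow> C \<noteq> {}"
  using partition by (auto simp: partition_on_def)

lemma class_eq: "\<lbrakk>C \<in> D; E \<in> D; x \<in> C; x \<in> E\<rbrakk> \<Longrightarrow> C = E"
  using partition unfolding partition_on_def disjoint_def by blast

lemma cls_eq: "\<lbrakk>C \<in> D; x \<in> C\<rbrakk> \<Longrightarrow> cls x = C"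
  unfolding cls_def by (rule the_equality, simp) (metis class_eq)

lemma cls_in: assumes "x \<in> cyl p" shows "cls x \<in> D" "x \<in> cls x"
proof -
  obtain C where "C \<in> D" "x \<in> C" using assms partition unfolding partition_on_def by blast
  then show "cls x \<in> D" "x \<in> cls x" using cls_eq [of C x] by simp_all
qed

lemma S_set_class: "C \<in> D \<Longrightarrow> S_set C"
  unfolding S_set_def by (simp add: class_subset cls_eq)

lemma S_set_subset: "S_set A \<Longrightarrow> A \<subseteq> cyl p"
  by (simp add: S_set_def)

lemma S_set_cls_subset: "S_set A \<Longrightarrow> x \<in> A \<Longrightarrow> cls x \<subseteq> A"
  by (simp add: S_set_def)

lemma S_set_class_subset: "\<lbrakk>S_set A; C \<in> D; x \<in> C; x \<in> A\<rbrakk> \<Longrightarrow> C \<subseteq> A"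
  using S_set_cls_subset [of A x] cls_eq [of C x] by simp

lemma isSI: "\<lbrakk>A \<subseteq> cyl p; \<And>C x y. \<lbrakk>C \<in> D; x \<in> C; y \<in> C; x \<in> A\<rbrakk> \<Longrightarrow> y \<in> A\<rbrakk> \<Longrightarrow> S_set A"
  unfolding S_set_def using cls_in by blast

lemma S_set_Un: "S_set A \<Longrightarrow> S_set B \<Longrightarrow> S_set (A \<union> B)"
  unfolding S_set_def by blast

lemma S_set_UN: "(\<And>i. i \<in> I \<Longrightarrow> S_set (A i)) \<Longrightarrow> S_set (\<Union>i\<in>I. A i)"
  unfolding S_set_def by blast

lemma S_set_Int: "S_set A \<Longrightarrow> S_set B \<Longrightarrow> S_set (A \<inter> B)"
  unfolding S_set_def by blast

lemma S_set_singleton_class: assumes "S_set {x}" shows "{x} \<in> D"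
proof -
  have "x \<in> cyl p" "cls x \<subseteq> {x}" using assms by (auto simp: S_set_def)
  then show ?thesis using cls_in [of x] by (metis singletonD subset_singletonD empty_iff)
qed

lemma S_set_mem_iff:
  assumes "S_set A" "C \<in> D" "x \<in> C" "y \<in> C"
  shows "x \<in> A \<longleftrightarrow> y \<in> A"
  using S_set_class_subset [OF assms(1,2,3)] S_set_class_subset [OF assms(1,2,4)] assms(3,4) by auto

lemma S_class_sum: assumes "finite A" "S_set A" shows "S (class_sum A)"
  unfolding S_def cf_class_sum [OF assms(1) S_set_subset [OF assms(2)]]
proof (intro ballI)
  fix C g h assume "C \<in> D" "g \<in> C" "h \<in> C"
  then have "g \<in> A \<longleftrightarrow> h \<in> A" by (rule S_set_mem_iff [OF assms(2)])
  then show "of_bool (g \<in> A) = (of_bool (h \<in> A) :: int)" by simp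
qed

lemma S_D: assumes "S f" "C \<in> D" "g \<in> C" "h \<in> C" shows "cf p f g = cf p f h"
proof -
  have "\<forall>g\<in>C. \<forall>h\<in>C. cf p f g = cf p f h" using assms(1,2) unfolding S_def by (rule bspec)
  then have "\<forall>h\<in>C. cf p f g = cf p f h" using assms(3) by (rule bspec)
  then show ?thesis using assms(4) by (rule bspec)
qed

lemma S_I: assumes "\<And>C g h. \<lbrakk>C \<in> D; g \<in> C; h \<in> C\<rbrakk> \<Longrightarrow> cf p f g = cf p f h" shows "S f"
  unfolding S_def by (intro ballI) (rule assms)

lemma S_sum: assumes "\<And>i. i \<in> I \<Longrightarrow> S (F i)" shows "S (sum F I)"
proof (rule S_I)
  fix C g h assume "C \<in> D" "g \<in> C" "h \<in> C"
  then show "cf p (sum F I) g = cf p (sum F I) h"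
    unfolding cf_sum by (intro sum.cong refl S_D [OF assms])
qed

lemma S_of_int_mult: assumes "S f" shows "S (of_int a * f)"
  by (rule S_I, unfold cf_of_int_mult) (intro arg_cong2 [where f = "(*)"] refl S_D [OF assms])

lemma S_cong: "cf p f = cf p g \<Longrightarrow> S f \<longleftrightarrow> S g"
  by (simp add: S_def)

lemma S_1: "S 1"
proof -
  have "S (class_sum {0})" by (intro S_class_sum finite_class S_set_class zero_class)
  then show ?thesis by (simp add: class_sum_def)
qed

lemma S_expand:
  assumes "S f"
  obtains U val where "finite U" "U \<subseteq> D" "cf p f = cf p (\<Sum>C\<in>U. of_int (val C) * class_sum C)"
proof
  define U where "U = cls ` red p ` Poly_Mapping.keys f"
  \<comment> \<open>The coefficient is sampled at an arbitrary element of the class, on which it is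
    constant.\<close>
  define val where "val C = cf p f (SOME x. x \<in> C)" for C
  show "finite U" by (simp add: U_def)
  show "U \<subseteq> D" unfolding U_def by (intro image_subsetI) (use cls_in red_in_cyl p_pos in blast)
  show "cf p f = cf p (\<Sum>C\<in>U. of_int (val C) * class_sum C)"
  proof
    fix g
    have eq: "cf p (\<Sum>C\<in>U. of_int (val C) * class_sum C) g = (\<Sum>C\<in>U. val C * of_bool (g \<in> C))"
      unfolding cf_sum cf_of_int_mult
    proof (rule sum.cong [OF refl])
      fix C assume "C \<in> U"
      then have "C \<in> D" using \<open>U \<subseteq> D\<close> by blast
      then show "val C * cf p (class_sum C) g = val C * of_bool (g \<in> C)"
        by (simp only: cf_class_sum [OF finite_class class_subset])
    qed
    show "cf p f g = cf p (\<Sum>C\<in>U. of_int (val C) * class_sum C) g"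
    proof (cases "g \<in> \<Union>U")
      case True
      then obtain C where C: "C \<in> U" "g \<in> C" by auto
      have "(\<Sum>E\<in>U. val E * of_bool (g \<in> E)) = (\<Sum>E\<in>U. if E = C then val C else 0)"
      proof (rule sum.cong [OF refl])
        fix E assume "E \<in> U"
        then have "E \<in> D" "C \<in> D" using C(1) \<open>U \<subseteq> D\<close> by auto
        then have "g \<in> E \<longleftrightarrow> E = C" using class_eq [of C E g] C(2) by metis
        then show "val E * of_bool (g \<in> E) = (if E = C then val C else 0)" by simp
      qed
      also have "\<dots> = val C" using C(1) \<open>finite U\<close> by (simp only: sum.delta if_True)
      also have "\<dots> = cf p f g" unfolding val_def
        by (rule S_D [OF assms _ someI [of "\<lambda>x. x \<in> C"]]) (use C \<open>U \<subseteq> D\<close> in blast)+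
      finally show ?thesis using eq by simp
    next
      case False
      have "g \<notin> red p ` Poly_Mapping.keys f"
      proof
        assume g: "g \<in> red p ` Poly_Mapping.keys f"
        then have "cls g \<in> U" unfolding U_def by (rule imageI)
        moreover have "g \<in> cyl p" using g red_in_cyl [OF p_pos] by blast
        then have "g \<in> cls g" by (rule cls_in)
        ultimately show False using False by blast
      qed
      then have "cf p f g = 0" unfolding cf_def by (intro sum.neutral) auto
      moreover have "(\<Sum>C\<in>U. val C * of_bool (g \<in> C)) = 0"
        using False by (intro sum.neutral) auto
      ultimately show ?thesis using eq by simp
    qed
  qed
qed

lemma S_class_mult: "\<lbrakk>C \<in> D; E \<in> D\<rbrakk> \<Longrightarrow> S (class_sum C * class_sum E)"
  by (rule S_I, simp only: cf_class_sum_mult finite_class)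
    (rule arg_cong [where f = int], rule prod_const)

lemma S_mult: assumes "S f" "S g" shows "S (f * g)"
proof -
  obtain U v where U: "finite U" "U \<subseteq> D" "cf p f = cf p (\<Sum>C\<in>U. of_int (v C) * class_sum C)"
    using S_expand [OF assms(1)] by blast
  obtain V w where V: "finite V" "V \<subseteq> D" "cf p g = cf p (\<Sum>C\<in>V. of_int (w C) * class_sum C)"
    using S_expand [OF assms(2)] by blast
  have "(\<Sum>C\<in>U. of_int (v C) * class_sum C) * (\<Sum>C\<in>V. of_int (w C) * class_sum C) =
     (\<Sum>C\<in>U. \<Sum>E\<in>V. of_int (v C * w E) * (class_sum C * class_sum E))"
    by (simp add: sum_product mult_ac)
  moreover have "S (\<Sum>C\<in>U. \<Sum>E\<in>V. of_int (v C * w E) * (class_sum C * class_sum E))"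
    using U V by (intro S_sum S_of_int_mult S_class_mult) auto
  ultimately show ?thesis using S_cong [OF cf_mult_cong [OF U(3) V(3)]] by simp
qed

lemma S_power: "S f \<Longrightarrow> S (f ^ n)"
  by (induction n) (simp_all add: S_1 S_mult)

text \<open>The Schur-Wielandt principle. It is applied below to non-divisibility of coefficients by
  a prime.\<close>

lemma S_set_Collect_cf: "S f \<Longrightarrow> S_set {g \<in> cyl p. P (cf p f g)}"
proof (rule isSI)
  assume f: "S f"
  fix C x y assume C: "C \<in> D" "x \<in> C" "y \<in> C" and x: "x \<in> {g \<in> cyl p. P (cf p f g)}"
  have "cf p f x = cf p f y" by (rule S_D [OF f C])
  moreover have "y \<in> cyl p" using class_subset [OF C(1)] C(3) by blast
  ultimately show "y \<in> {g \<in> cyl p. P (cf p f g)}" using x by simp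
qed auto

text \<open>An element lies in a product of two classes iff its coefficient there is nonzero, and
  this depends on its class only. Passing to the classes of x and y keeps the counts finite even for
  infinite A or B.\<close>

lemma S_set_sset: assumes "S_set A" "S_set B" shows "S_set (sset p A B)"
proof (rule isSI)
  show "sset p A B \<subseteq> cyl p" unfolding sset_def using red_in_cyl [OF p_pos] by blast
  fix K g h assume K: "K \<in> D" "g \<in> K" "h \<in> K" and "g \<in> sset p A B"
  then obtain x y where xy: "x \<in> A" "y \<in> B" "g = red p (x + y)" unfolding sset_def by blast
  let ?C = "cls x" and ?E = "cls y"
  have C: "?C \<in> D" "x \<in> ?C" "?E \<in> D" "y \<in> ?E"
    using xy S_set_subset [OF assms(1)] S_set_subset [OF assms(2)] by (auto intro!: cls_in)
  have sub: "?C \<subseteq> A" "?E \<subseteq> B" using xy S_set_cls_subset [OF assms(1)] S_set_cls_subset [OF assms(2)] by blast+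
  have "finite {(x, y). x \<in> ?C \<and> y \<in> ?E \<and> red p (x + y) = g}"
    by (rule finite_subset [of _ "?C \<times> ?E"]) (blast, simp add: finite_class C)
  then have "card {(x, y). x \<in> ?C \<and> y \<in> ?E \<and> red p (x + y) = g} \<noteq> 0"
    using xy C by (simp only: card_eq_0_iff) blast
  then have "card {(x, y). x \<in> ?C \<and> y \<in> ?E \<and> red p (x + y) = h} \<noteq> 0"
    using prod_const [OF C(1,3) K] by simp
  then have "{(x, y). x \<in> ?C \<and> y \<in> ?E \<and> red p (x + y) = h} \<noteq> {}"
    by (rule contrapos_nn) (simp only: card.empty)
  then obtain x' y' where "x' \<in> ?C" "y' \<in> ?E" "red p (x' + y') = h" by blast
  with sub show "h \<in> sset p A B" unfolding sset_def by blast
qed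

lemma S_set_neg: assumes "S_set A" shows "S_set (nmul p (-1) A)"
proof -
  have "nmul p (-1) A = (\<Union>x\<in>A. nmul p (-1) (cls x))"
  proof -
    have "(\<Union>x\<in>A. cls x) \<subseteq> A" by (intro UN_least S_set_cls_subset [OF assms])
    moreover have "x \<in> cls x" if "x \<in> A" for x
      by (rule cls_in(2) [OF subsetD [OF S_set_subset [OF assms] that]])
    ultimately have "A = (\<Union>x\<in>A. cls x)" by auto
    then have "nmul p (-1) A = nmul p (-1) (\<Union>x\<in>A. cls x)" by (rule arg_cong)
    then show ?thesis unfolding nmul_def image_UN .
  qed
  moreover have "S_set (\<Union>x\<in>A. nmul p (-1) (cls x))"
    using S_set_subset [OF assms] by (intro S_set_UN S_set_class neg_class cls_in) blast
  ultimately show ?thesis by simp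
qed

section \<open>Power maps as symmetries of the Schur ring\<close>

lemma nmul_subset_cyl: "nmul p n A \<subseteq> cyl p"
  unfolding nmul_def by (rule image_subsetI) (rule red_in_cyl [OF p_pos])

text \<open>Frobenius: modulo a prime \<open>q\<close> the \<open>q\<close>-th power of the sum of \<open>A\<close> is the sum of the \<open>q\<close>-th powers.\<close>

lemma S_set_nmul_prime:
  assumes "Factorial_Ring.prime (q :: nat)" "finite A" "S_set A" "inj_on (\<lambda>x. red p (smul (int q) x)) A"
  shows "S_set (nmul p (int q) A)"
proof -
  obtain w where w: "class_sum A ^ q = (\<Sum>x\<in>A. Poly_Mapping.single (smul (int q) x) 1) + of_nat q * w"
    using class_sum_power_prime [OF assms(1,2)] by blast
  have q: "q > 1" using assms(1) prime_gt_1_nat by blast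
  have eq: "cf p (class_sum A ^ q) g = of_bool (g \<in> nmul p (int q) A) + int q * cf p w g" for g
  proof -
    have "cf p (\<Sum>x\<in>A. Poly_Mapping.single (smul (int q) x) 1) g =
      (\<Sum>x\<in>A. if red p (smul (int q) x) = g then 1 else 0)"
      by (simp add: cf_sum cf_single)
    also have "\<dots> = (\<Sum>y\<in>nmul p (int q) A. if y = g then 1 else 0)"
      unfolding nmul_def by (subst sum.reindex [OF assms(4)]) simp
    also have "\<dots> = of_bool (g \<in> nmul p (int q) A)"
      using assms(2) by (simp add: nmul_def sum.delta')
    finally show ?thesis using w by simp
  qed
  \<comment> \<open>By injectivity the coefficients modulo q are 0 or 1, and q > 1 tells these
    apart.\<close>
  have iff: "g \<in> nmul p (int q) A \<longleftrightarrow> g \<in> cyl p \<and> \<not> int q dvd cf p (class_sum A ^ q) g" for g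
    using q subsetD [OF nmul_subset_cyl [of "int q" A], of g] unfolding eq
    by (cases "g \<in> nmul p (int q) A") (simp_all add: dvd_add_left_iff)
  have "nmul p (int q) A = {g \<in> cyl p. \<not> int q dvd cf p (class_sum A ^ q) g}"
  proof (rule Set.set_eqI)
    fix g show "g \<in> nmul p (int q) A \<longleftrightarrow> g \<in> {g \<in> cyl p. \<not> int q dvd cf p (class_sum A ^ q) g}"
      unfolding mem_Collect_eq by (rule iff)
  qed
  also have "S_set \<dots>"
    by (rule S_set_Collect_cf [OF S_power [OF S_class_sum [OF assms(2,3)]]])
  finally show ?thesis .
qed

lemma nmul_nmul: "nmul p n (nmul p m A) = nmul p (n * m) A"
  unfolding nmul_def image_image red_simps smul_simps ..

lemma nmul_1: assumes "A \<subseteq> cyl p" shows "nmul p 1 A = A"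
proof -
  have "nmul p 1 A = (\<lambda>x. x) ` A" unfolding nmul_def
    by (rule image_cong [OF refl]) (simp add: red_id subsetD [OF assms])
  then show ?thesis by simp
qed

text \<open>The prime factors of n are applied one at a time. For n = q m, injectivity of the n-th
  power on A passes to the m-th power on A and to the q-th power on its image.\<close>

lemma S_set_nmul_pos:
  assumes "n > 0" "finite A" "S_set A" "inj_on (\<lambda>x. red p (smul (int n) x)) A"
  shows "S_set (nmul p (int n) A)"
  using assms(1,4)
proof (induction n rule: less_induct)
  case (less n)
  show ?case
  proof (cases "n = 1")
    case True
    then have "int n = 1" by simp
    then show ?thesis using assms(3) unfolding \<open>int n = 1\<close> nmul_1 [OF S_set_subset [OF assms(3)]] by simp
  next
    case False
    then obtain q where q: "Factorial_Ring.prime q" "q dvd n" using prime_factor_nat by blast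
    then obtain m where n: "n = q * m" by auto
    have "q > 1" using q(1) prime_gt_1_nat by blast
    with n less.prems have m: "m < n" "m > 0" by auto
    have inj: "inj_on ((\<lambda>x. red p (smul (int q) x)) \<circ> (\<lambda>x. red p (smul (int m) x))) A"
      using less.prems(2) n by (simp add: o_def)
    then have inj_m: "inj_on (\<lambda>x. red p (smul (int m) x)) A" by (rule inj_on_imageI2)
    have "S_set (nmul p (int m) A)" using less.IH [OF m inj_m] .
    moreover have "inj_on (\<lambda>x. red p (smul (int q) x)) (nmul p (int m) A)"
      unfolding nmul_def using inj by (rule inj_on_imageI)
    moreover have "finite (nmul p (int m) A)" using assms(2) by (simp add: nmul_def)
    ultimately have "S_set (nmul p (int q) (nmul p (int m) A))" using S_set_nmul_prime [OF q(1)] by blast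
    then show ?thesis by (simp add: nmul_nmul n)
  qed
qed

lemma S_set_nmul:
  assumes "n \<noteq> 0" "finite A" "S_set A" "inj_on (\<lambda>x. red p (smul n x)) A"
  shows "S_set (nmul p n A)"
proof (cases "n > 0")
  case True
  then obtain m where "n = int m" "m > 0" using zero_less_imp_eq_int by blast
  then show ?thesis using S_set_nmul_pos [of m A] assms(2-4) by simp
next
  case False
  then have "- n > 0" using assms(1) by simp
  then obtain m where m: "- n = int m" "m > 0" using zero_less_imp_eq_int by blast
  then have n: "n = - 1 * int m" by simp
  have "inj_on ((\<lambda>x. red p (smul (-1) x)) \<circ> (\<lambda>x. red p (smul (int m) x))) A"
    using assms(4) unfolding n o_def red_simps smul_simps(8) .
  then have "inj_on (\<lambda>x. red p (smul (int m) x)) A" by (rule inj_on_imageI2)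
  then have "S_set (nmul p (int m) A)" by (rule S_set_nmul_pos [OF m(2) assms(2,3)])
  from S_set_neg [OF this] show ?thesis unfolding nmul_nmul n .
qed

lemma S_set_nmul_coprime:
  assumes "coprime n (int p)" "n \<noteq> 0" "finite A" "S_set A"
  shows "S_set (nmul p n A)"
  using S_set_nmul [OF assms(2-4)] inj_on_subset [OF inj_on_smul_coprime [OF assms(1,2)] S_set_subset [OF assms(4)]]
  by blast

lemma card_nmul:
  assumes "coprime n (int p)" "n \<noteq> 0" "A \<subseteq> cyl p"
  shows "card (nmul p n A) = card A"
  unfolding nmul_def by (rule card_image [OF inj_on_subset [OF inj_on_smul_coprime [OF assms(1,2)] assms(3)]])

end

section \<open>Adjoining the translation by \<open>p\<close>\<close>

text \<open>Multiplication by z^(p l).\<close>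

definition shift :: "nat \<Rightarrow> int \<Rightarrow> int \<times> int \<Rightarrow> int \<times> int" where
  "shift p l x = (fst x + int p * l, snd x)"

text \<open>The set {z^(p m), z^(-p m)}. It turns out to be a union of classes whether or not z^p is
  a class by itself, and so stands in for the translation by z^(p m).\<close>

definition pm :: "nat \<Rightarrow> int \<Rightarrow> (int \<times> int) set" where
  "pm p m = {(int p * m, 0), (- int p * m, 0)}"

lemma fst_shift [simp]: "fst (shift p l x) = fst x + int p * l" and snd_shift [simp]: "snd (shift p l x) = snd x"
  by (simp_all add: shift_def)

lemma shift_in_cyl [simp]: "shift p l x \<in> cyl p \<longleftrightarrow> x \<in> cyl p"
  by (simp add: shift_def cyl_def mem_Times_iff)

lemma shift_shift [simp]: "shift p l (shift p k x) = shift p (k + l) x" and shift_0 [simp]: "shift p 0 x = x"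
  by (simp_all add: shift_def algebra_simps)

lemma red_shift_add: "red p (shift p k x + shift p l y) = shift p (k + l) (red p (x + y))"
  by (simp add: shift_def red_def algebra_simps)

lemma red_neg_shift: "red p (- shift p k x) = shift p (- k) (red p (- x))"
  by (simp add: shift_def red_def algebra_simps)

lemma shift_inj: "shift p l x = shift p l y \<longleftrightarrow> x = y"
  by (auto simp: shift_def prod_eq_iff)

lemma in_cylI: "x \<in> cyl p \<longleftrightarrow> 0 \<le> snd x \<and> snd x < int p"
  by (simp add: cyl_def mem_Times_iff)

context schur_cyl
begin

lemma p_ne_0 [simp]: "p \<noteq> 0" and Suc_0_le_p [simp]: "Suc 0 \<le> p"
  using p_pos by (simp_all add: Suc_le_eq del: p_pos)

lemma cls_cong: "\<lbrakk>x \<in> cyl p; y \<in> cls x\<rbrakk> \<Longrightarrow> cls y = cls x"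
  using cls_eq cls_in by blast

lemma cls_subset_cyl: "x \<in> cyl p \<Longrightarrow> cls x \<subseteq> cyl p"
  using cls_in class_subset by simp

lemma finite_cls: "x \<in> cyl p \<Longrightarrow> finite (cls x)"
  using cls_in finite_class by simp

lemma cls_0: "cls 0 = {0}"
  by (rule cls_eq [OF zero_class]) simp

lemma cls_neg: assumes "x \<in> cyl p" shows "cls (red p (- x)) = nmul p (-1) (cls x)"
proof (rule cls_eq)
  show "nmul p (-1) (cls x) \<in> D" by (intro neg_class cls_in assms)
  have "red p (smul (-1) x) \<in> nmul p (-1) (cls x)"
    unfolding nmul_def by (rule imageI) (rule cls_in(2) [OF assms])
  then show "red p (- x) \<in> nmul p (-1) (cls x)" by simp
qed

lemma S_set_sset_memI: "\<lbrakk>x \<in> A; y \<in> B; z = red p (x + y)\<rbrakk> \<Longrightarrow> z \<in> sset p A B"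
  unfolding sset_def by blast

lemma sset_memE:
  assumes "z \<in> sset p A B" obtains x y where "x \<in> A" "y \<in> B" "z = red p (x + y)"
  using assms unfolding sset_def by blast

lemma coprime_Suc_mult: "coprime (1 + int p * l) (int p)"
proof (rule coprimeI)
  fix c assume "c dvd 1 + int p * l" "c dvd int p"
  then show "is_unit c" by (metis dvd_add_left_iff dvd_mult2)
qed

text \<open>The exponent 1 + p l is 1 on the torsion part and stretches level m to m + p l m, so it
  acts as a translation that depends on the level alone.\<close>

lemma red_smul_Suc_mult: "x \<in> cyl p \<Longrightarrow> red p (smul (1 + int p * l) x) = shift p (l * fst x) x"
proof -
  assume x: "x \<in> cyl p"
  have "((1 + int p * l) * snd x) mod int p = snd x mod int p"
    by (simp add: algebra_simps flip: mod_add_right_eq)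
  with x show ?thesis by (simp add: red_def shift_def in_cylI algebra_simps)
qed

lemma ex_shift: obtains l where "(m :: int) + int p * l > 0"
proof
  have "\<bar>m\<bar> + 1 \<le> int p * (\<bar>m\<bar> + 1)" using p_pos by simp
  then show "m + int p * (\<bar>m\<bar> + 1) > 0" by linarith
qed

end

section \<open>The class of z^p and the levels met by a class\<close>

locale schur_cyl_N = schur_cyl +
  assumes S_set_N: "S_set {(int p * m, 0) | m. True}"
begin

text \<open>If z^(p n) is in the class B of z^p, then the n-th powers of B form a union of classes
  containing z^(p n), hence containing B, and equal sizes make the two sets equal. So z^p is an n-th
  power inside <z^p>, which forces n = 1 or n = -1.\<close>

lemma pm_1_subset: "cls (int p, 0) \<subseteq> pm p 1"
proof -
  let ?x = "(int p, 0) :: int \<times> int" and ?B = "cls (int p, 0)"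
  have x: "?x \<in> cyl p" by (simp add: in_cylI)
  have "?x \<in> {(int p * m, 0) | m. True}" by (rule CollectI) (intro exI [of _ 1], simp)
  from S_set_cls_subset [OF S_set_N this] have BN: "?B \<subseteq> {(int p * m, 0) | m. True}" .
  show ?thesis
  proof
    fix c assume c: "c \<in> ?B"
    then obtain n where n: "c = (int p * n, 0)" using BN by blast
    have "n \<noteq> 0"
    proof
      assume "n = 0"
      then have "c = 0" using n by (simp add: zero_prod_def)
      then have "cls 0 = ?B" using c cls_cong [OF x, of c] by simp
      then have "?x \<in> {0}" using cls_in(2) [OF x] cls_0 by simp
      then show False by (simp add: zero_prod_def)
    qed
    have val: "red p (smul n (int p * m, 0)) = (int p * (n * m), 0)" for m
      by (simp add: red_def smul_def)
    have inj: "inj_on (\<lambda>x. red p (smul n x)) ?B"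
    proof (rule inj_onI)
      fix u v assume "u \<in> ?B" "v \<in> ?B" and eq: "red p (smul n u) = red p (smul n v)"
      then obtain i j where ij: "u = (int p * i, 0)" "v = (int p * j, 0)" using BN by blast
      show "u = v" using eq \<open>n \<noteq> 0\<close> unfolding ij val by simp
    qed
    have S: "S_set (nmul p n ?B)"
      by (rule S_set_nmul [OF \<open>n \<noteq> 0\<close> finite_cls [OF x] S_set_class [OF cls_in(1) [OF x]] inj])
    have "red p (smul n ?x) \<in> nmul p n ?B"
      unfolding nmul_def by (rule imageI) (rule cls_in(2) [OF x])
    then have "c \<in> nmul p n ?B" using val [of 1] n by simp
    then have sub: "?B \<subseteq> nmul p n ?B"
      using S_set_cls_subset [OF S] cls_cong [OF x c] by metis
    have "card (nmul p n ?B) = card ?B" unfolding nmul_def by (rule card_image [OF inj])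
    then have "?B = nmul p n ?B"
      using sub finite_cls [OF x] by (intro card_subset_eq) (simp_all add: nmul_def)
    then have "?x \<in> nmul p n ?B" using cls_in(2) [OF x] by simp
    then obtain u where "u \<in> ?B" "?x = red p (smul n u)" unfolding nmul_def by blast
    then obtain m where "?x = red p (smul n (int p * m, 0))" using BN by blast
    then have "int p * 1 = int p * (n * m)" unfolding val by simp
    then have "n * m = 1" by simp
    then have "n = 1 \<or> n = - 1" by (simp add: zmult_eq_1_iff) auto
    then show "c \<in> pm p 1" unfolding n pm_def by auto
  qed
qed

lemma nmul_pm: "nmul p n (pm p m) = pm p (n * m)"
  by (simp add: nmul_def pm_def red_def smul_def mult_ac)

text \<open>The class of z^p and its inverse make up {z^p, z^-p}; the m-th power map gives the
  rest.\<close>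

lemma S_set_pm: "S_set (pm p m)"
proof -
  let ?x = "(int p, 0) :: int \<times> int" and ?B = "cls (int p, 0)"
  have x: "?x \<in> cyl p" by (simp add: in_cylI)
  have "nmul p (-1) ?B \<subseteq> nmul p (-1) (pm p 1)"
    unfolding nmul_def using pm_1_subset by (rule image_mono)
  also have "nmul p (-1) (pm p 1) = pm p 1" by (simp add: nmul_pm) (simp add: pm_def insert_commute)
  finally have sub: "nmul p (-1) ?B \<subseteq> pm p 1" .
  have "red p (smul (-1) ?x) \<in> nmul p (-1) ?B"
    unfolding nmul_def by (rule imageI) (rule cls_in(2) [OF x])
  then have "(- int p, 0) \<in> nmul p (-1) ?B" by (simp add: red_def)
  with cls_in(2) [OF x] have "pm p 1 \<subseteq> ?B \<union> nmul p (-1) ?B" unfolding pm_def by simp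
  with sub pm_1_subset have "pm p 1 = ?B \<union> nmul p (-1) ?B" by blast
  moreover have B: "S_set ?B" by (rule S_set_class [OF cls_in(1) [OF x]])
  ultimately have S1: "S_set (pm p 1)" using S_set_Un [OF B S_set_neg [OF B]] by simp
  show ?thesis
  proof (cases "m = 0")
    case True
    then have "pm p m = {0}" by (simp add: pm_def zero_prod_def)
    then show ?thesis using S_set_class [OF zero_class] by simp
  next
    case False
    have "inj_on (\<lambda>x. red p (smul m x)) (pm p 1)"
      using False by (simp add: pm_def inj_on_def red_def)
    then have "S_set (nmul p m (pm p 1))" using S_set_nmul [OF False _ S1] by (simp add: pm_def)
    then show ?thesis by (simp add: nmul_pm)
  qed
qed

lemma sset_pm_memI:
  assumes "x \<in> A" "x \<in> cyl p"
  shows "shift p l x \<in> sset p A (pm p l)" "shift p (- l) x \<in> sset p A (pm p l)"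
proof -
  have eq: "shift p l x = red p (x + (int p * l, 0))" "shift p (- l) x = red p (x + (- int p * l, 0))"
    using assms(2) by (simp_all add: shift_def red_def in_cylI)
  show "shift p l x \<in> sset p A (pm p l)" by (rule S_set_sset_memI [OF assms(1) _ eq(1)]) (simp add: pm_def)
  show "shift p (- l) x \<in> sset p A (pm p l)" by (rule S_set_sset_memI [OF assms(1) _ eq(2)]) (simp add: pm_def)
qed

lemma sset_pm_memE:
  assumes "z \<in> sset p A (pm p l)" "A \<subseteq> cyl p"
  obtains x where "x \<in> A" "z = shift p l x \<or> z = shift p (- l) x"
proof -
  obtain x y where xy: "x \<in> A" "y \<in> pm p l" "z = red p (x + y)" using assms(1) by (rule sset_memE)
  have "x \<in> cyl p" using xy(1) assms(2) by blast
  then have "z = shift p l x \<or> z = shift p (- l) x"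
    using xy(2,3) by (auto simp: pm_def shift_def red_def in_cylI)
  with xy(1) show ?thesis by (rule that)
qed

text \<open>Raising a class to the power \<open>1 + pl\<close> and shifting back spreads its levels apart, unless they agree up to sign.\<close>

lemma fst_class:
  assumes C: "C \<in> D" and x: "x \<in> C" and y: "y \<in> C"
  shows "fst y = fst x \<or> fst y = - fst x"
proof -
  have cyl: "C \<subseteq> cyl p" using class_subset [OF C] .
  have fin: "finite C" using finite_class [OF C] .
  define M where "M = Max ((\<lambda>x. \<bar>fst x\<bar>) ` C)"
  have M: "\<bar>fst u\<bar> \<le> M" if "u \<in> C" for u
    unfolding M_def using fin that by (intro Max_ge) simp_all
  define l where "l = 2 * M + 1"
  have M0: "M \<ge> 0" using M [OF x] by simp
  then have l: "l > 2 * M" "l > 0" by (simp_all add: l_def)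
  let ?n = "1 + int p * l"
  have "int p * l > 0" using l by simp
  then have n: "?n \<noteq> 0" by simp
  \<comment> \<open>The exponent 1 + p l moves x by l times its level; one of the two translations
    in \<open>pm\<close> moves it back, so this union of classes contains x and hence y.\<close>
  let ?A = "sset p (nmul p ?n C) (pm p (l * fst x))"
  have S: "S_set ?A"
    by (intro S_set_sset S_set_pm S_set_nmul_coprime coprime_Suc_mult n fin S_set_class C)
  have nm: "nmul p ?n C = (\<lambda>u. shift p (l * fst u) u) ` C"
    unfolding nmul_def by (rule image_cong [OF refl]) (use cyl in \<open>intro red_smul_Suc_mult, blast\<close>)
  have "shift p (l * fst x) x \<in> nmul p ?n C" unfolding nm using x by (rule imageI)
  then have "shift p (- (l * fst x)) (shift p (l * fst x) x) \<in> ?A"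
    by (rule sset_pm_memI(2)) (use x cyl in \<open>simp add: subsetD\<close>)
  then have "x \<in> ?A" by simp
  then have "y \<in> ?A" using S_set_class_subset [OF S C x] y by blast
  then obtain v where "v \<in> nmul p ?n C" and v: "y = shift p (l * fst x) v \<or> y = shift p (- (l * fst x)) v"
    by (rule sset_pm_memE [OF _ nmul_subset_cyl])
  then obtain u where u: "u \<in> C" "v = shift p (l * fst u) u" unfolding nm by blast
  have small: "d = 0" if "fst y = fst u + int p * l * d" for d
  proof (rule ccontr)
    assume "d \<noteq> 0"
    then have "\<bar>d\<bar> \<ge> 1" by simp
    moreover have "int p * l \<ge> l" using p_pos l by simp
    ultimately have "l * 1 \<le> int p * l * \<bar>d\<bar>" using l by (intro mult_mono) auto
    also have "\<dots> = \<bar>fst y - fst u\<bar>" using that l by (simp add: abs_mult)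
    also have "\<dots> \<le> 2 * M" using M [OF y] M [OF u(1)] by linarith
    finally show False using l by simp
  qed
  from v show ?thesis
  proof
    assume "y = shift p (l * fst x) v"
    then have eq: "fst y = fst u + int p * l * (fst u + fst x)" using u(2) by (simp add: algebra_simps)
    have "fst u + fst x = 0" by (rule small [OF eq])
    with eq show ?thesis by simp
  next
    assume "y = shift p (- (l * fst x)) v"
    then have eq: "fst y = fst u + int p * l * (fst u - fst x)" using u(2) by (simp add: algebra_simps)
    have "fst u - fst x = 0" by (rule small [OF eq])
    with eq show ?thesis by simp
  qed
qed

lemma fst_cls: "\<lbrakk>x \<in> cyl p; y \<in> cls x\<rbrakk> \<Longrightarrow> fst y = fst x \<or> fst y = - fst x"
  using fst_class [of "cls x" x y] cls_in by simp

lemma S_set_levels: "S_set {x \<in> cyl p. fst x = m \<or> fst x = - m}"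
proof (rule isSI)
  fix C x y assume C: "C \<in> D" "x \<in> C" "y \<in> C" and x: "x \<in> {x \<in> cyl p. fst x = m \<or> fst x = - m}"
  have "y \<in> cyl p" using class_subset [OF C(1)] C(3) by blast
  then show "y \<in> {x \<in> cyl p. fst x = m \<or> fst x = - m}" using fst_class [OF C] x by auto
qed simp

text \<open>The class of x times {z^(p l), z^(-p l)} reaches level \<open>fst x + p l\<close> only
  through z^(p l): the other translation would require \<open>l = 0\<close> or
  \<open>fst x + p l = 0\<close>.\<close>

lemma cls_shift_imp:
  assumes x: "x \<in> cyl p" and y: "y \<in> cyl p" "fst y = fst x"
    and m: "fst x \<noteq> 0" "fst x + int p * l \<noteq> 0" and eq: "cls (shift p l y) = cls (shift p l x)"
  shows "cls y = cls x"
proof (cases "l = 0")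
  case False
  let ?A = "sset p (cls x) (pm p l)"
  have S: "S_set ?A" by (intro S_set_sset S_set_pm S_set_class cls_in x)
  have "shift p l x \<in> ?A" by (rule sset_pm_memI(1) [OF cls_in(2) [OF x] x])
  from S_set_cls_subset [OF S this] have "shift p l y \<in> ?A" using cls_in(2) [of "shift p l y"] eq y(1) by auto
  then obtain u where u: "u \<in> cls x" and v: "shift p l y = shift p l u \<or> shift p l y = shift p (- l) u"
    by (rule sset_pm_memE [OF _ cls_subset_cyl [OF x]])
  have fu: "fst u = fst x \<or> fst u = - fst x" by (rule fst_cls [OF x u])
  have pl: "int p * l \<noteq> 0" using False p_pos by simp
  have "shift p l y \<noteq> shift p (- l) u"
  proof
    assume "shift p l y = shift p (- l) u"
    then have "fst (shift p l y) = fst (shift p (- l) u)" by simp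
    then have "fst x + int p * l = fst u - int p * l" using y(2) by simp
    with fu m pl show False by linarith
  qed
  with v have "y = u" by (simp add: shift_inj)
  then show ?thesis using cls_cong [OF x u] by simp
qed (use eq in simp)

section \<open>Comparing classes across levels, and the Schur ring of slices\<close>

lemma cls_shift:
  assumes x: "x \<in> cyl p" and y: "y \<in> cyl p" "fst y = fst x"
    and m: "fst x \<noteq> 0" "fst x + int p * l \<noteq> 0"
  shows "cls (shift p l y) = cls (shift p l x) \<longleftrightarrow> cls y = cls x"
proof
  show "cls (shift p l y) = cls (shift p l x) \<Longrightarrow> cls y = cls x"
    by (rule cls_shift_imp [OF assms])
  assume "cls y = cls x"
  then show "cls (shift p l y) = cls (shift p l x)"
    by (intro cls_shift_imp [of "shift p l x" "shift p l y" "- l"]) (use assms in simp_all)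
qed

text \<open>The classes of the Schur ring that \<open>D\<close> becomes once \<open>z\<^sup>p\<close> is adjoined. Level \<open>0\<close> is read off at level \<open>p\<close>.\<close>

definition up :: "int \<times> int \<Rightarrow> int \<times> int" where
  "up x = (if fst x = 0 then shift p 1 x else x)"

definition slice :: "int \<times> int \<Rightarrow> (int \<times> int) set" where
  "slice x = {y \<in> cyl p. fst y = fst x \<and> cls (up y) = cls (up x)}"

definition slices :: "(int \<times> int) set set" where
  "slices = slice ` cyl p"

text \<open>Any translate off level 0 may be used to compare classes, not only the one chosen by
  \<open>up\<close>. This freedom makes slices compatible with translation, inversion and
  products.\<close>

lemma slice_iff:
  assumes x: "x \<in> cyl p" and l: "fst x + int p * l \<noteq> 0"
  shows "y \<in> slice x \<longleftrightarrow> y \<in> cyl p \<and> fst y = fst x \<and> cls (shift p l y) = cls (shift p l x)"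
proof (cases "y \<in> cyl p \<and> fst y = fst x")
  case True
  then have y: "y \<in> cyl p" "fst y = fst x" by simp_all
  have "cls (up y) = cls (up x) \<longleftrightarrow> cls (shift p l y) = cls (shift p l x)"
  proof (cases "fst x = 0")
    case True
    have "cls (shift p (l - 1) (shift p 1 y)) = cls (shift p (l - 1) (shift p 1 x)) \<longleftrightarrow> cls (shift p 1 y) = cls (shift p 1 x)"
      by (rule cls_shift) (use x y True l p_pos in \<open>simp_all add: algebra_simps\<close>)
    then show ?thesis using True y(2) by (simp add: up_def)
  next
    case False
    show ?thesis using cls_shift [OF x y False l] False y(2) by (simp add: up_def)
  qed
  with y show ?thesis by (simp add: slice_def)
qed (auto simp: slice_def)

lemma slice_self: "x \<in> cyl p \<Longrightarrow> x \<in> slice x"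
  by (simp add: slice_def)

lemma slice_cong: "y \<in> slice x \<Longrightarrow> slice y = slice x"
  by (simp add: slice_def)

lemma slice_subset_lev: "slice x \<subseteq> lev p (fst x)"
  by (rule subsetI) (simp add: slice_def lev_iff)

lemma finite_slice: "finite (slice x)"
  using slice_subset_lev finite_lev by (rule finite_subset)

lemma slice_p: "slice (int p, 0) = {(int p, 0)}"
proof -
  have x: "(int p, 0) \<in> cyl p" by (simp add: in_cylI)
  have "y = (int p, 0)" if "y \<in> slice (int p, 0)" for y
  proof -
    have y: "y \<in> cyl p" "fst y = int p" "cls y = cls (int p, 0)"
      using that slice_iff [OF x, of 0 y] by simp_all
    then have "y \<in> pm p 1" using cls_in(2) [OF y(1)] pm_1_subset by blast
    then show ?thesis using y(2) by (auto simp: pm_def)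
  qed
  then show ?thesis using slice_self [OF x] by blast
qed

lemma slice_shift:
  assumes "x \<in> cyl p" shows "shift p k y \<in> slice (shift p k x) \<longleftrightarrow> y \<in> slice x"
proof -
  obtain l where l: "fst x + int p * l > 0" by (rule ex_shift)
  have "shift p k y \<in> slice (shift p k x) \<longleftrightarrow> shift p k y \<in> cyl p \<and> fst (shift p k y) = fst (shift p k x) \<and>
      cls (shift p (l - k) (shift p k y)) = cls (shift p (l - k) (shift p k x))"
    by (rule slice_iff) (use assms l in \<open>simp_all add: algebra_simps\<close>)
  also have "\<dots> \<longleftrightarrow> y \<in> slice x" using slice_iff [OF assms, of l y] l by simp
  finally show ?thesis .
qed

lemma slice_0: "slice 0 = {0}"
proof -
  have 0: "(0 :: int \<times> int) \<in> cyl p" by (simp add: in_cylI)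
  have "y = 0" if "y \<in> slice 0" for y
  proof -
    have "shift p 1 y \<in> slice (shift p 1 0)" using that by (simp only: slice_shift [OF 0])
    then have "shift p 1 y \<in> {(int p, 0)}" using slice_p by (simp add: shift_def)
    then show ?thesis by (simp add: shift_def prod_eq_iff)
  qed
  then show ?thesis using slice_self [OF 0] by blast
qed

lemma slice_neg: assumes x: "x \<in> cyl p" and y: "y \<in> slice x" shows "red p (- y) \<in> slice (red p (- x))"
proof -
  obtain l where l: "fst x + int p * l > 0" by (rule ex_shift)
  have y': "y \<in> cyl p" "fst y = fst x" "cls (shift p l y) = cls (shift p l x)"
    using y slice_iff [OF x, of l y] l by simp_all
  have "cls (red p (- shift p l y)) = cls (red p (- shift p l x))"
    using cls_neg [of "shift p l y"] cls_neg [of "shift p l x"] x y' by simp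
  then have "cls (shift p (- l) (red p (- y))) = cls (shift p (- l) (red p (- x)))"
    by (simp only: red_neg_shift)
  then show ?thesis
    using slice_iff [of "red p (- x)" "- l" "red p (- y)"] l y'(2) by (simp add: red_in_cyl)
qed

text \<open>After translation both factors sit on positive levels m and n. Their classes meet only
  the levels m, -m and n, -n, and the level m + n arises from m and n alone; so the structure
  constants of the slices are structure constants of the original ring.\<close>

lemma card_slice_slice:
  assumes x: "x \<in> cyl p" and y: "y \<in> cyl p" and g: "fst g = fst x + fst y"
    and l: "fst x + int p * k > 0" "fst y + int p * l > 0"
  shows "card {(u, v). u \<in> slice x \<and> v \<in> slice y \<and> red p (u + v) = g} =
    card {(u, v). u \<in> cls (shift p k x) \<and> v \<in> cls (shift p l y) \<and> red p (u + v) = shift p (k + l) g}"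
proof (rule bij_betw_same_card)
  let ?f = "\<lambda>(u, v). (shift p k u, shift p l v)"
  let ?A = "{(u, v). u \<in> slice x \<and> v \<in> slice y \<and> red p (u + v) = g}"
  let ?B = "{(u, v). u \<in> cls (shift p k x) \<and> v \<in> cls (shift p l y) \<and> red p (u + v) = shift p (k + l) g}"
  have ux: "shift p k u \<in> cls (shift p k x)" if "u \<in> slice x" for u
    using that slice_iff [OF x, of k u] l cls_in(2) [of "shift p k u"] by auto
  have vy: "shift p l v \<in> cls (shift p l y)" if "v \<in> slice y" for v
    using that slice_iff [OF y, of l v] l cls_in(2) [of "shift p l v"] by auto
  have xu: "shift p (- k) u \<in> slice x" if "u \<in> cls (shift p k x)" "fst u = fst x + int p * k" for u
  proof -
    have "u \<in> cyl p" using that(1) cls_subset_cyl [of "shift p k x"] x by auto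
    moreover have "cls u = cls (shift p k x)" using that(1) x by (intro cls_cong) simp_all
    ultimately show ?thesis using that(2) l slice_iff [OF x, of k "shift p (- k) u"] by simp
  qed
  have yv: "shift p (- l) v \<in> slice y" if "v \<in> cls (shift p l y)" "fst v = fst y + int p * l" for v
  proof -
    have "v \<in> cyl p" using that(1) cls_subset_cyl [of "shift p l y"] y by auto
    moreover have "cls v = cls (shift p l y)" using that(1) y by (intro cls_cong) simp_all
    ultimately show ?thesis using that(2) l slice_iff [OF y, of l "shift p (- l) v"] by simp
  qed
  show "bij_betw ?f ?A ?B"
  proof (rule bij_betw_imageI)
    show "inj_on ?f ?A" by (rule inj_onI) (clarsimp simp: shift_inj)
    have "?f ` ?A \<subseteq> ?B" using ux vy by (clarsimp simp: red_shift_add)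
    moreover have "z \<in> ?f ` ?A" if z: "z \<in> ?B" for z
    proof -
      obtain u v where zuv: "z = (u, v)" by (cases z)
      with z have u: "u \<in> cls (shift p k x)" and v: "v \<in> cls (shift p l y)"
        and eq: "red p (u + v) = shift p (k + l) g" by simp_all
      have fu: "fst u = fst x + int p * k \<or> fst u = - (fst x + int p * k)"
        using fst_cls [OF _ u] x by simp
      have fv: "fst v = fst y + int p * l \<or> fst v = - (fst y + int p * l)"
        using fst_cls [OF _ v] y by simp
      have "fst (red p (u + v)) = fst (shift p (k + l) g)" using eq by simp
      then have "fst u + fst v = (fst x + int p * k) + (fst y + int p * l)"
        using g by (simp add: algebra_simps)
      with fu fv l have fuv: "fst u = fst x + int p * k" "fst v = fst y + int p * l" by linarith+
      have "red p (shift p (- k) u + shift p (- l) v) = shift p (- k + - l) (red p (u + v))"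
        by (rule red_shift_add)
      also have "\<dots> = g" unfolding eq by simp
      finally have "(shift p (- k) u, shift p (- l) v) \<in> ?A" using xu [OF u fuv(1)] yv [OF v fuv(2)] by simp
      then have "?f (shift p (- k) u, shift p (- l) v) \<in> ?f ` ?A" by (rule imageI)
      then show ?thesis unfolding zuv by simp
    qed
    ultimately show "?f ` ?A = ?B" by blast
  qed
qed

lemma schur_cyl_slices: "schur_cyl p slices"
proof
  show "Factorial_Ring.prime p" by (rule prime_p)
  show "partition_on (cyl p) slices"
  proof (rule partition_onI)
    show "\<Union> slices = cyl p"
    proof
      show "\<Union> slices \<subseteq> cyl p" unfolding slices_def slice_def by blast
      show "cyl p \<subseteq> \<Union> slices" unfolding slices_def using slice_self by blast
    qed
    show "{} \<notin> slices" unfolding slices_def using slice_self by blast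
    fix A B assume A: "A \<in> slices" and B: "B \<in> slices" and ne: "A \<noteq> B"
    obtain x y where xy: "A = slice x" "B = slice y" using A B unfolding slices_def by blast
    have "False" if "u \<in> A" "u \<in> B" for u
      using that ne unfolding xy using slice_cong [of u x] slice_cong [of u y] by simp
    then show "disjnt A B" unfolding disjnt_def by blast
  qed
  show "finite C" if "C \<in> slices" for C using that unfolding slices_def using finite_slice by blast
  have 0: "(0 :: int \<times> int) \<in> cyl p" by (simp add: in_cylI)
  show "{0} \<in> slices" unfolding slices_def using imageI [OF 0, of slice] by (simp only: slice_0)
  show "nmul p (-1) C \<in> slices" if C: "C \<in> slices" for C
  proof -
    obtain x where x: "x \<in> cyl p" "C = slice x" using C unfolding slices_def by blast
    have "nmul p (-1) C = slice (red p (- x))"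
    proof
      show "nmul p (-1) C \<subseteq> slice (red p (- x))"
        unfolding nmul_def x(2) by (rule image_subsetI) (use slice_neg [OF x(1)] in simp)
      show "slice (red p (- x)) \<subseteq> nmul p (-1) C"
      proof
        fix y assume y: "y \<in> slice (red p (- x))"
        then have yc: "y \<in> cyl p" using slice_subset_lev [of "red p (- x)"] unfolding lev_def cyl_def by blast
        have "red p (- y) \<in> slice (red p (- red p (- x)))" by (rule slice_neg [OF _ y]) (simp add: red_in_cyl)
        then have "red p (- y) \<in> C" using x by (simp add: red_id)
        then have "red p (smul (-1) (red p (- y))) \<in> nmul p (-1) C" unfolding nmul_def by (rule imageI)
        then show "y \<in> nmul p (-1) C" using yc by (simp add: red_id)
      qed
    qed
    then show ?thesis unfolding slices_def by (simp add: red_in_cyl)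
  qed
  fix C E K g h assume C: "C \<in> slices" and E: "E \<in> slices" and K: "K \<in> slices" and g: "g \<in> K" and h: "h \<in> K"
  obtain x where x: "x \<in> cyl p" "C = slice x" using C unfolding slices_def by blast
  obtain y where y: "y \<in> cyl p" "E = slice y" using E unfolding slices_def by blast
  obtain z where z: "z \<in> cyl p" "K = slice z" using K unfolding slices_def by blast
  have gh: "g \<in> cyl p" "h \<in> slice g" "fst h = fst g"
    using g h unfolding z(2) slice_def by simp_all
  show "card {(u, v). u \<in> C \<and> v \<in> E \<and> red p (u + v) = g} = card {(u, v). u \<in> C \<and> v \<in> E \<and> red p (u + v) = h}"
  proof (cases "fst g = fst x + fst y")
    case True
    obtain k where k: "fst x + int p * k > 0" by (rule ex_shift)
    obtain l where l: "fst y + int p * l > 0" by (rule ex_shift)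
    have "cls (shift p (k + l) h) = cls (shift p (k + l) g)"
    proof -
      have "fst g + int p * (k + l) > 0" using k l True by (simp add: algebra_simps)
      then show ?thesis using gh slice_iff [OF gh(1), of "k + l" h] by simp
    qed
    moreover have "h \<in> cyl p" using gh(2) by (simp add: slice_def)
    ultimately have "card {(u, v). u \<in> cls (shift p k x) \<and> v \<in> cls (shift p l y) \<and> red p (u + v) = shift p (k + l) g} =
      card {(u, v). u \<in> cls (shift p k x) \<and> v \<in> cls (shift p l y) \<and> red p (u + v) = shift p (k + l) h}"
      by (intro prod_const [of _ _ "cls (shift p (k + l) g)"] cls_in)
        (use x(1) y(1) gh(1) cls_in(2) [of "shift p (k + l) g"] cls_in(2) [of "shift p (k + l) h"] in simp_all)
    then show ?thesis unfolding x(2) y(2)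
      using card_slice_slice [OF x(1) y(1) _ k l] True gh(3) by simp
  next
    case False
    have "{(u, v). u \<in> C \<and> v \<in> E \<and> red p (u + v) = w} = {}" if "fst w = fst g" for w
    proof -
      have "red p (u + v) \<noteq> w" if "u \<in> C" "v \<in> E" for u v
      proof
        assume "red p (u + v) = w"
        then have "fst (red p (u + v)) = fst w" by simp
        then show False using that \<open>fst w = fst g\<close> False unfolding x(2) y(2) slice_def by simp
      qed
      then show ?thesis by blast
    qed
    from this [of g] this [of h] show ?thesis using gh(3) by (simp only: card.empty)
  qed
qed

end

section \<open>Schur rings in which \<open>z\<^sup>p\<close> is a class\<close>

context schur_cyl
begin

text \<open>The class of x t times the singleton t^-1 is a union of classes containing x, hence it
  contains the class of x.\<close>

lemma class_shift_imp:
  assumes t: "{t} \<in> D" and x: "x \<in> cyl p" and y: "y \<in> cls x"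
  shows "red p (y + t) \<in> cls (red p (x + t))"
proof -
  let ?u = "red p (x + t)" and ?t = "nmul p (-1) {t}"
  have u: "?u \<in> cyl p" by (simp add: red_in_cyl)
  have S: "S_set (sset p (cls ?u) ?t)" by (intro S_set_sset S_set_class cls_in u neg_class t)
  have tt: "?t = {red p (- t)}" by (simp add: nmul_def)
  have "x \<in> sset p (cls ?u) ?t"
    by (rule S_set_sset_memI [OF cls_in(2) [OF u]]) (auto simp: tt red_id [OF x])
  then have "y \<in> sset p (cls ?u) ?t" using S_set_cls_subset [OF S] y by blast
  then obtain v w where vw: "v \<in> cls ?u" "w \<in> ?t" "y = red p (v + w)" by (rule sset_memE)
  have "red p (y + t) = red p v" using vw(2,3) by (simp add: tt)
  also have "\<dots> = v" using vw(1) cls_subset_cyl [OF u] red_id by blast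
  finally show ?thesis using vw(1) by simp
qed

lemma class_shift:
  assumes t: "{t} \<in> D" and x: "x \<in> cyl p" and y: "y \<in> cyl p"
  shows "red p (y + t) \<in> cls (red p (x + t)) \<longleftrightarrow> y \<in> cls x"
proof
  show "y \<in> cls x \<Longrightarrow> red p (y + t) \<in> cls (red p (x + t))" by (rule class_shift_imp [OF t x])
  assume *: "red p (y + t) \<in> cls (red p (x + t))"
  have t': "{red p (- t)} \<in> D" using neg_class [OF t] by (simp add: nmul_def)
  have "red p (red p (y + t) + red p (- t)) \<in> cls (red p (red p (x + t) + red p (- t)))"
    by (rule class_shift_imp [OF t' _ *]) (simp add: red_in_cyl)
  then show "y \<in> cls x" by (simp add: red_id [OF x] red_id [OF y])
qed

lemma singleton_multiple: assumes "{t} \<in> D" shows "{red p (smul n t)} \<in> D"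
proof (cases "n = 0")
  case True
  have "red p (smul n t) = 0" using True by (simp add: red_def prod_eq_iff)
  then show ?thesis using zero_class by simp
next
  case False
  have "S_set (nmul p n {t})" by (rule S_set_nmul [OF False _ S_set_class [OF assms]]) simp_all
  then show ?thesis by (intro S_set_singleton_class) (simp add: nmul_def)
qed

definition level_classes :: "int \<Rightarrow> (int \<times> int) set set" where
  "level_classes m = {C \<in> D. C \<subseteq> lev p m}"

lemma finite_classes: "finite (level_classes m)"
proof (rule finite_subset)
  show "level_classes m \<subseteq> Pow (lev p m)" unfolding level_classes_def by (rule subsetI) simp
qed simp

end

lemma lev_subset_cyl: "lev p m \<subseteq> cyl p"
  by (rule subsetI) (simp add: lev_iff)

lemma nmul_lev_subset: "p > 0 \<Longrightarrow> nmul p n (lev p m) \<subseteq> lev p (n * m)"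
  unfolding nmul_def by (rule image_subsetI) (simp add: lev_iff red_in_cyl)

text \<open>The situation of the slices: translation by z^p preserves the partition, and no class
  spreads over two levels.\<close>

locale schur_cyl_A = schur_cyl +
  assumes p_class: "{(int p, 0)} \<in> D"
    and level_class: "\<lbrakk>C \<in> D; x \<in> C; y \<in> C\<rbrakk> \<Longrightarrow> fst x = fst y"
begin

lemma cls_shift_iff:
  assumes x: "x \<in> cyl p" and y: "y \<in> cyl p"
  shows "shift p l y \<in> cls (shift p l x) \<longleftrightarrow> y \<in> cls x"
proof -
  have eq: "shift p l u = red p (u + red p (smul l (int p, 0)))" if "u \<in> cyl p" for u
    using that by (simp add: shift_def red_def in_cylI algebra_simps)
  show ?thesis
    unfolding eq [OF x] eq [OF y] by (rule class_shift [OF singleton_multiple [OF p_class] x y])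
qed

lemma cls_lev: assumes "x \<in> cyl p" shows "cls x \<subseteq> lev p (fst x)"
proof
  fix y assume y: "y \<in> cls x"
  then have "fst y = fst x" using level_class [of "cls x" y x] cls_in [OF assms] by simp
  then show "y \<in> lev p (fst x)" using y cls_subset_cyl [OF assms] by (auto simp: lev_iff)
qed

lemma cls_in_classes: "x \<in> lev p m \<Longrightarrow> cls x \<in> level_classes m"
  unfolding level_classes_def using cls_lev [of x] cls_in [of x] by (simp add: lev_iff)

lemma classes_Union: "\<Union> (level_classes m) = lev p m"
proof
  show "\<Union> (level_classes m) \<subseteq> lev p m" by (rule Union_least) (simp add: level_classes_def)
  show "lev p m \<subseteq> \<Union> (level_classes m)"
  proof
    fix x assume x: "x \<in> lev p m"
    then have "x \<in> cls x" by (intro cls_in) (simp add: lev_iff)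
    then show "x \<in> \<Union> (level_classes m)" by (rule UnionI [OF cls_in_classes [OF x]])
  qed
qed

lemma card_cls_shift: assumes "x \<in> cyl p" shows "card (cls (shift p l x)) = card (cls x)"
proof -
  have "cls (shift p l x) = shift p l ` cls x"
  proof
    show "shift p l ` cls x \<subseteq> cls (shift p l x)"
      using cls_shift_iff [OF assms] cls_subset_cyl [OF assms] by blast
    show "cls (shift p l x) \<subseteq> shift p l ` cls x"
    proof
      fix y assume y: "y \<in> cls (shift p l x)"
      then have yc: "y \<in> cyl p" using cls_subset_cyl [of "shift p l x"] assms by auto
      have "shift p (- l) y \<in> cls x" using cls_shift_iff [OF assms, of "shift p (- l) y" l] y yc by simp
      then have "shift p l (shift p (- l) y) \<in> shift p l ` cls x" by (rule imageI)
      then show "y \<in> shift p l ` cls x" by simp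
    qed
  qed
  moreover have "inj_on (shift p l) (cls x)" by (rule inj_onI) (simp only: shift_inj)
  ultimately show ?thesis by (simp add: card_image)
qed

text \<open>A Bezout coefficient. It is again a nonzero unit modulo p, so the exponent n' is
  injective on the whole group.\<close>

lemma coprime_inverse:
  assumes "coprime n (int p)"
  obtains n' l where "n' * n = 1 + int p * l" "coprime n' (int p)" "n' \<noteq> 0"
proof -
  obtain u v where uv: "u * n + v * int p = 1"
    using bezout_int [of n "int p"] assms by auto
  have "1 = u * n + int p * v" using uv by (simp add: mult.commute)
  have "coprime u (int p)"
  proof (rule coprimeI)
    fix c assume "c dvd u" "c dvd int p"
    then have "c dvd u * n + v * int p" by simp
    then show "is_unit c" using uv by simp
  qed
  moreover have "u \<noteq> 0"
  proof
    assume "u = 0"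
    then have "int p dvd 1" using uv by (metis add_0 dvd_triv_right mult_zero_left)
    then show False using p_gt_1 by simp
  qed
  moreover have "u * n = 1 + int p * (- v)" using uv by (simp add: algebra_simps)
  ultimately show ?thesis using that by blast
qed

text \<open>With C the class of x, the n-th powers of C include the class of x^n. The n'-th powers
  of that class in turn include a translate of C, by \<open>red_smul_Suc_mult\<close>, and
  translates keep the size; so the inclusion is an equality.\<close>

lemma cls_nmul:
  assumes n: "coprime n (int p)" "n \<noteq> 0" and x: "x \<in> cyl p"
  shows "cls (red p (smul n x)) = nmul p n (cls x)"
proof -
  let ?A = "nmul p n (cls x)" and ?y = "red p (smul n x)"
  let ?B = "cls ?y"
  obtain n' l where n': "n' * n = 1 + int p * l" "coprime n' (int p)" "n' \<noteq> 0"
    using coprime_inverse [OF n(1)] by blast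
  have y: "?y \<in> cyl p" by (simp add: red_in_cyl)
  have SA: "S_set ?A" by (intro S_set_nmul_coprime n finite_cls S_set_class cls_in x)
  have "?y \<in> ?A" unfolding nmul_def by (rule imageI) (rule cls_in(2) [OF x])
  then have sub: "?B \<subseteq> ?A" by (rule S_set_cls_subset [OF SA])
  have SB: "S_set (nmul p n' ?B)" by (intro S_set_nmul_coprime n' finite_cls S_set_class cls_in y)
  have "red p (smul n' ?y) \<in> nmul p n' ?B" unfolding nmul_def by (rule imageI) (rule cls_in(2) [OF y])
  moreover have "red p (smul n' ?y) = shift p (l * fst x) x"
    using red_smul_Suc_mult [OF x, of l] n'(1) by simp
  ultimately have sub2: "cls (shift p (l * fst x) x) \<subseteq> nmul p n' ?B" using S_set_cls_subset [OF SB] by simp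
  have fin: "finite (nmul p n' ?B)" "finite ?A" using finite_cls x y by (simp_all add: nmul_def)
  have "card ?A = card (cls x)" by (rule card_nmul [OF n cls_subset_cyl [OF x]])
  also have "\<dots> = card (cls (shift p (l * fst x) x))" using card_cls_shift [OF x] by simp
  also have "\<dots> \<le> card (nmul p n' ?B)" by (rule card_mono [OF fin(1) sub2])
  also have "\<dots> = card ?B" by (rule card_nmul [OF n'(2,3) cls_subset_cyl [OF y]])
  finally have "card ?A \<le> card ?B" .
  then have "card ?B = card ?A" using card_mono [OF fin(2) sub] by (rule antisym [rotated])
  then show ?thesis by (rule card_subset_eq [OF fin(2) sub])
qed

lemma coprime_iff_not_dvd: "coprime n (int p) \<longleftrightarrow> \<not> int p dvd n"
proof -
  have p: "Factorial_Ring.prime (int p)" using prime_p by simp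
  show ?thesis
  proof
    assume "coprime n (int p)"
    then show "\<not> int p dvd n" using p_gt_1 by (auto dest: coprime_common_divisor [of n "int p" "int p"])
  next
    assume "\<not> int p dvd n"
    then have "coprime (int p) n" by (rule prime_imp_coprime [OF p])
    then show "coprime n (int p)" by (simp add: coprime_commute)
  qed
qed

lemma lev_class_multiple:
  assumes "lev p 1 \<in> D" "\<not> int p dvd m" shows "lev p m \<in> D"
proof -
  have m: "coprime m (int p)" "m \<noteq> 0" using assms(2) coprime_iff_not_dvd by auto
  have x: "(1, 0) \<in> cyl p" by (simp add: in_cylI)
  have "cls (1, 0) = lev p 1" by (rule cls_eq [OF assms(1)]) (simp add: lev_def)
  then have eq: "cls (red p (smul m (1, 0))) = nmul p m (lev p 1)" using cls_nmul [OF m x] by simp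
  have "card (nmul p m (lev p 1)) = card (lev p 1)" by (rule card_nmul [OF m lev_subset_cyl])
  then have "nmul p m (lev p 1) = lev p m"
    using nmul_lev_subset [OF p_pos, of m 1] by (intro card_subset_eq) simp_all
  with eq have "cls (red p (smul m (1, 0))) = lev p m" by simp
  then show ?thesis using cls_in(1) [of "red p (smul m (1, 0))"] by (simp add: red_in_cyl)
qed

lemma one_in_cyl: "(0, 1) \<in> cyl p"
  using p_gt_1 by (simp add: in_cylI)

lemma cls_zero_level:
  assumes "0 < k" "k < int p" shows "cls (0, k) = nmul p k (cls (0, 1))"
proof -
  have "\<not> int p dvd k" using assms by (simp add: zdvd_not_zless)
  then have k: "coprime k (int p)" "k \<noteq> 0" using coprime_iff_not_dvd assms(1) by auto
  have "red p (smul k (0, 1)) = (0, k)" using assms by (simp add: red_def)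
  then show ?thesis using cls_nmul [OF k one_in_cyl] by simp
qed

section \<open>Counting classes and their sizes level by level\<close>

lemma disjoint_classes: "disjoint (level_classes m)"
  using partition unfolding partition_on_def level_classes_def by (simp add: disjoint_def)

lemma sum_classes: "(\<Sum>x\<in>lev p m. f x) = (\<Sum>C\<in>level_classes m. \<Sum>x\<in>C. f x)"
proof -
  have "(\<Sum>x\<in>\<Union> (level_classes m). f x) = (sum \<circ> sum) f (level_classes m)"
  proof (rule sum.Union_disjoint)
    show "\<forall>A\<in>level_classes m. finite A" unfolding level_classes_def using finite_class by simp
    show "\<forall>A\<in>level_classes m. \<forall>B\<in>level_classes m. A \<noteq> B \<longrightarrow> A \<inter> B = {}"
      using disjoint_classes unfolding disjoint_def by blast
  qed
  then show ?thesis by (simp only: classes_Union o_def)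
qed

lemma zero_in_classes: "{0} \<in> level_classes 0"
  unfolding level_classes_def using zero_class by (simp add: lev_def zero_prod_def)

lemmas sum_classes_0 = sum.remove [OF finite_classes zero_in_classes]

text \<open>The size of the class of the torsion generator, shared by every class at level 0 other
  than the trivial one.\<close>

definition h :: nat where "h = card (cls (0, 1))"

lemma card_class_0: assumes "C \<in> level_classes 0 - {{0}}" shows "card C = h"
proof -
  have C: "C \<in> D" "C \<subseteq> lev p 0" "C \<noteq> {0}" using assms unfolding level_classes_def by auto
  obtain x where x: "x \<in> C" using class_nonempty [OF C(1)] by blast
  have "x \<noteq> 0" using class_eq [OF C(1) zero_class x] C(3) by auto
  moreover have "x \<in> lev p 0" using x C(2) by blast
  ultimately have "x = (0, snd x)" "0 \<le> snd x" "snd x < int p" "snd x \<noteq> 0"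
    by (simp_all add: lev_iff in_cylI prod_eq_iff)
  then obtain k where k: "x = (0, k)" "0 \<le> k" "k < int p" "k \<noteq> 0" by blast
  have "\<not> int p dvd k" using k by (simp add: zdvd_not_zless)
  then have ck: "coprime k (int p)" using coprime_iff_not_dvd by blast
  have "C = nmul p k (cls (0, 1))"
    using cls_zero_level [of k] cls_eq [OF C(1) x] k by simp
  then show ?thesis
    unfolding h_def using card_nmul [OF ck k(4) cls_subset_cyl [OF one_in_cyl]] by simp
qed

lemma h_classes: "(card (level_classes 0) - 1) * h = p - 1"
proof -
  have "p = (\<Sum>x\<in>lev p 0. 1)" by simp
  also have "\<dots> = (\<Sum>C\<in>level_classes 0. card C)" by (simp only: sum_classes card_eq_sum)
  also have "\<dots> = 1 + (\<Sum>C\<in>level_classes 0 - {{0}}. card C)"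
    unfolding sum_classes_0 by simp
  also have "(\<Sum>C\<in>level_classes 0 - {{0}}. card C) = (\<Sum>C\<in>level_classes 0 - {{0}}. h)"
    by (rule sum.cong [OF refl]) (rule card_class_0)
  also have "\<dots> = (card (level_classes 0) - 1) * h"
    using zero_in_classes finite_classes [of 0] by (simp add: card_Diff_singleton)
  finally show ?thesis by simp
qed

lemma sum_card_classes: "(\<Sum>C\<in>level_classes m. card C) = p"
proof -
  have "(\<Sum>C\<in>level_classes m. card C) = (\<Sum>x\<in>lev p m. 1)" by (simp only: sum_classes card_eq_sum)
  then show ?thesis by simp
qed

text \<open>The coefficient of g in K K^-1: the number of ways to write g as a quotient of two
  elements of K.\<close>

definition autocorr :: "(int \<times> int) set \<Rightarrow> int \<times> int \<Rightarrow> nat" where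
  "autocorr K g = card {(x, y). x \<in> K \<and> y \<in> nmul p (-1) K \<and> red p (x + y) = g}"

lemma autocorr_const: "\<lbrakk>K \<in> D; C \<in> D; g \<in> C; g' \<in> C\<rbrakk> \<Longrightarrow> autocorr K g = autocorr K g'"
  unfolding autocorr_def by (rule prod_const [OF _ neg_class])

lemma autocorr_0: assumes "K \<in> D" shows "autocorr K 0 = card K"
proof -
  have "{(x, y). x \<in> K \<and> y \<in> nmul p (-1) K \<and> red p (x + y) = 0} = (\<lambda>x. (x, red p (- x))) ` K"
  proof
    show "(\<lambda>x. (x, red p (- x))) ` K \<subseteq> {(x, y). x \<in> K \<and> y \<in> nmul p (-1) K \<and> red p (x + y) = 0}"
    proof (rule image_subsetI)
      fix x assume x: "x \<in> K"
      have "red p (smul (-1) x) \<in> nmul p (-1) K" unfolding nmul_def using x by (rule imageI)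
      moreover have "red p (x + red p (- x)) = red p (x + - x)" by (rule red_simps(4))
      then have "red p (x + red p (- x)) = 0" by (simp add: red_def zero_prod_def)
      ultimately show "(x, red p (- x)) \<in> {(x, y). x \<in> K \<and> y \<in> nmul p (-1) K \<and> red p (x + y) = 0}"
        using x by simp
    qed
    show "{(x, y). x \<in> K \<and> y \<in> nmul p (-1) K \<and> red p (x + y) = 0} \<subseteq> (\<lambda>x. (x, red p (- x))) ` K"
    proof
      fix z assume z: "z \<in> {(x, y). x \<in> K \<and> y \<in> nmul p (-1) K \<and> red p (x + y) = 0}"
      obtain x y where xy: "z = (x, y)" by (cases z)
      with z have x: "x \<in> K" and y: "y \<in> nmul p (-1) K" and eq: "red p (x + y) = 0" by simp_all
      have "y \<in> cyl p" by (rule subsetD [OF nmul_subset_cyl y])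
      then have "y = red p y" by (rule red_id [symmetric])
      also have "\<dots> = red p (red p (x + y) - x)" by simp
      also have "\<dots> = red p (- x)" unfolding eq by simp
      finally have "y = red p (- x)" .
      then show "z \<in> (\<lambda>x. (x, red p (- x))) ` K" using x xy by simp
    qed
  qed
  moreover have "inj_on (\<lambda>x. (x, red p (- x))) K" by (rule inj_onI) simp
  ultimately show ?thesis unfolding autocorr_def by (simp only: card_image)
qed

lemma sum_autocorr:
  assumes K: "K \<in> level_classes m" shows "(\<Sum>g\<in>lev p 0. autocorr K g) = card K * card K"
proof -
  have KD: "K \<in> D" "K \<subseteq> lev p m" using K by (simp_all add: level_classes_def)
  let ?N = "nmul p (-1) K"
  have fin: "finite K" "finite ?N" using finite_class [OF KD(1)] by (simp_all add: nmul_def)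
  have cN: "card ?N = card K"
    by (rule card_nmul [OF _ _ class_subset [OF KD(1)]]) simp_all
  have lev: "red p (fst z + snd z) \<in> lev p 0" if z: "z \<in> K \<times> ?N" for z
  proof -
    have "fst (fst z) = m" using z KD(2) by (auto simp: lev_iff)
    moreover have "fst (snd z) = - m"
    proof -
      have "snd z \<in> ?N" using z by auto
      then obtain u where "u \<in> K" "snd z = red p (smul (-1) u)" unfolding nmul_def by blast
      then show ?thesis using KD(2) by (auto simp: lev_iff)
    qed
    ultimately show ?thesis by (simp add: lev_iff red_in_cyl)
  qed
  have "card K * card K = card (K \<times> ?N)" by (simp add: cN card_cartesian_product)
  also have "\<dots> = (\<Sum>g\<in>lev p 0. card {z \<in> K \<times> ?N. red p (fst z + snd z) = g})"
  proof -
    have "(\<lambda>z. red p (fst z + snd z)) ` (K \<times> ?N) \<subseteq> lev p 0"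
      by (rule image_subsetI) (rule lev)
    from sum.group [OF finite_cartesian_product [OF fin] finite_lev this, of "\<lambda>_. 1 :: nat"]
    show ?thesis by (simp only: card_eq_sum)
  qed
  also have "\<dots> = (\<Sum>g\<in>lev p 0. autocorr K g)"
  proof (rule sum.cong [OF refl])
    fix g
    have "{z \<in> K \<times> ?N. red p (fst z + snd z) = g} = {(x, y). x \<in> K \<and> y \<in> ?N \<and> red p (x + y) = g}"
      by (rule Set.set_eqI) (simp add: mem_Times_iff case_prod_beta conj_assoc)
    then show "card {z \<in> K \<times> ?N. red p (fst z + snd z) = g} = autocorr K g"
      unfolding autocorr_def by simp
  qed
  finally show ?thesis by simp
qed

text \<open>With k = \<open>card K\<close>, the coefficients of K K^-1 add up to k^2. The identity
  contributes k, and every other class at level 0 contributes h times a constant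
  coefficient.\<close>

lemma h_dvd: assumes K: "K \<in> level_classes m" shows "h dvd card K * (card K - 1)"
proof -
  have KD: "K \<in> D" using K by (simp add: level_classes_def)
  have "card K * card K = (\<Sum>C\<in>level_classes 0. \<Sum>g\<in>C. autocorr K g)"
    using sum_autocorr [OF K] by (simp only: sum_classes)
  also have "\<dots> = card K + (\<Sum>C\<in>level_classes 0 - {{0}}. \<Sum>g\<in>C. autocorr K g)"
    unfolding sum_classes_0 by (simp add: autocorr_0 [OF KD])
  finally have eq: "card K * card K = card K + (\<Sum>C\<in>level_classes 0 - {{0}}. \<Sum>g\<in>C. autocorr K g)" .
  have "h dvd (\<Sum>C\<in>level_classes 0 - {{0}}. \<Sum>g\<in>C. autocorr K g)"
  proof (rule dvd_sum)
    fix C assume C: "C \<in> level_classes 0 - {{0}}"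
    then have CD: "C \<in> D" by (simp add: level_classes_def)
    obtain x where x: "x \<in> C" using class_nonempty [OF CD] by blast
    have "(\<Sum>g\<in>C. autocorr K g) = (\<Sum>g\<in>C. autocorr K x)"
      by (rule sum.cong [OF refl]) (rule autocorr_const [OF KD CD _ x])
    also have "\<dots> = h * autocorr K x" using card_class_0 [OF C] by simp
    finally show "h dvd (\<Sum>g\<in>C. autocorr K g)" by simp
  qed
  moreover have "card K * (card K - 1) = (\<Sum>C\<in>level_classes 0 - {{0}}. \<Sum>g\<in>C. autocorr K g)"
    using eq by (simp add: diff_mult_distrib2)
  ultimately show ?thesis by simp
qed

end

section \<open>The classes at level one\<close>

lemma card_residue_functions: "finite A \<Longrightarrow> card (A \<rightarrow>\<^sub>E {0..<int p}) = p ^ card A"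
  by (simp add: card_funcsetE)

text \<open>Since k and k - 1 are coprime, the prime power divides one of them, and both are
  positive.\<close>

lemma le_if_prime_power_dvd:
  fixes k :: nat
  assumes "Factorial_Ring.prime \<pi>" "\<pi> ^ e dvd k * (k - 1)" "2 \<le> k"
  shows "\<pi> ^ e \<le> k"
proof (cases "\<pi> dvd k")
  case True
  have "\<not> \<pi> dvd k - 1"
  proof
    assume "\<pi> dvd k - 1"
    with True have "\<pi> dvd k - (k - 1)" by (rule dvd_diff_nat)
    then show False using assms(1,3) by (simp add: not_prime_unit)
  qed
  then have "coprime (\<pi> ^ e) (k - 1)" using assms(1) by (simp add: prime_imp_coprime)
  then have "\<pi> ^ e dvd k" using assms(2) by (simp add: coprime_dvd_mult_left_iff)
  then show ?thesis using assms(3) by (intro dvd_imp_le) auto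
next
  case False
  then have "coprime (\<pi> ^ e) k" using assms(1) by (simp add: prime_imp_coprime)
  then have "\<pi> ^ e dvd k - 1" using assms(2) by (simp add: coprime_dvd_mult_right_iff)
  then have "\<pi> ^ e \<le> k - 1" using assms(3) by (intro dvd_imp_le) auto
  then show ?thesis by simp
qed

text \<open>The multiples of the sum of the torsion subgroup.\<close>

definition flat :: "nat \<Rightarrow> gring \<Rightarrow> bool" where
  "flat p f \<longleftrightarrow> (\<forall>x\<in>cyl p. \<forall>y\<in>cyl p. fst x = fst y \<longrightarrow> cf p f x = cf p f y)"

lemma flatD: assumes "flat p f" "x \<in> cyl p" "y \<in> cyl p" "fst x = fst y" shows "cf p f x = cf p f y"
proof -
  have "\<forall>y\<in>cyl p. fst x = fst y \<longrightarrow> cf p f x = cf p f y"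
    using assms(1,2) unfolding flat_def by (rule bspec)
  then have "fst x = fst y \<longrightarrow> cf p f x = cf p f y" using assms(3) by (rule bspec)
  then show ?thesis using assms(4) by (rule mp)
qed

lemma flatI:
  assumes "\<And>x y. \<lbrakk>x \<in> cyl p; y \<in> cyl p; fst x = fst y\<rbrakk> \<Longrightarrow> cf p f x = cf p f y" shows "flat p f"
  unfolding flat_def by (intro ballI impI) (rule assms)

lemma flat_add: assumes "flat p f" "flat p g" shows "flat p (f + g)"
  by (rule flatI, unfold cf_add) (intro arg_cong2 [where f = "(+)"] flatD [OF assms(1)] flatD [OF assms(2)])

text \<open>Flat elements form an ideal, so congruences modulo them can be multiplied; the
  difference set argument is such a computation.\<close>

lemma flat_mult: assumes "p > 0" "flat p f" shows "flat p (f' * f)"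
proof (rule flatI)
  fix x y assume x: "x \<in> cyl p" and y: "y \<in> cyl p" and eq: "fst x = fst y"
  have "cf p f (red p (x - u)) = cf p f (red p (y - u))" for u
    by (rule flatD [OF assms(2) red_in_cyl [OF assms(1)] red_in_cyl [OF assms(1)]]) (simp add: eq)
  then show "cf p (f' * f) x = cf p (f' * f) y"
    unfolding cf_mult [OF red_id [OF x]] cf_mult [OF red_id [OF y]]
    by (intro sum.cong refl arg_cong2 [where f = "(*)"])
qed

context schur_cyl
begin

lemma cf_class_sum_neg:
  assumes A: "finite A" "A \<subseteq> cyl p" and x: "x \<in> cyl p"
  shows "cf p (class_sum (nmul p (-1) A)) x = cf p (class_sum A) (red p (- x))"
proof -
  have "x \<in> nmul p (-1) A \<longleftrightarrow> red p (- x) \<in> A"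
  proof
    assume "x \<in> nmul p (-1) A"
    then obtain a where a: "a \<in> A" "x = red p (smul (-1) a)" unfolding nmul_def by (rule imageE)
    then have "red p (- x) = red p a" by simp
    also have "\<dots> = a" by (rule red_id [OF subsetD [OF A(2) a(1)]])
    finally show "red p (- x) \<in> A" using a(1) by simp
  next
    assume "red p (- x) \<in> A"
    then have "red p (smul (-1) (red p (- x))) \<in> nmul p (-1) A" unfolding nmul_def by (rule imageI)
    also have "red p (smul (-1) (red p (- x))) = red p x" by simp
    also have "\<dots> = x" by (rule red_id [OF x])
    finally show "x \<in> nmul p (-1) A" .
  qed
  moreover have "finite (nmul p (-1) A)" using A(1) by (simp add: nmul_def)
  ultimately show ?thesis using A by (simp add: cf_class_sum nmul_subset_cyl)
qed

lemma class_sum_neg: "A \<subseteq> cyl p \<Longrightarrow>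
  class_sum (nmul p (-1) A) = (\<Sum>a\<in>A. Poly_Mapping.single (red p (- a)) 1)"
  unfolding class_sum_def nmul_def
  by (subst sum.reindex [OF inj_on_subset [OF inj_on_smul_coprime]]) simp_all

text \<open>Inversion is an automorphism of the commutative group ring, so it commutes with
  squaring.\<close>

lemma cf_square_neg:
  assumes A: "finite A" "A \<subseteq> cyl p" and x: "x \<in> cyl p"
  shows "cf p (class_sum (nmul p (-1) A) * class_sum (nmul p (-1) A)) x =
    cf p (class_sum A * class_sum A) (red p (- x))"
proof -
  have eq: "red p (- a + - b) = x \<longleftrightarrow> red p (a + b) = red p (- x)" for a b
  proof
    assume "red p (- a + - b) = x"
    then have "red p (- x) = red p (- red p (- a + - b))" by simp
    also have "\<dots> = red p (- (- a + - b))" by (rule red_simps)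
    also have "- (- a + - b) = a + b" by (simp add: prod_eq_iff)
    finally show "red p (a + b) = red p (- x)" by simp
  next
    assume *: "red p (a + b) = red p (- x)"
    have "- a + - b = - (a + b)" by (simp add: prod_eq_iff)
    then have "red p (- a + - b) = red p (- red p (a + b))" by (simp only: red_simps)
    also have "\<dots> = red p x" unfolding * by simp
    also have "\<dots> = x" by (rule red_id [OF x])
    finally show "red p (- a + - b) = x" .
  qed
  have eq2: "red p (red p (- a) + red p (- b)) = x \<longleftrightarrow> red p (a + b) = red p (- x)" for a b
    unfolding red_simps by (rule eq)
  show ?thesis
    unfolding class_sum_neg [OF A(2)] unfolding class_sum_def sum_product mult_single cf_sum cf_single
    by (simp only: eq2 mult_1)
qed

end

context schur_cyl_A
begin

text \<open>Modulo \<open>p\<close> the \<open>p\<close>-th power of the sum of \<open>K\<close> is \<open>card K\<close> times the group element \<open>z\<^sup>p\<close>,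
  so multiplication by that sum is injective modulo \<open>p\<close> unless \<open>K\<close> is a full coset.\<close>

lemma card_classes_le:
  assumes K: "K \<in> level_classes 1" and np: "\<not> p dvd card K"
  shows "card (level_classes 0) \<le> card (level_classes 1)"
proof -
  have KD: "K \<in> D" "K \<subseteq> lev p 1" using K by (simp_all add: level_classes_def)
  have Kf: "finite K" by (rule finite_class [OF KD(1)])
  have CD: "C \<in> D" "C \<subseteq> lev p 0" if "C \<in> level_classes 0" for C using that by (simp_all add: level_classes_def)
  \<comment> \<open>The general element of the Schur ring supported on level 0.\<close>
  define Y :: "((int \<times> int) set \<Rightarrow> int) \<Rightarrow> gring"
    where "Y \<alpha> = (\<Sum>C\<in>level_classes 0. of_int (\<alpha> C) * class_sum C)" for \<alpha>
  have SX: "S (Y \<alpha>)" for \<alpha>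
    unfolding Y_def by (intro S_sum S_of_int_mult S_class_sum finite_class S_set_class CD)
  have Y_val: "cf p (Y \<alpha>) x = \<alpha> C" if C: "C \<in> level_classes 0" "x \<in> C" for C x \<alpha>
  proof -
    have "cf p (Y \<alpha>) x = (\<Sum>E\<in>level_classes 0. if E = C then \<alpha> C else 0)"
      unfolding Y_def cf_sum cf_of_int_mult
    proof (rule sum.cong [OF refl])
      fix E assume E: "E \<in> level_classes 0"
      have "x \<in> E \<longleftrightarrow> E = C" using class_eq [OF CD(1) [OF E] CD(1) [OF C(1)], of x] C(2) by metis
      then show "\<alpha> E * cf p (class_sum E) x = (if E = C then \<alpha> C else 0)"
        using cf_class_sum [OF finite_class class_subset, OF CD(1) CD(1), OF E E, of x] by simp
    qed
    also have "\<dots> = \<alpha> C" using C(1) finite_classes [of 0] by (simp only: sum.delta if_True)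
    finally show ?thesis .
  qed
  have Y_off: "cf p (Y \<alpha> * class_sum K) g = 0" if "fst g \<noteq> 1" for \<alpha> g
  proof -
    have zero: "cf p (class_sum C * class_sum K) g = 0" if C: "C \<in> level_classes 0" for C
    proof -
      have "red p (x + y) \<noteq> g" if "x \<in> C" "y \<in> K" for x y
      proof
        assume "red p (x + y) = g"
        then have "fst (red p (x + y)) = fst g" by simp
        moreover have "fst x = 0" using subsetD [OF CD(2) [OF C] that(1)] by (simp add: lev_iff)
        moreover have "fst y = 1" using subsetD [OF KD(2) that(2)] by (simp add: lev_iff)
        ultimately show False using \<open>fst g \<noteq> 1\<close> by simp
      qed
      then have "{(x, y). x \<in> C \<and> y \<in> K \<and> red p (x + y) = g} = {}" by blast
      then show ?thesis
        unfolding cf_class_sum_mult [OF finite_class [OF CD(1) [OF C]] Kf] by (simp only: card.empty of_nat_0)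
    qed
    have "Y \<alpha> * class_sum K = (\<Sum>C\<in>level_classes 0. of_int (\<alpha> C) * (class_sum C * class_sum K))"
      unfolding Y_def sum_distrib_right by (simp only: mult.assoc)
    then show ?thesis by (simp add: cf_sum zero)
  qed
  define e where "e E = (SOME x. x \<in> E)" for E :: "(int \<times> int) set"
  \<comment> \<open>The product with the sum of K lies on level 1 and is determined by one value per
    class. Injectivity of F on residue functions compares p-powers, in place of dimensions over the
    field with p elements.\<close>
  define F where "F \<alpha> = (\<lambda>E\<in>level_classes 1. cf p (Y \<alpha> * class_sum K) (e E) mod int p)" for \<alpha>
  let ?A = "level_classes 0 \<rightarrow>\<^sub>E {0..<int p}" and ?B = "level_classes 1 \<rightarrow>\<^sub>E {0..<int p}"
  have "inj_on F ?A"
  proof (rule inj_onI)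
    fix \<alpha> \<beta> assume \<alpha>: "\<alpha> \<in> ?A" and \<beta>: "\<beta> \<in> ?A" and eq: "F \<alpha> = F \<beta>"
    let ?d = "Y \<alpha> - Y \<beta>"
    have dK: "?d * class_sum K = Y \<alpha> * class_sum K - Y \<beta> * class_sum K" by (rule left_diff_distrib)
    have dvd1: "int p dvd cf p (?d * class_sum K) g" for g
    proof (cases "red p g = g \<and> fst g = 1")
      case True
      then have g: "g \<in> cyl p" "g \<in> lev p 1" using red_in_cyl [OF p_pos, of g] by (simp_all add: lev_iff)
      have E: "cls g \<in> level_classes 1" by (rule cls_in_classes [OF g(2)])
      have BD: "cls g \<in> D" "g \<in> cls g" using cls_in [OF g(1)] by simp_all
      have eg: "e (cls g) \<in> cls g" unfolding e_def using BD(2) by (rule someI)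
      have const: "cf p (Y \<xi> * class_sum K) g = cf p (Y \<xi> * class_sum K) (e (cls g))" for \<xi>
        by (rule S_D [OF S_mult [OF SX S_class_sum [OF Kf S_set_class [OF KD(1)]]] BD eg])
      have "F \<alpha> (cls g) = F \<beta> (cls g)" using eq by simp
      then have "cf p (Y \<alpha> * class_sum K) g mod int p = cf p (Y \<beta> * class_sum K) g mod int p"
        unfolding F_def const by (simp only: E restrict_apply' if_True)
      then show ?thesis unfolding dK cf_diff by (rule mod_eq_dvd_iff [THEN iffD1])
    next
      case False
      then have "cf p (?d * class_sum K) g = 0"
      proof (cases "fst g = 1")
        case True
        with False have "red p g \<noteq> g" by simp
        then show ?thesis by (rule cf_outside)
      next
        case off: False
        show ?thesis unfolding dK cf_diff by (simp add: Y_off [OF off])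
      qed
      then show ?thesis by simp
    qed
    obtain w where w: "class_sum K ^ p = (\<Sum>x\<in>K. Poly_Mapping.single (smul (int p) x) 1) + of_nat p * w"
      using class_sum_power_prime [OF prime_p Kf] by blast
    \<comment> \<open>The missing factors complete the p-th power of the class sum; since x^p = z^p
      for all x at level 1, this is \<open>card K\<close> times z^p modulo p.\<close>
    have "class_sum K ^ (p - 1) * (?d * class_sum K) = (class_sum K ^ (p - 1) * class_sum K) * ?d"
      by (simp only: mult_ac)
    also have "\<dots> = class_sum K ^ p * ?d"
      by (simp only: power_minus_mult [OF p_pos])
    also have "\<dots> = (\<Sum>x\<in>K. Poly_Mapping.single (smul (int p) x) 1 * ?d) + of_nat p * (w * ?d)"
      unfolding w by (simp only: distrib_right sum_distrib_right mult.assoc)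
    finally have expand: "class_sum K ^ (p - 1) * (?d * class_sum K) = \<dots>" .
    have val: "int p dvd cf p ?d y" if y: "y \<in> cyl p" for y
    proof -
      \<comment> \<open>Multiplication by z^p moves the coefficient of the difference at y to this
        place.\<close>
      let ?g = "shift p 1 y"
      have rg: "red p ?g = ?g" by (rule red_id) (simp add: y)
      have sub: "red p (?g - smul (int p) x) = y" if x: "x \<in> K" for x
      proof -
        have "fst x = 1" using subsetD [OF KD(2) x] by (simp add: lev_iff)
        moreover have "(snd y + int p * (- snd x)) mod int p = snd y mod int p" by (rule mod_mult_self2)
        ultimately show ?thesis using y by (simp add: red_def shift_def in_cylI prod_eq_iff)
      qed
      have "int p dvd cf p (class_sum K ^ (p - 1) * (?d * class_sum K)) ?g"
        by (rule cf_dvd_mult [OF dvd1])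
      also have "cf p (class_sum K ^ (p - 1) * (?d * class_sum K)) ?g =
          (\<Sum>x\<in>K. cf p (Poly_Mapping.single (smul (int p) x) 1 * ?d) ?g) + int p * cf p (w * ?d) ?g"
        unfolding expand cf_add cf_sum cf_of_nat_mult ..
      also have "(\<Sum>x\<in>K. cf p (Poly_Mapping.single (smul (int p) x) 1 * ?d) ?g) = (\<Sum>x\<in>K. cf p ?d y)"
        by (rule sum.cong [OF refl]) (simp only: cf_mult_single [OF rg] sub mult_1)
      also have "\<dots> = int (card K) * cf p ?d y" by simp
      finally have "int p dvd int (card K) * cf p ?d y" by (simp add: dvd_add_left_iff)
      moreover have "coprime (int p) (int (card K))"
        using np prime_imp_coprime [OF prime_p np] by simp
      ultimately show ?thesis by (simp only: coprime_dvd_mult_right_iff)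
    qed
    show "\<alpha> = \<beta>"
    proof (rule PiE_ext [OF \<alpha> \<beta>])
      fix C assume C: "C \<in> level_classes 0"
      obtain x where x: "x \<in> C" using class_nonempty [OF CD(1) [OF C]] by blast
      have "x \<in> cyl p" by (rule subsetD [OF class_subset [OF CD(1) [OF C]] x])
      from val [OF this] have "int p dvd \<alpha> C - \<beta> C" unfolding cf_diff Y_val [OF C x] .
      moreover have "\<alpha> C \<in> {0..<int p}" "\<beta> C \<in> {0..<int p}"
        using PiE_mem [OF \<alpha> C] PiE_mem [OF \<beta> C] by simp_all
      moreover have "\<alpha> C mod int p = \<beta> C mod int p"
        using \<open>int p dvd \<alpha> C - \<beta> C\<close> by (rule mod_eq_dvd_iff [THEN iffD2])
      ultimately show "\<alpha> C = \<beta> C" by (simp add: mod_pos_pos_trivial)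
    qed
  qed
  moreover have "F ` ?A \<subseteq> ?B"
  proof (rule image_subsetI)
    fix \<alpha> show "F \<alpha> \<in> ?B" unfolding F_def by (rule restrict_PiE_iff [THEN iffD2]) simp
  qed
  moreover have "finite ?B" by (intro finite_PiE finite_classes) simp
  ultimately have "card ?A \<le> card ?B" by (rule card_inj_on_le)
  then have "p ^ card (level_classes 0) \<le> p ^ card (level_classes 1)"
    by (simp only: card_residue_functions [OF finite_classes])
  then show ?thesis using p_gt_1 by simp
qed

text \<open>The nontrivial elements of level 0 form one class, so K K^-1 has the coefficient q at
  the identity and a constant \<lambda> elsewhere on level 0. Counting gives q^2 = q + 2 q
  \<lambda>, so q = 1 + 2 \<lambda>, and n = q - \<lambda> is the order of the difference set
  K.\<close>

lemma flat_autocorr: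
  assumes q: "p = 2 * q + 1" "q > 0" and zero: "lev p 0 - {0} \<in> D"
    and K: "K \<in> level_classes m" "card K = q" and n: "2 * n = int q + 1"
  shows "flat p (class_sum K * class_sum (nmul p (-1) K) - of_int n * 1)"
proof -
  have KD: "K \<in> D" "K \<subseteq> lev p m" using K(1) by (simp_all add: level_classes_def)
  have fin: "finite K" "finite (nmul p (-1) K)" using finite_class [OF KD(1)] by (simp_all add: nmul_def)
  have cfK: "cf p (class_sum K * class_sum (nmul p (-1) K)) g = int (autocorr K g)" for g
    unfolding cf_class_sum_mult [OF fin] autocorr_def ..
  have "(0, 1) \<in> lev p 0 - {0}" using one_in_cyl by (simp add: lev_iff zero_prod_def)
  from autocorr_const [OF KD(1) zero _ this]
  have lam: "autocorr K g = autocorr K (0, 1)" if "g \<in> lev p 0 - {0}" for g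
    using that .
  have mem0: "0 \<in> lev p 0" by (simp add: lev_def zero_prod_def)
  have "q * q = (\<Sum>g\<in>lev p 0. autocorr K g)" using sum_autocorr [OF K(1)] K(2) by simp
  also have "\<dots> = autocorr K 0 + (\<Sum>g\<in>lev p 0 - {0}. autocorr K g)"
    by (rule sum.remove [OF finite_lev mem0])
  also have "(\<Sum>g\<in>lev p 0 - {0}. autocorr K g) = (\<Sum>g\<in>lev p 0 - {0}. autocorr K (0, 1))"
    by (rule sum.cong [OF refl lam])
  also have "\<dots> = 2 * q * autocorr K (0, 1)" using mem0 q(1) by (simp add: card_Diff_singleton)
  also have "autocorr K 0 = q" using autocorr_0 [OF KD(1)] K(2) by simp
  finally have "q * q = q * (1 + 2 * autocorr K (0, 1))" by (simp add: algebra_simps)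
  then have qq: "q = 1 + 2 * autocorr K (0, 1)" by (rule nat_mult_eq_cancel1 [OF q(2), THEN iffD1])
  have val: "cf p (class_sum K * class_sum (nmul p (-1) K) - of_int n * 1) g =
      (if fst g = 0 then int (autocorr K (0, 1)) else 0)" if g: "g \<in> cyl p" for g
  proof -
    have one: "cf p 1 g = of_bool (g = 0)"
      using cf_class_sum [of "{0}" p g] by (simp add: class_sum_def in_cylI)
    show ?thesis
    proof (cases "fst g = 0")
      case True
      show ?thesis
      proof (cases "g = 0")
        case True
        then show ?thesis unfolding cf_diff cf_of_int_mult cfK one
          using autocorr_0 [OF KD(1)] K(2) n qq by simp
      next
        case False
        then have "g \<in> lev p 0 - {0}" using True g by (simp add: lev_iff)
        then show ?thesis unfolding cf_diff cf_of_int_mult cfK one using False True lam by simp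
      qed
    next
      case False
      then have "g \<noteq> 0" by auto
      have "red p (x + y) \<noteq> g" if x: "x \<in> K" and y: "y \<in> nmul p (-1) K" for x y
      proof
        assume *: "red p (x + y) = g"
        obtain u where u: "u \<in> K" "y = red p (smul (-1) u)" using y unfolding nmul_def by (rule imageE)
        have "fst x = m" "fst u = m" using subsetD [OF KD(2) x] subsetD [OF KD(2) u(1)] by (simp_all add: lev_iff)
        then have "fst (red p (x + y)) = 0" using u(2) by simp
        with * False show False by simp
      qed
      then have "{(x, y). x \<in> K \<and> y \<in> nmul p (-1) K \<and> red p (x + y) = g} = {}" by blast
      then have "autocorr K g = 0" unfolding autocorr_def by (simp only: card.empty)
      with False \<open>g \<noteq> 0\<close> show ?thesis unfolding cf_diff cf_of_int_mult cfK one by simp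
    qed
  qed
  show ?thesis by (rule flatI) (simp only: val)
qed

text \<open>Level 2 consists of two classes, so the square of the sum of K takes one value on A and
  one on its complement; \<gamma> is their difference, and subtracting it on A leaves a constant on
  level 2.\<close>

lemma flat_square:
  assumes A: "A \<in> level_classes 2" and B: "lev p 2 - A \<in> D" and K: "K \<in> level_classes 1"
  obtains \<gamma> where "flat p (class_sum K * class_sum K - of_int \<gamma> * class_sum A)"
proof -
  have KD: "K \<in> D" "K \<subseteq> lev p 1" using K by (simp_all add: level_classes_def)
  have AD: "A \<in> D" "A \<subseteq> lev p 2" using A by (simp_all add: level_classes_def)
  let ?f = "class_sum K * class_sum K"
  have Sf: "S ?f" by (rule S_class_mult [OF KD(1) KD(1)])
  obtain a where a: "a \<in> A" using class_nonempty [OF AD(1)] by blast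
  obtain b where b: "b \<in> lev p 2 - A" using class_nonempty [OF B] by blast
  have off: "cf p ?f g = 0" if "fst g \<noteq> 2" for g
  proof -
    have "red p (x + y) \<noteq> g" if x: "x \<in> K" and y: "y \<in> K" for x y
    proof
      assume *: "red p (x + y) = g"
      have "fst x = 1" "fst y = 1" using subsetD [OF KD(2) x] subsetD [OF KD(2) y] by (simp_all add: lev_iff)
      then have "fst (red p (x + y)) = 2" by simp
      with * that \<open>fst g \<noteq> 2\<close> show False by simp
    qed
    then have "{(x, y). x \<in> K \<and> y \<in> K \<and> red p (x + y) = g} = {}" by blast
    then show ?thesis
      unfolding cf_class_sum_mult [OF finite_class [OF KD(1)] finite_class [OF KD(1)]]
      by (simp only: card.empty of_nat_0)
  qed
  have cA: "cf p (class_sum A) g = of_bool (g \<in> A)" for g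
    by (rule cf_class_sum [OF finite_class [OF AD(1)] class_subset [OF AD(1)]])
  have val: "cf p (?f - of_int (cf p ?f a - cf p ?f b) * class_sum A) g = (if fst g = 2 then cf p ?f b else 0)"
    if g: "g \<in> cyl p" for g
  proof (cases "fst g = 2")
    case True
    then have gl: "g \<in> lev p 2" using g by (simp add: lev_iff)
    show ?thesis
    proof (cases "g \<in> A")
      case gA: True
      have "cf p ?f g = cf p ?f a" by (rule S_D [OF Sf AD(1) gA a])
      then show ?thesis unfolding cf_diff cf_of_int_mult cA using gA True by simp
    next
      case gA: False
      have "cf p ?f g = cf p ?f b" by (rule S_D [OF Sf B _ b]) (use gl gA in simp)
      then show ?thesis unfolding cf_diff cf_of_int_mult cA using gA True by simp
    qed
  next
    case False
    then have "g \<notin> A" using subsetD [OF AD(2), of g] by (auto simp: lev_iff)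
    then show ?thesis unfolding cf_diff cf_of_int_mult cA using False off [OF False] by simp
  qed
  have "flat p (?f - of_int (cf p ?f a - cf p ?f b) * class_sum A)"
    by (rule flatI) (simp only: val)
  then show ?thesis by (rule that)
qed

text \<open>A level \<open>1\<close> split into two classes would give a \<open>(2q+1, q)\<close> difference set whose order \<open>(q+1)/2\<close> is a
  square \<open>\<gamma>\<^sup>2\<close>, and then \<open>p = (2\<gamma> - 1)(2\<gamma> + 1)\<close>.\<close>

lemma no_difference_set:
  assumes q: "p = 2 * q + 1" "q > 1" and zero: "lev p 0 - {0} \<in> D"
    and K: "K \<in> level_classes 1" "card K = q" "lev p 1 - K \<in> D"
  shows False
proof -
  have KD: "K \<in> D" "K \<subseteq> lev p 1" using K(1) by (simp_all add: level_classes_def)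
  have "\<not> int p dvd 2"
  proof
    assume "int p dvd 2"
    then have "int p \<le> 2" by (rule zdvd_imp_le) simp
    then show False using q by simp
  qed
  then have two: "coprime 2 (int p)" "(2 :: int) \<noteq> 0" using coprime_iff_not_dvd by auto
  have nmul2: "nmul p 2 C \<in> D" if C: "C \<in> D" for C
  proof -
    obtain x where x: "x \<in> C" using class_nonempty [OF C] by blast
    have xc: "x \<in> cyl p" by (rule subsetD [OF class_subset [OF C] x])
    have "cls (red p (smul 2 x)) = nmul p 2 C" using cls_nmul [OF two xc] cls_eq [OF C x] by simp
    then show ?thesis using cls_in(1) [of "red p (smul 2 x)"] by (simp add: red_in_cyl)
  qed
  have lev2: "nmul p 2 (lev p 1) = lev p 2"
  proof (rule card_subset_eq)
    show "nmul p 2 (lev p 1) \<subseteq> lev p 2" using nmul_lev_subset [OF p_pos, of 2 1] by simp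
    show "card (nmul p 2 (lev p 1)) = card (lev p 2)" using card_nmul [OF two lev_subset_cyl, of 1] by simp
  qed simp
  \<comment> \<open>As 2 is a unit modulo p, squaring elements carries the two classes of level 1 to
    the two classes of level 2.\<close>
  let ?K2 = "nmul p 2 K"
  have K2D: "?K2 \<in> D" by (rule nmul2 [OF KD(1)])
  have K2: "?K2 \<in> level_classes 2"
    unfolding level_classes_def using K2D image_mono [OF KD(2), of "\<lambda>x. red p (smul 2 x)"] lev2
    by (simp add: nmul_def)
  have cK2: "card ?K2 = q" using card_nmul [OF two class_subset [OF KD(1)]] K(2) by simp
  have "nmul p 2 (lev p 1 - K) = nmul p 2 (lev p 1) - ?K2"
    unfolding nmul_def
    by (rule inj_on_image_set_diff [OF inj_on_smul_coprime [OF two] _ class_subset [OF KD(1)]])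
      (use lev_subset_cyl in blast)
  then have comp: "lev p 2 - ?K2 \<in> D" using nmul2 [OF K(3)] lev2 by simp
  obtain \<gamma> where g: "flat p (class_sum K * class_sum K - of_int \<gamma> * class_sum ?K2)"
    using flat_square [OF K2 comp K(1)] by blast
  let ?k = "class_sum K" and ?k' = "class_sum (nmul p (-1) K)"
  let ?l = "class_sum ?K2" and ?l' = "class_sum (nmul p (-1) ?K2)"
  \<comment> \<open>The image under inversion of the congruence between the square of K and \<gamma>
    times the set of squares.\<close>
  have g': "flat p (?k' * ?k' - of_int \<gamma> * ?l')"
  proof (rule flatI)
    fix x y assume x: "x \<in> cyl p" and y: "y \<in> cyl p" and eq: "fst x = fst y"
    have neg: "cf p (?k' * ?k' - of_int \<gamma> * ?l') u = cf p (?k * ?k - of_int \<gamma> * ?l) (red p (- u))"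
      if u: "u \<in> cyl p" for u
      unfolding cf_diff cf_of_int_mult cf_square_neg [OF finite_class [OF KD(1)] class_subset [OF KD(1)] u]
        cf_class_sum_neg [OF finite_class [OF K2D] class_subset [OF K2D] u] ..
    show "cf p (?k' * ?k' - of_int \<gamma> * ?l') x = cf p (?k' * ?k' - of_int \<gamma> * ?l') y"
      unfolding neg [OF x] neg [OF y]
      by (rule flatD [OF g red_in_cyl [OF p_pos] red_in_cyl [OF p_pos]]) (simp add: eq)
  qed
  \<comment> \<open>Here h = 2q divides q (q - 1), so q is odd.\<close>
  have "\<exists>n. 2 * n = int q + 1"
  proof -
    have "h = 2 * q"
    proof -
      have "(0, 1) \<in> lev p 0 - {0}" using one_in_cyl by (simp add: lev_iff zero_prod_def)
      then have "cls (0, 1) = lev p 0 - {0}" by (rule cls_eq [OF zero])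
      moreover have "(0 :: int \<times> int) \<in> lev p 0" by (simp add: lev_def zero_prod_def)
      ultimately show ?thesis unfolding h_def using q(1) by (simp add: card_Diff_singleton)
    qed
    then have "q * 2 dvd q * (q - 1)" using h_dvd [OF K(1)] K(2) by (simp add: mult.commute)
    then have "2 dvd q - 1" using q(2) by simp
    then have "even (int q + 1)" using q(2) by presburger
    then show ?thesis by (metis evenE)
  qed
  then obtain n where n: "2 * n = int q + 1" by blast
  have q0: "q > 0" using q(2) by simp
  have fK: "flat p (?k * ?k' - of_int n * 1)" by (rule flat_autocorr [OF q(1) q0 zero K(1,2) n])
  have fK2: "flat p (?l * ?l' - of_int n * 1)" by (rule flat_autocorr [OF q(1) q0 zero K2 cK2 n])
  \<comment> \<open>Write K' and L' for the inverses of K and of its set of squares L. Modulo flat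
    elements K K' = n, L L' = n, K^2 = \<gamma> L and K'^2 = \<gamma> L', so n^2 = K^2 K'^2 =
    \<gamma>^2 L L' = \<gamma>^2 n. The identity displays the four flat factors behind this
    chain.\<close>
  have "of_int (n ^ 2 - \<gamma> ^ 2 * n) * (1 :: gring) =
      (- (?k * ?k' + of_int n)) * (?k * ?k' - of_int n * 1) +
      (?k * ?k * (?k' * ?k' - of_int \<gamma> * ?l') +
      (of_int \<gamma> * ?l' * (?k * ?k - of_int \<gamma> * ?l) +
      of_int (\<gamma> ^ 2) * (?l * ?l' - of_int n * 1)))"
    by (simp add: algebra_simps power2_eq_square)
  moreover have "flat p ((- (?k * ?k' + of_int n)) * (?k * ?k' - of_int n * 1) +
      (?k * ?k * (?k' * ?k' - of_int \<gamma> * ?l') +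
      (of_int \<gamma> * ?l' * (?k * ?k - of_int \<gamma> * ?l) +
      of_int (\<gamma> ^ 2) * (?l * ?l' - of_int n * 1))))"
    by (intro flat_add flat_mult p_pos fK fK2 g g')
  ultimately have fl: "flat p (of_int (n ^ 2 - \<gamma> ^ 2 * n) * (1 :: gring))" by simp
  have one: "cf p 1 u = of_bool (u = 0)" for u
    using cf_class_sum [of "{0}" p u] by (simp add: class_sum_def in_cylI)
  \<comment> \<open>A constant is supported at the identity, so it is flat only if it is 0.\<close>
  have "cf p (of_int (n ^ 2 - \<gamma> ^ 2 * n) * 1) 0 = cf p (of_int (n ^ 2 - \<gamma> ^ 2 * n) * 1) (0, 1)"
    by (rule flatD [OF fl _ one_in_cyl]) (simp_all add: in_cylI)
  then have "n ^ 2 - \<gamma> ^ 2 * n = 0" unfolding cf_of_int_mult one by (simp add: zero_prod_def)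
  then have "n * (n - \<gamma> ^ 2) = 0" by (simp add: algebra_simps power2_eq_square)
  then have "n = \<gamma> ^ 2" using n by auto
  \<comment> \<open>Because p = 2q + 1 = 4n - 1.\<close>
  then have ip: "int p = (2 * \<bar>\<gamma>\<bar> - 1) * (2 * \<bar>\<gamma>\<bar> + 1)"
    using n q(1) by (simp add: algebra_simps power2_eq_square abs_mult_self_eq)
  have "\<bar>\<gamma>\<bar> \<ge> 2"
  proof (rule ccontr)
    assume "\<not> \<bar>\<gamma>\<bar> \<ge> 2"
    then have "\<gamma> = 0 \<or> \<gamma> = 1 \<or> \<gamma> = - 1" by auto
    then have "\<gamma> ^ 2 \<le> 1" by auto
    then show False using \<open>n = \<gamma> ^ 2\<close> n q(2) by simp
  qed
  moreover have "Factorial_Ring.irreducible (int p)" using prime_p by (simp add: prime_elem_imp_irreducible)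
  from Factorial_Ring.irreducibleD [OF this ip] have "\<bar>2 * \<bar>\<gamma>\<bar> - 1\<bar> = 1 \<or> \<bar>2 * \<bar>\<gamma>\<bar> + 1\<bar> = 1" by (simp only: zdvd1_eq)
  ultimately show False by linarith
qed

text \<open>There are at least as many classes at level \<open>1\<close> as at level \<open>0\<close>, so by \<open>h_dvd\<close> their sizes leave no room
  for a level \<open>1\<close> without singletons, except for the sizes \<open>q\<close> and \<open>q + 1\<close> when \<open>p = 2q + 1\<close>.\<close>

lemma level_one:
  assumes p: "fermat_prime p \<or> safe_prime p"
  shows "lev p 1 \<in> D \<or> (\<exists>b. {(1, b)} \<in> D)"
proof (rule ccontr)
  assume "\<not> ?thesis"
  then have full: "lev p 1 \<notin> D" and single: "{(1, b)} \<notin> D" for b by auto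
  have KD: "K \<in> D" "K \<subseteq> lev p 1" if "K \<in> level_classes 1" for K using that by (simp_all add: level_classes_def)
  have fin: "finite K" if "K \<in> level_classes 1" for K by (rule finite_class [OF KD(1) [OF that]])
  have ge2: "2 \<le> card K" if K: "K \<in> level_classes 1" for K
  proof (rule ccontr)
    assume "\<not> 2 \<le> card K"
    moreover have "card K \<noteq> 0" using fin [OF K] class_nonempty [OF KD(1) [OF K]] by simp
    ultimately have "card K = 1" by simp
    then obtain x where x: "K = {x}" by (auto simp: card_1_singleton_iff)
    then have "x = (1, snd x)" using KD(2) [OF K] by (simp add: lev_iff prod_eq_iff)
    then show False using single [of "snd x"] KD(1) [OF K] x by simp
  qed
  have lt: "card K < p" if K: "K \<in> level_classes 1" for K
  proof -
    have "K \<noteq> lev p 1" using full KD(1) [OF K] by auto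
    then have "K \<subset> lev p 1" using KD(2) [OF K] by auto
    then have "card K < card (lev p 1)" by (rule psubset_card_mono [OF finite_lev])
    then show ?thesis by simp
  qed
  let ?r = "card (level_classes 1)" and ?s = "card (level_classes 0)"
  have "(1, 0) \<in> lev p 1" by (simp add: lev_def)
  then have K0: "cls (1, 0) \<in> level_classes 1" by (rule cls_in_classes)
  have "\<not> p dvd card (cls (1, 0))" using ge2 [OF K0] lt [OF K0] by (auto dest: dvd_imp_le)
  then have sr: "?s \<le> ?r" by (rule card_classes_le [OF K0])
  have shift: "(?s - 1) * h = p - 1" by (rule h_classes)
  have s1: "?s \<ge> 2" "h \<ge> 1"
    using shift p_gt_1 by (cases "?s - 1 = 0", simp, simp, cases "h = 0", simp_all)
  have total: "(\<Sum>K\<in>level_classes 1. card K) = p" by (rule sum_card_classes)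
  \<comment> \<open>If all sizes were at least h, then r h \<le> p and s \<le> r would force h = 1;
    level 0 would then have p classes, but level 1 has at most p/2, as singletons are
    excluded.\<close>
  have "\<exists>K\<in>level_classes 1. card K < h"
  proof (rule ccontr)
    assume "\<not> ?thesis"
    then have "\<And>K. K \<in> level_classes 1 \<Longrightarrow> h \<le> card K" by (meson not_less)
    then have "?r * h \<le> p" using sum_bounded_below [of "level_classes 1" h card] total by simp
    moreover have "?s * h = p - 1 + h"
    proof -
      have "?s * h = (?s - 1) * h + h" using s1 by (simp add: diff_mult_distrib)
      then show ?thesis using shift by simp
    qed
    moreover have "?s * h \<le> ?r * h" using sr by simp
    ultimately have "h = 1" using s1 p_gt_1 by linarith
    then have "?s = p" using shift s1 p_gt_1 by simp
    moreover have "?r * 2 \<le> p" using sum_bounded_below [of "level_classes 1" 2 card] ge2 total by simp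
    ultimately show False using sr p_gt_1 by linarith
  qed
  then obtain K where K: "K \<in> level_classes 1" "card K < h" by blast
  \<comment> \<open>A prime power h dividing k (k - 1) is at most k = \<open>card K\<close>, against
    the choice of K.\<close>
  have no_pp: False if "h = \<pi> ^ e" "Factorial_Ring.prime \<pi>" for \<pi> e
    using le_if_prime_power_dvd [OF that(2), of e "card K"] h_dvd [OF K(1)] ge2 [OF K(1)] K(2) that(1) by simp
  have h_dvd_p: "h dvd p - 1" using shift by (metis dvd_triv_right)
  from p show False
  proof
    assume "fermat_prime p"
    then obtain j where j: "p = 2 ^ j + 1" unfolding fermat_prime_def by blast
    then have "h dvd 2 ^ j" using h_dvd_p by simp
    then obtain i where "h = 2 ^ i" using divides_primepow_nat [OF two_is_prime_nat] by blast
    then show False using no_pp [of 2 i] by simp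
  next
    assume "safe_prime p"
    then obtain q where q: "Factorial_Ring.prime q" "p = 2 * q + 1" unfolding safe_prime_def by blast
    have q1: "q > 1" using q(1) by (rule prime_gt_1_nat)
    have h2q: "h dvd 2 * q" using h_dvd_p q(2) by simp
    \<comment> \<open>Of the divisors of 2q only 2q itself survives: values up to 2 leave no room
      for \<open>2 \<le> card K < h\<close>, and q is a prime.\<close>
    have "q dvd h"
    proof (rule ccontr)
      assume "\<not> q dvd h"
      then have "coprime q h" by (rule prime_imp_coprime [OF q(1)])
      then have "coprime h q" by (rule coprime_commute [THEN iffD1])
      then have "h dvd 2" using h2q by (simp add: coprime_dvd_mult_left_iff)
      then have "h \<le> 2" by (rule dvd_imp_le) simp
      then show False using K(2) ge2 [OF K(1)] by simp
    qed
    then obtain c where c: "h = q * c" by auto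
    then have "q * c dvd q * 2" using h2q by (simp add: mult.commute)
    then have "c dvd 2" using q1 by simp
    then have "c \<le> 2" by (rule dvd_imp_le) simp
    moreover have "c \<noteq> 0" using c s1 by auto
    moreover have "c \<noteq> 1" using no_pp [of q 1] q(1) c by auto
    ultimately have "c = 2" by simp
    then have h: "h = 2 * q" using c by simp
    have zl: "(0 :: int \<times> int) \<in> lev p 0" by (simp add: lev_def zero_prod_def)
    have "cls (0, 1) \<noteq> {0}" using cls_in(2) [OF one_in_cyl] by (auto simp: zero_prod_def)
    then have n0: "0 \<notin> cls (0, 1)" using class_eq [OF cls_in(1) [OF one_in_cyl] zero_class, of 0] by auto
    have sub0: "cls (0, 1) \<subseteq> lev p 0 - {0}"
      using cls_lev [OF one_in_cyl] n0 by (intro subset_Diff_insert [THEN iffD2]) simp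
    have "cls (0, 1) = lev p 0 - {0}"
      by (rule card_subset_eq [OF _ sub0]) (use h q(2) zl in \<open>simp_all add: h_def card_Diff_singleton\<close>)
    then have zero: "lev p 0 - {0} \<in> D" using cls_in(1) [OF one_in_cyl] by simp
    have geq: "q \<le> card E" if E: "E \<in> level_classes 1" for E
    proof -
      have "2 * q dvd card E * (card E - 1)" using h_dvd [OF E] h by simp
      then have "q dvd card E * (card E - 1)" by (rule dvd_mult_right)
      then show ?thesis using le_if_prime_power_dvd [OF q(1), of 1 "card E"] ge2 [OF E] by simp
    qed
    have "\<not> ?r \<le> Suc 0" using sr s1 by simp
    then have "\<not> (\<forall>A\<in>level_classes 1. \<forall>B\<in>level_classes 1. A = B)"
      unfolding card_le_Suc0_iff_eq [OF finite_classes [of 1]] .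
    then obtain A B where AB: "A \<in> level_classes 1" "B \<in> level_classes 1" "A \<noteq> B" by auto
    let ?R = "level_classes 1 - {A} - {B}"
    have sum: "card A + (card B + (\<Sum>E\<in>?R. card E)) = 2 * q + 1"
      using total q(2) AB sum.remove [OF finite_classes AB(1), of card]
        sum.remove [of "level_classes 1 - {A}" B card] finite_classes [of 1] by simp
    \<comment> \<open>Two classes already fill at least 2q of the 2q + 1 elements, and a third would
      need at least 2.\<close>
    have "?R = {}"
    proof (rule ccontr)
      assume "?R \<noteq> {}"
      then obtain E where E: "E \<in> ?R" by blast
      then have "card E \<le> (\<Sum>E\<in>?R. card E)"
        using finite_classes [of 1] by (intro member_le_sum) simp_all
      moreover have "card E \<ge> 2" using ge2 E by simp
      ultimately show False using sum geq [OF AB(1)] geq [OF AB(2)] by linarith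
    qed
    then have sum2: "card A + card B = 2 * q + 1" using sum by (simp only: sum.empty)
    have concl: False if "A \<in> level_classes 1" "B \<in> level_classes 1" "A \<noteq> B" "card A = q" "card B = q + 1" for A B
    proof -
      have disj: "A \<inter> B = {}" using disjoint_classes [of 1] that unfolding disjoint_def by simp
      then have sub: "B \<subseteq> lev p 1 - A" using KD(2) [OF that(2)] by auto
      have "B = lev p 1 - A"
      proof (rule card_subset_eq [OF _ sub])
        show "card B = card (lev p 1 - A)"
          using card_Diff_subset [OF fin [OF that(1)] KD(2) [OF that(1)]] that q(2) by simp
      qed simp
      then have "lev p 1 - A \<in> D" using KD(1) [OF that(2)] by simp
      then show False by (rule no_difference_set [OF q(2) q1 zero that(1,4)])
    qed
    have "card A = q \<and> card B = q + 1 \<or> card B = q \<and> card A = q + 1"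
      using sum2 geq [OF AB(1)] geq [OF AB(2)] by linarith
    then show False using concl [OF AB] concl [OF AB(2,1)] AB(3) by auto
  qed
qed

end

section \<open>Automorphisms fixing \<open>z\<^sup>p\<close>\<close>

text \<open>The endomorphism z |-> z^e a^b, a |-> a^i.\<close>

definition aut :: "nat \<Rightarrow> int \<Rightarrow> int \<Rightarrow> int \<Rightarrow> int \<times> int \<Rightarrow> int \<times> int" where
  "aut p e b i x = (e * fst x, (b * fst x + i * snd x) mod int p)"

lemma fst_aut [simp]: "fst (aut p e b i x) = e * fst x"
  by (simp add: aut_def)

lemma aut_aut: "aut p e b i (aut p e' b' i' x) = aut p (e * e') (b * e' + i * b') (i * i') x"
proof -
  have "(b * (e' * fst x) + i * ((b' * fst x + i' * snd x) mod int p)) mod int p =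
      (b * (e' * fst x) + i * (b' * fst x + i' * snd x)) mod int p"
    by (metis mod_add_right_eq mod_mult_right_eq)
  then show ?thesis by (simp add: aut_def algebra_simps)
qed

lemma aut_in_cyl: "p > 0 \<Longrightarrow> aut p e b i x \<in> cyl p"
  by (simp add: aut_def in_cylI)

context schur_cyl
begin

text \<open>For injective maps this already means that every class is permuted, since classes are
  finite.\<close>

definition preserves :: "(int \<times> int \<Rightarrow> int \<times> int) \<Rightarrow> bool" where
  "preserves f \<longleftrightarrow> (\<forall>x\<in>cyl p. f x \<in> cls x)"

lemma preservesI: "(\<And>x. x \<in> cyl p \<Longrightarrow> f x \<in> cls x) \<Longrightarrow> preserves f"
  unfolding preserves_def by (rule ballI)

lemma preservesD: "preserves f \<Longrightarrow> x \<in> cyl p \<Longrightarrow> f x \<in> cls x"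
  unfolding preserves_def by (rule bspec)

end

context schur_cyl_A
begin

section \<open>Automorphisms realising the classes when z^p is a class\<close>

lemma unit_factor:
  assumes x: "x \<in> lev p 0" "x \<noteq> 0" and y: "y \<in> lev p 0" "y \<noteq> 0"
  obtains i where "coprime i (int p)" "i \<noteq> 0" "red p (smul i x) = y"
proof -
  have xs: "fst x = 0" "0 < snd x" "snd x < int p" using x by (simp_all add: lev_iff in_cylI prod_eq_iff)
  have ys: "fst y = 0" "0 < snd y" "snd y < int p" using y by (simp_all add: lev_iff in_cylI prod_eq_iff)
  have cx: "coprime (snd x) (int p)" "coprime (snd y) (int p)"
    unfolding coprime_iff_not_dvd using xs ys by (simp_all add: zdvd_not_zless)
  obtain n l where n: "n * snd x = 1 + int p * l" "coprime n (int p)" "n \<noteq> 0"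
    using coprime_inverse [OF cx(1)] by blast
  have "snd y * n * snd x = snd y * (n * snd x)" by (rule mult.assoc)
  also have "\<dots> = snd y + int p * (l * snd y)" unfolding n(1) by (simp add: algebra_simps)
  finally have "snd y * n * snd x = snd y + int p * (l * snd y)" .
  then have "(snd y * n * snd x) mod int p = snd y mod int p" by (simp only: mod_mult_self2)
  then have "red p (smul (snd y * n) x) = y" using xs ys by (simp add: red_def prod_eq_iff)
  moreover have "coprime (snd y * n) (int p)" using cx n by simp
  ultimately show ?thesis using n ys by (intro that [of "snd y * n"]) simp_all
qed

text \<open>For x not the identity, let i carry x to y. Any other nontrivial u is x^n for a unit n,
  and u^i = y^n lies in the n-th power of the class of x, which is the class of u. Hence i preserves
  all of level 0 at once.\<close>

lemma level_zero_multiplier: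
  assumes x: "x \<in> lev p 0" and y: "y \<in> cls x"
  shows "\<exists>i. coprime i (int p) \<and> red p (smul i x) = y \<and> (\<forall>u\<in>lev p 0. red p (smul i u) \<in> cls u)"
proof -
  have xc: "x \<in> cyl p" using x by (simp add: lev_iff)
  have yl: "y \<in> lev p 0" using subsetD [OF cls_lev [OF xc] y] x by (simp add: lev_iff)
  then have yc: "y \<in> cyl p" by (simp add: lev_iff)
  have xy: "cls y = cls x" by (rule cls_cong [OF xc y])
  show ?thesis
  proof (cases "x = 0")
    case True
    then have "y = x" using y cls_0 by simp
    then have "coprime 1 (int p) \<and> red p (smul 1 x) = y \<and> (\<forall>u\<in>lev p 0. red p (smul 1 u) \<in> cls u)"
      using xc by (simp add: red_id lev_iff cls_in)
    then show ?thesis by blast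
  next
    case False
    have "y \<noteq> 0"
    proof
      assume "y = 0"
      then have "cls x = {0}" using xy cls_0 by simp
      then show False using cls_in(2) [OF xc] False by simp
    qed
    then obtain i where i: "coprime i (int p)" "i \<noteq> 0" "red p (smul i x) = y"
      using unit_factor [OF x False yl] by blast
    have "red p (smul i u) \<in> cls u" if u: "u \<in> lev p 0" for u
    proof (cases "u = 0")
      case True
      have "red p (0 :: int \<times> int) = 0" by (simp add: red_def zero_prod_def)
      then show ?thesis using True cls_0 by simp
    next
      case u0: False
      obtain n where n: "coprime n (int p)" "n \<noteq> 0" "red p (smul n x) = u"
        using unit_factor [OF x False u u0] by blast
      have "red p (smul i u) = red p (smul n y)"
        unfolding n(3) [symmetric] i(3) [symmetric] by (simp add: mult.commute)
      then have "cls (red p (smul i u)) = nmul p n (cls y)" using cls_nmul [OF n(1,2) yc] by simp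
      also have "\<dots> = cls u" unfolding xy using cls_nmul [OF n(1,2) xc] n(3) by simp
      finally show ?thesis using cls_in(2) [of "red p (smul i u)"] by (simp add: red_in_cyl)
    qed
    with i show ?thesis by blast
  qed
qed

text \<open>Multiplication by a unit \<open>i\<close> about the singleton class \<open>t\<close>, transported to every other singleton class \<open>s\<close>.\<close>

lemma centred_multiplier:
  assumes t: "{t} \<in> D" and x: "x \<in> lev p (fst t)" and y: "y \<in> cls x"
  obtains i where "coprime i (int p)" "red p (t + smul i (x - t)) = y"
    "\<And>s u. \<lbrakk>{s} \<in> D; u \<in> lev p (fst s)\<rbrakk> \<Longrightarrow> red p (s + smul i (u - s)) \<in> cls u"
proof -
  have neg: "{red p (- s)} \<in> D" if "{s} \<in> D" for s
    using neg_class [OF that] by (simp add: nmul_def)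
  have xc: "x \<in> cyl p" using x by (simp add: lev_iff)
  have yc: "y \<in> cyl p" by (rule subsetD [OF cls_subset_cyl [OF xc] y])
  have zero: "red p (u - s) \<in> lev p 0" if "u \<in> lev p (fst s)" for s u
    using that by (simp add: lev_iff red_in_cyl)
  have "red p (y + red p (- t)) \<in> cls (red p (x + red p (- t)))"
    using class_shift [OF neg [OF t] xc yc] y by simp
  then have "red p (y - t) \<in> cls (red p (x - t))" by simp
  from level_zero_multiplier [OF zero [OF x] this]
  obtain i where i: "coprime i (int p)" "red p (smul i (red p (x - t))) = red p (y - t)"
    and pres: "\<forall>u\<in>lev p 0. red p (smul i u) \<in> cls u" by blast
  have "red p (t + smul i (x - t)) = red p (t + red p (smul i (red p (x - t))))" by simp
  also have "\<dots> = red p y" unfolding i(2) by simp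
  also have "\<dots> = y" by (rule red_id [OF yc])
  finally have eq: "red p (t + smul i (x - t)) = y" .
  have "red p (s + smul i (u - s)) \<in> cls u" if s: "{s} \<in> D" and u: "u \<in> lev p (fst s)" for s u
  proof -
    have "red p (smul i (red p (u - s))) \<in> cls (red p (u - s))"
      by (rule bspec [OF pres zero [OF u]])
    then have "red p (red p (smul i (red p (u - s))) + s) \<in> cls (red p (red p (u - s) + s))"
      by (rule class_shift_imp [OF s red_in_cyl [OF p_pos]])
    moreover have "red p (red p (u - s) + s) = u" using u by (simp add: red_id lev_iff)
    ultimately show ?thesis by (simp add: add.commute)
  qed
  with i(1) eq show ?thesis by (rule that)
qed

lemma p_multiple_class: "{(int p * l, 0)} \<in> D"
  using singleton_multiple [OF p_class, of l] by (simp add: red_def smul_def mult.commute)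

lemma transitive_A:
  assumes dich: "lev p 1 \<in> D \<or> (\<exists>b. {(1, b)} \<in> D)" and x: "x \<in> cyl p" and y: "y \<in> cls x"
  shows "\<exists>b i. coprime i (int p) \<and> aut p 1 b i x = y \<and> preserves (aut p 1 b i)"
proof -
  have yl: "y \<in> lev p (fst x)" by (rule subsetD [OF cls_lev [OF x] y])
  then have yc: "y \<in> cyl p" "fst y = fst x" by (simp_all add: lev_iff)
  have xl: "x \<in> lev p (fst x)" using x by (simp add: lev_iff)
  from dich show ?thesis
  proof
    assume full: "lev p 1 \<in> D"
    have free: "v \<in> cls u" if "u \<in> cyl p" "v \<in> cyl p" "fst v = fst u" "\<not> int p dvd fst u" for u v
    proof -
      have "cls u = lev p (fst u)"
        by (rule cls_eq [OF lev_class_multiple [OF full that(4)]]) (use that in \<open>simp add: lev_iff\<close>)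
      then show ?thesis using that by (simp add: lev_iff)
    qed
    show ?thesis
    proof (cases "int p dvd fst x")
      case True
      then obtain l where l: "fst x = int p * l" by blast
      have xl: "x \<in> lev p (fst (int p * l, 0))" using x l by (simp add: lev_iff)
      obtain i where i: "coprime i (int p)" "red p ((int p * l, 0) + smul i (x - (int p * l, 0))) = y"
        and pres: "\<And>s u. \<lbrakk>{s} \<in> D; u \<in> lev p (fst s)\<rbrakk> \<Longrightarrow> red p (s + smul i (u - s)) \<in> cls u"
        by (rule centred_multiplier [OF p_multiple_class xl y]) blast
      have form: "red p ((fst u, 0) + smul i (u - (fst u, 0))) = aut p 1 0 i u" for u
        by (simp add: red_def aut_def)
      \<comment> \<open>Levels divisible by p contain singleton classes z^(p l), about which i is
        centred; every other level is a single class and imposes no condition beyond keeping the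
        level.\<close>
      have "preserves (aut p 1 0 i)"
      proof (rule preservesI)
        fix u assume u: "u \<in> cyl p"
        show "aut p 1 0 i u \<in> cls u"
        proof (cases "int p dvd fst u")
          case True
          then have "{(fst u, 0)} \<in> D" using p_multiple_class by auto
          from pres [OF this, of u] show ?thesis using u by (simp add: form lev_iff)
        next
          case False
          then show ?thesis by (intro free u aut_in_cyl p_pos) simp_all
        qed
      qed
      moreover have "aut p 1 0 i x = y" using i(2) form [of x] l by simp
      ultimately show ?thesis using i(1) by blast
    next
      case False
      then have c: "coprime (fst x) (int p)" unfolding coprime_iff_not_dvd .
      obtain n l where n: "n * fst x = 1 + int p * l" using coprime_inverse [OF c] by blast
      \<comment> \<open>As n inverts the level of x modulo p, z |-> z a^b with this exponent b
        carries x to y; it is the identity on the levels divisible by p.\<close>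
      let ?b = "(snd y - snd x) * n"
      have "?b * fst x + 1 * snd x = (snd y - snd x) * (n * fst x) + snd x" by (simp add: mult.assoc)
      also have "\<dots> = snd y + int p * (l * (snd y - snd x))" unfolding n by (simp add: algebra_simps)
      finally have "(?b * fst x + 1 * snd x) mod int p = snd y mod int p" by (simp only: mod_mult_self2)
      then have "aut p 1 ?b 1 x = y" using yc by (simp add: aut_def prod_eq_iff in_cylI)
      moreover have "preserves (aut p 1 ?b 1)"
      proof (rule preservesI)
        fix u assume u: "u \<in> cyl p"
        show "aut p 1 ?b 1 u \<in> cls u"
        proof (cases "int p dvd fst u")
          case True
          then obtain k where "fst u = int p * k" by blast
          then have "?b * fst u + 1 * snd u = snd u + int p * (?b * k)" by (simp add: algebra_simps)
          then have "(?b * fst u + 1 * snd u) mod int p = snd u mod int p" by (simp only: mod_mult_self2)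
          then have "aut p 1 ?b 1 u = u" using u by (simp add: aut_def prod_eq_iff in_cylI)
          then show ?thesis using cls_in(2) [OF u] by simp
        next
          case False
          then show ?thesis by (intro free u aut_in_cyl p_pos) simp_all
        qed
      qed
      ultimately show ?thesis by (intro exI [of _ ?b] exI [of _ 1]) simp
    qed
  next
    assume "\<exists>b. {(1, b)} \<in> D"
    then obtain b where b: "{(1, b)} \<in> D" by blast
    let ?t = "\<lambda>m. red p (smul m (1, b))"
    have t: "{?t m} \<in> D" and ft: "fst (?t m) = m" for m by (simp_all add: singleton_multiple [OF b])
    have xl: "x \<in> lev p (fst (?t (fst x)))" using x by (simp add: lev_iff)
    obtain i where i: "coprime i (int p)" "red p (?t (fst x) + smul i (x - ?t (fst x))) = y"
      and pres: "\<And>s u. \<lbrakk>{s} \<in> D; u \<in> lev p (fst s)\<rbrakk> \<Longrightarrow> red p (s + smul i (u - s)) \<in> cls u"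
      by (rule centred_multiplier [OF t xl y]) blast
    \<comment> \<open>Chosen so that the singleton (1, b) is fixed. The multiplications by i centred
      at its powers, one on each level, are then a single automorphism.\<close>
    let ?b = "b * (1 - i)"
    have form: "red p (?t (fst u) + smul i (u - ?t (fst u))) = aut p 1 ?b i u" for u
    proof -
      have collapse: "red p (v + smul i w) = red p (v + red p (smul i (red p w)))" for v w by simp
      have "red p (?t (fst u) + smul i (u - ?t (fst u))) = red p (smul (fst u) (1, b) + smul i (u - ?t (fst u)))"
        by (rule red_simps)
      also have "\<dots> = red p (smul (fst u) (1, b) + red p (smul i (red p (u - smul (fst u) (1, b)))))"
        unfolding collapse [of _ "u - ?t (fst u)"] red_simps(6) ..
      also have "\<dots> = red p (smul (fst u) (1, b) + smul i (u - smul (fst u) (1, b)))"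
        by (rule collapse [symmetric])
      also have "\<dots> = aut p 1 ?b i u" by (simp add: red_def aut_def algebra_simps)
      finally show ?thesis .
    qed
    have "preserves (aut p 1 ?b i)"
    proof (rule preservesI)
      fix u assume u: "u \<in> cyl p"
      have "red p (?t (fst u) + smul i (u - ?t (fst u))) \<in> cls u"
        by (rule pres [OF t]) (use u in \<open>simp add: lev_iff\<close>)
      then show "aut p 1 ?b i u \<in> cls u" unfolding form .
    qed
    moreover have "aut p 1 ?b i x = y" using i(2) unfolding form .
    ultimately show ?thesis using i(1) by blast
  qed
qed

end

section \<open>The reflection\<close>

context schur_cyl_N
begin

lemma schur_cyl_A_slices: "schur_cyl_A p slices"
proof (rule schur_cyl_A.intro [OF schur_cyl_slices], unfold_locales)
  have "(int p, 0) \<in> cyl p" by (simp add: in_cylI)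
  then show "{(int p, 0)} \<in> slices" unfolding slices_def slice_p [symmetric] by (rule imageI)
  fix C x y assume C: "C \<in> slices" and x: "x \<in> C" and y: "y \<in> C"
  then obtain z where "C = slice z" unfolding slices_def by blast
  then show "fst x = fst y" using x y by (simp add: slice_def)
qed

section \<open>Passing between classes and slices\<close>

interpretation A: schur_cyl_A p slices
  by (rule schur_cyl_A_slices)

lemma A_cls: assumes "x \<in> cyl p" shows "A.cls x = slice x"
  by (rule A.cls_eq) (use assms slice_self in \<open>simp_all add: slices_def\<close>)

lemma slice_imp_cls: assumes "x \<in> cyl p" "fst x \<noteq> 0" "y \<in> slice x" shows "y \<in> cls x"
  using slice_iff [OF assms(1), of 0 y] assms cls_in(2) [of y] by simp

lemma cls_imp_slice: assumes "x \<in> cyl p" "fst x \<noteq> 0" "y \<in> cls x" "fst y = fst x" shows "y \<in> slice x"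
  using slice_iff [OF assms(1), of 0 y] assms cls_cong [OF assms(1,3)] subsetD [OF cls_subset_cyl [OF assms(1)] assms(3)]
  by simp

text \<open>The class of z^p u lies in the class of u times {z^p, z^-p}, and the level of an element
  tells which translation produced it. This carries results from the levels p and -p down to level
  0.\<close>

lemma cls_level_zero:
  assumes u: "u \<in> cyl p" "fst u = 0" and v: "fst v = 0" and w: "shift p 1 v \<in> cls (shift p 1 u) \<or> shift p (- 1) v \<in> cls (shift p 1 u)"
  shows "v \<in> cls u"
proof -
  let ?A = "sset p (cls u) (pm p 1)"
  have S: "S_set ?A" by (intro S_set_sset S_set_pm S_set_class cls_in u)
  have "shift p 1 u \<in> ?A" by (rule sset_pm_memI(1) [OF cls_in(2) [OF u(1)] u(1)])
  then have sub: "cls (shift p 1 u) \<subseteq> ?A" by (rule S_set_cls_subset [OF S])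
  have key: "v \<in> cls u" if k: "k = 1 \<or> k = - 1" and vk: "shift p k v \<in> cls (shift p 1 u)" for k
  proof -
    obtain t where t: "t \<in> cls u" "shift p k v = shift p 1 t \<or> shift p k v = shift p (- 1) t"
      using sset_pm_memE [OF subsetD [OF sub vk] cls_subset_cyl [OF u(1)]] by blast
    have ft: "fst t = 0" using fst_cls [OF u(1) t(1)] u(2) by simp
    obtain s where s: "shift p k v = shift p s t" using t(2) by blast
    then have "fst (shift p k v) = fst (shift p s t)" by simp
    then have "k = s" using v ft by simp
    then have "v = t" using s by (simp add: shift_inj)
    then show ?thesis using t(1) by simp
  qed
  from w show ?thesis using key [of 1] key [of "- 1"] by auto
qed

text \<open>Off level 0 a slice lies inside a class. Level 0 is reached through level p, because an
  automorphism with \<open>e = 1\<close> fixes z^p and so commutes with translation by it.\<close>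

lemma preserves_slices: assumes "A.preserves (aut p 1 b i)" shows "preserves (aut p 1 b i)"
proof (rule preservesI)
  fix u assume u: "u \<in> cyl p"
  have slice: "aut p 1 b i w \<in> slice w" if "w \<in> cyl p" for w
    using A.preservesD [OF assms that] A_cls [OF that] by simp
  show "aut p 1 b i u \<in> cls u"
  proof (cases "fst u = 0")
    case True
    have "(b * int p + i * snd u) mod int p = (i * snd u) mod int p" by simp
    then have "aut p 1 b i (shift p 1 u) = shift p 1 (aut p 1 b i u)" using True by (simp add: aut_def shift_def)
    then have "shift p 1 (aut p 1 b i u) \<in> slice (shift p 1 u)" using slice [of "shift p 1 u"] u by simp
    then have "shift p 1 (aut p 1 b i u) \<in> cls (shift p 1 u)" by (rule slice_imp_cls [rotated 2]) (use u True in simp_all)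
    then show ?thesis using True by (intro cls_level_zero [OF u True]) simp_all
  next
    case False
    show ?thesis by (rule slice_imp_cls [OF u False slice [OF u]])
  qed
qed

lemma transitive_slices:
  assumes dich: "lev p 1 \<in> slices \<or> (\<exists>b. {(1, b)} \<in> slices)" and x: "x \<in> cyl p" and y: "y \<in> slice x"
  shows "\<exists>b i. coprime i (int p) \<and> aut p 1 b i x = y \<and> preserves (aut p 1 b i)"
  using A.transitive_A [OF dich x] y A_cls [OF x] preserves_slices by metis

text \<open>If a class joined the levels m and -m with m not 0, its translate by z^p would join m +
  p and -m + p, which are neither equal nor opposite.\<close>

lemma slice_if_p_class:
  assumes p: "{(int p, 0)} \<in> D" and x: "x \<in> cyl p" and y: "y \<in> cls x"
  shows "y \<in> slice x"
proof -
  have yc: "y \<in> cyl p" by (rule subsetD [OF cls_subset_cyl [OF x] y])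
  have shift: "red p (v + (int p, 0)) = shift p 1 v" if "v \<in> cyl p" for v
    using that by (simp add: shift_def red_def in_cylI)
  have s: "shift p 1 y \<in> cls (shift p 1 x)" using class_shift [OF p x yc] y shift [OF x] shift [OF yc] by simp
  have "fst (shift p 1 y) = fst (shift p 1 x) \<or> fst (shift p 1 y) = - fst (shift p 1 x)"
    by (rule fst_cls [OF _ s]) (simp add: x)
  moreover have "int p > 0" by simp
  ultimately have f: "fst y = fst x" using fst_cls [OF x y] by auto
  show ?thesis
  proof (cases "fst x = 0")
    case True
    have "cls (shift p 1 y) = cls (shift p 1 x)" by (rule cls_cong [OF _ s]) (simp add: x)
    then show ?thesis using slice_iff [OF x, of 1 y] True f yc by simp
  next
    case False
    show ?thesis by (rule cls_imp_slice [OF x False y f])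
  qed
qed

section \<open>Levels as unions of classes, and partners at opposite levels\<close>

lemma sset_lev: assumes B: "B \<subseteq> lev p m" "B \<noteq> {}" shows "sset p B (lev p n) = lev p (m + n)"
proof
  show "sset p B (lev p n) \<subseteq> lev p (m + n)"
  proof
    fix z assume "z \<in> sset p B (lev p n)"
    then obtain x y where "x \<in> B" "y \<in> lev p n" "z = red p (x + y)" by (rule sset_memE)
    then show "z \<in> lev p (m + n)" using subsetD [OF B(1), of x] by (simp add: lev_iff red_in_cyl)
  qed
  show "lev p (m + n) \<subseteq> sset p B (lev p n)"
  proof
    fix z assume z: "z \<in> lev p (m + n)"
    obtain x where x: "x \<in> B" using B(2) by blast
    have "red p (z - x) \<in> lev p n" using z subsetD [OF B(1) x] by (simp add: lev_iff red_in_cyl)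
    moreover have "z = red p (x + red p (z - x))" using z by (simp add: lev_iff red_id)
    ultimately show "z \<in> sset p B (lev p n)" by (rule S_set_sset_memI [OF x])
  qed
qed

lemma lev_nonempty: "lev p m \<noteq> {}"
  by (simp add: lev_def)

lemma S_set_lev_0: "S_set (lev p 0)"
proof -
  have "lev p 0 = {x \<in> cyl p. fst x = 0 \<or> fst x = - 0}" by (rule Set.set_eqI) (simp add: lev_iff)
  then show ?thesis using S_set_levels [of 0] by simp
qed

text \<open>A class on one level only would make \<open>z\<^sup>p\<close> a singleton class.\<close>

lemma both_levels:
  assumes np: "{(int p, 0)} \<notin> D" and x: "x \<in> cyl p" "fst x \<noteq> 0"
  shows "\<exists>y\<in>cls x. fst y = - fst x"
proof (rule ccontr)
  assume neg: "\<not> ?thesis"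
  let ?m = "fst x"
  have sub: "cls x \<subseteq> lev p ?m"
  proof
    fix y assume y: "y \<in> cls x"
    then have "fst y = ?m" using fst_cls [OF x(1) y] neg by auto
    then show "y \<in> lev p ?m" using subsetD [OF cls_subset_cyl [OF x(1)] y] by (simp add: lev_iff)
  qed
  have "cls x \<noteq> {}" using cls_in(2) [OF x(1)] by auto
  from sset_lev [OF sub this, of 0] have eq: "sset p (cls x) (lev p 0) = lev p ?m" by simp
  have "S_set (sset p (cls x) (lev p 0))" by (intro S_set_sset S_set_lev_0 S_set_class cls_in x)
  then have Sm: "S_set (lev p ?m)" unfolding eq .
  have "S_set (lev p (int n * ?m))" for n
  proof (induction n)
    case 0
    show ?case using S_set_lev_0 by simp
  next
    case (Suc n)
    have "sset p (lev p (int n * ?m)) (lev p ?m) = lev p (int n * ?m + ?m)"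
      by (rule sset_lev [OF subset_refl lev_nonempty])
    then have "S_set (lev p (int n * ?m + ?m))" using S_set_sset [OF Suc.IH Sm] by simp
    then show ?case by (simp add: algebra_simps)
  qed
  \<comment> \<open>With m the level of x, level p m meets <z^p> in z^(p m) alone.\<close>
  then have "S_set (lev p (int p * ?m) \<inter> {(int p * m, 0) | m. True})" by (intro S_set_Int S_set_N)
  moreover have "lev p (int p * ?m) \<inter> {(int p * m, 0) | m. True} = {(int p * ?m, 0)}"
    by (auto simp: lev_def)
  ultimately have "S_set {(int p * ?m, 0)}" by simp
  then have "S_set (nmul p (-1) {(int p * ?m, 0)})" by (rule S_set_neg)
  then have t: "S_set {(- (int p * ?m), 0)}" by (simp add: nmul_def red_def)
  \<comment> \<open>A second union of classes around z^p. Its other element lies outside {z^p,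
    z^-p}, unless m = -1, when the pair collapses to z^p.\<close>
  let ?B = "sset p (pm p (1 + ?m)) {(- (int p * ?m), 0)}"
  have B: "?B \<subseteq> {(int p, 0), (- int p - 2 * int p * ?m, 0)}"
  proof
    fix z assume "z \<in> ?B"
    then obtain u v where "u \<in> pm p (1 + ?m)" "v \<in> {(- (int p * ?m), 0)}" "z = red p (u + v)" by (rule sset_memE)
    then show "z \<in> {(int p, 0), (- int p - 2 * int p * ?m, 0)}"
      by (auto simp: pm_def red_def algebra_simps)
  qed
  have SB: "S_set ?B" by (rule S_set_sset [OF S_set_pm t])
  have "(int p, 0) \<in> ?B"
    by (rule S_set_sset_memI [of "(int p * (1 + ?m), 0)" _ "(- (int p * ?m), 0)"])
      (simp_all add: pm_def red_def algebra_simps)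
  from S_set_cls_subset [OF SB this] B have "cls (int p, 0) \<subseteq> {(int p, 0), (- int p - 2 * int p * ?m, 0)}" by blast
  moreover have "(- int p - 2 * int p * ?m, 0) \<notin> cls (int p, 0)"
  proof
    assume "(- int p - 2 * int p * ?m, 0) \<in> cls (int p, 0)"
    then have "(- int p - 2 * int p * ?m, 0) \<in> pm p 1" by (rule subsetD [OF pm_1_subset])
    then have "- int p - 2 * int p * ?m = int p \<or> - int p - 2 * int p * ?m = - int p" by (auto simp: pm_def)
    then have "2 * (int p * (1 + ?m)) = 0 \<or> 2 * (int p * ?m) = 0" by (simp add: algebra_simps)
    then have "1 + ?m = 0 \<or> ?m = 0" by (simp only: mult_eq_0_iff of_nat_eq_0_iff p_ne_0 zero_neq_numeral numeral_neq_zero simp_thms)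
    then have m: "?m = - 1" using x(2) by auto
    have "pm p (1 + ?m) = {(0, 0)}" unfolding m by (simp add: pm_def)
    then have "?B = {(int p, 0)}" unfolding m by (auto simp: sset_def red_def)
    then have "{(int p, 0)} \<in> D" using SB by (intro S_set_singleton_class) simp
    then show False using np by simp
  qed
  ultimately have "cls (int p, 0) \<subseteq> {(int p, 0)}" by blast
  moreover have pc: "(int p, 0) \<in> cyl p" by (simp add: in_cylI)
  ultimately have "cls (int p, 0) = {(int p, 0)}" using cls_in(2) [OF pc] by blast
  then show False using np cls_in(1) [OF pc] by simp
qed

lemma card_lev_convolution:
  assumes C: "C \<subseteq> cyl p" and g: "g \<in> cyl p"
  shows "card {(u, v). u \<in> C \<and> v \<in> lev p 0 \<and> red p (u + v) = g} = card {u \<in> C. fst u = fst g}"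
proof (rule bij_betw_same_card [of fst])
  show "bij_betw fst {(u, v). u \<in> C \<and> v \<in> lev p 0 \<and> red p (u + v) = g} {u \<in> C. fst u = fst g}"
  proof (rule bij_betw_imageI)
    show "inj_on fst {(u, v). u \<in> C \<and> v \<in> lev p 0 \<and> red p (u + v) = g}"
    proof (rule inj_onI)
      fix a b assume a: "a \<in> {(u, v). u \<in> C \<and> v \<in> lev p 0 \<and> red p (u + v) = g}"
        and b: "b \<in> {(u, v). u \<in> C \<and> v \<in> lev p 0 \<and> red p (u + v) = g}" and eq: "fst a = fst b"
      have v: "v = red p (g - u)" if "v \<in> lev p 0" "red p (u + v) = g" for u v
      proof -
        have "red p (g - u) = red p (u + v - u)" unfolding that(2) [symmetric] by (rule red_simps)
        also have "\<dots> = red p v" by simp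
        also have "\<dots> = v" using that(1) by (simp add: lev_iff red_id)
        finally show ?thesis by simp
      qed
      obtain u1 v1 u2 v2 where ab: "a = (u1, v1)" "b = (u2, v2)" by (cases a, cases b) blast
      have "v1 = red p (g - u1)" "v2 = red p (g - u2)" using a b unfolding ab by (simp_all add: v)
      then show "a = b" using eq unfolding ab by simp
    qed
    show "fst ` {(u, v). u \<in> C \<and> v \<in> lev p 0 \<and> red p (u + v) = g} = {u \<in> C. fst u = fst g}"
    proof (intro Set.set_eqI iffI)
      fix u assume "u \<in> fst ` {(u, v). u \<in> C \<and> v \<in> lev p 0 \<and> red p (u + v) = g}"
      then obtain v where uv: "u \<in> C" "v \<in> lev p 0" "red p (u + v) = g" by auto
      have "fst (red p (u + v)) = fst u" using uv(2) by (simp add: lev_iff)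
      then show "u \<in> {u \<in> C. fst u = fst g}" using uv by simp
    next
      fix u assume u: "u \<in> {u \<in> C. fst u = fst g}"
      have "red p (g - u) \<in> lev p 0" using u by (simp add: lev_iff red_in_cyl)
      moreover have "red p (u + red p (g - u)) = g" using g by (simp add: red_id)
      ultimately have "(u, red p (g - u)) \<in> {(u, v). u \<in> C \<and> v \<in> lev p 0 \<and> red p (u + v) = g}" using u by simp
      then show "u \<in> fst ` {(u, v). u \<in> C \<and> v \<in> lev p 0 \<and> red p (u + v) = g}" by (rule image_eqI [rotated]) simp
    qed
  qed
qed

text \<open>In the product of the class of x with the torsion subgroup, the coefficient at g counts
  the elements of the class on the level of g. It agrees at x and y, and the parts of the class on
  their levels are the two slices.\<close>

lemma card_slice_eq:
  assumes x: "x \<in> cyl p" "fst x \<noteq> 0" and y: "y \<in> cls x" "fst y = - fst x"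
  shows "card (slice y) = card (slice x)"
proof -
  have yc: "y \<in> cyl p" by (rule subsetD [OF cls_subset_cyl [OF x(1)] y(1)])
  have slice: "slice w = {u \<in> cls x. fst u = fst w}" if w: "w \<in> cls x" "fst w \<noteq> 0" for w
  proof -
    have wc: "w \<in> cyl p" by (rule subsetD [OF cls_subset_cyl [OF x(1)] w(1)])
    have eq: "cls w = cls x" by (rule cls_cong [OF x(1) w(1)])
    have lev: "fst u = fst w" if "u \<in> slice w" for u using that by (simp add: slice_def)
    show ?thesis
    proof (intro Set.set_eqI iffI)
      fix u assume "u \<in> slice w"
      then show "u \<in> {u \<in> cls x. fst u = fst w}" using slice_imp_cls [OF wc w(2)] lev eq by simp
    next
      fix u assume "u \<in> {u \<in> cls x. fst u = fst w}"
      then show "u \<in> slice w" using cls_imp_slice [OF wc w(2)] eq by simp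
    qed
  qed
  have S: "S (class_sum (cls x) * class_sum (lev p 0))"
    by (intro S_mult S_class_sum S_set_lev_0 S_set_class finite_cls finite_lev cls_in x(1))
  have "cf p (class_sum (cls x) * class_sum (lev p 0)) x = cf p (class_sum (cls x) * class_sum (lev p 0)) y"
    by (rule S_D [OF S cls_in [OF x(1)] y(1)])
  then have "card {u \<in> cls x. fst u = fst x} = card {u \<in> cls x. fst u = fst y}"
    unfolding cf_class_sum_mult [OF finite_cls [OF x(1)] finite_lev]
      card_lev_convolution [OF cls_subset_cyl [OF x(1)] x(1)] card_lev_convolution [OF cls_subset_cyl [OF x(1)] yc]
    by simp
  then show ?thesis using slice [OF cls_in(2) [OF x(1)] x(2)] slice [OF y(1)] x(2) y(2) by simp
qed

text \<open>The multiplier \<open>j\<close> of the reflection is read off from the partner of \<open>z\<^sup>p a\<close> at level \<open>-p\<close>.\<close>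

lemma reflection_p_levels:
  assumes np: "{(int p, 0)} \<notin> D"
  shows "\<exists>j. coprime j (int p) \<and> (\<forall>m k. m \<noteq> 0 \<longrightarrow> 0 \<le> k \<longrightarrow> k < int p \<longrightarrow>
    (- (int p * m), (j * k) mod int p) \<in> cls (int p * m, k))"
proof -
  have x0: "(int p, 1) \<in> cyl p" using p_gt_1 by (simp add: in_cylI)
  have "\<exists>y\<in>cls (int p, 1). fst y = - fst (int p, 1 :: int)"
    by (rule both_levels [OF np x0]) simp
  then obtain y where y: "y \<in> cls (int p, 1)" "fst y = - int p" by auto
  define j where "j = snd y"
  have yj: "y = (- int p, j)" using y(2) by (simp add: j_def prod_eq_iff)
  have yc: "y \<in> cyl p" by (rule subsetD [OF cls_subset_cyl [OF x0] y(1)])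
  have j: "0 \<le> j" "j < int p" using yc by (simp_all add: yj in_cylI)
  have "j \<noteq> 0"
  proof
    assume "j = 0"
    then have "y \<in> pm p 1" by (simp add: yj pm_def)
    then have "cls y \<subseteq> pm p 1" by (rule S_set_cls_subset [OF S_set_pm])
    then have "(int p, 1) \<in> pm p 1" using cls_cong [OF x0 y(1)] cls_in(2) [OF x0] by auto
    then show False by (simp add: pm_def)
  qed
  then have cj: "coprime j (int p)" unfolding A.coprime_iff_not_dvd using j by (simp add: zdvd_not_zless)
  have "(- (int p * m), (j * k) mod int p) \<in> cls (int p * m, k)"
    if m: "m \<noteq> 0" and k: "0 \<le> k" "k < int p" for m k
  proof -
    let ?x = "(int p * m, k)"
    have x: "?x \<in> cyl p" "fst ?x \<noteq> 0" using k m by (simp_all add: in_cylI)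
    obtain w where w: "w \<in> cls ?x" "fst w = - (int p * m)" using both_levels [OF np x] by auto
    have wc: "w \<in> cyl p" by (rule subsetD [OF cls_subset_cyl [OF x(1)] w(1)])
    show ?thesis
    proof (cases "k = 0")
      case True
      then have "?x \<in> pm p m" by (simp add: pm_def)
      then have "w \<in> pm p m" using S_set_cls_subset [OF S_set_pm, of ?x m] w(1) by blast
      then have "w = (- (int p * m), 0)" using w(2) m by (auto simp: pm_def)
      then show ?thesis using w(1) True by simp
    next
      case False
      then have ck: "coprime k (int p)" unfolding A.coprime_iff_not_dvd using k by (simp add: zdvd_not_zless)
      \<comment> \<open>The element (p m, k) arises from (p, 1) by the exponent k followed by the
        translation z^(p (m - k)). So w comes from a k-th power of some e in the class of (p, 1), up
        to the sign of the translation.\<close>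
      let ?E = "nmul p k (cls (int p, 1))" and ?A = "sset p (nmul p k (cls (int p, 1))) (pm p (m - k))"
      have S: "S_set ?A" by (intro S_set_sset S_set_pm S_set_nmul_coprime ck False finite_cls S_set_class cls_in x0)
      have "red p (smul k (int p, 1)) \<in> ?E" unfolding nmul_def by (rule imageI) (rule cls_in(2) [OF x0])
      then have "shift p (m - k) (red p (smul k (int p, 1))) \<in> ?A"
        by (rule sset_pm_memI(1)) (simp add: red_in_cyl)
      moreover have "shift p (m - k) (red p (smul k (int p, 1))) = ?x"
        using k by (simp add: shift_def red_def smul_def algebra_simps)
      ultimately have "?x \<in> ?A" by simp
      from subsetD [OF S_set_cls_subset [OF S this] w(1)]
      obtain v where v: "v \<in> ?E" "w = shift p (m - k) v \<or> w = shift p (- (m - k)) v"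
        by (rule sset_pm_memE [OF _ nmul_subset_cyl])
      obtain e where e: "e \<in> cls (int p, 1)" "v = red p (smul k e)" using v(1) unfolding nmul_def by (rule imageE)
      have "fst e = int p \<or> fst e = - int p" using fst_cls [OF x0 e(1)] by simp
      then have "\<exists>\<epsilon>. (\<epsilon> = 1 \<or> \<epsilon> = - 1) \<and> fst e = int p * \<epsilon>"
        by (elim disjE) (intro exI [of _ 1], simp, intro exI [of _ "- 1"], simp)
      then obtain \<epsilon> where eps: "\<epsilon> = 1 \<or> \<epsilon> = - 1" "fst e = int p * \<epsilon>" by blast
      have "\<exists>\<delta>. (\<delta> = 1 \<or> \<delta> = - 1) \<and> w = shift p (\<delta> * (m - k)) v"
        using v(2) by (elim disjE) (intro exI [of _ 1], simp, intro exI [of _ "- 1"], simp)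
      then obtain \<delta> where del: "\<delta> = 1 \<or> \<delta> = - 1" "w = shift p (\<delta> * (m - k)) v" by blast
      have "fst w = int p * (k * \<epsilon> + \<delta> * (m - k))" using del(2) e(2) eps(2) by (simp add: algebra_simps)
      then have "int p * (k * \<epsilon> + \<delta> * (m - k)) = int p * (- m)" using w(2) by simp
      then have lev: "k * \<epsilon> + \<delta> * (m - k) = - m"
        by (simp only: mult_cancel_left of_nat_eq_0_iff p_ne_0 simp_thms)
      \<comment> \<open>Comparing levels, e must come from level -p and the translation must be
        reversed. If m = k it is trivial and \<delta> = 1 remains possible; hence the form of the
        second conjunct.\<close>
      have *: "\<epsilon> = - 1 \<and> \<delta> * (m - k) = - (m - k)"
        using eps(1) del(1)
      proof (elim disjE)
        assume "\<epsilon> = 1" "\<delta> = 1" then show ?thesis using lev m by simp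
      next
        assume "\<epsilon> = 1" "\<delta> = - 1" then show ?thesis using lev False by simp
      next
        assume "\<epsilon> = - 1" "\<delta> = 1" then show ?thesis using lev by simp
      next
        assume "\<epsilon> = - 1" "\<delta> = - 1" then show ?thesis by simp
      qed
      have yb: "cls y = cls (int p, 1)" by (rule cls_cong [OF x0 y(1)])
      have "e \<in> slice y" by (rule cls_imp_slice [OF yc]) (use yb e(1) eps(2) * y(2) in simp_all)
      then have "red p (smul k e) \<in> nmul p k (slice y)" unfolding nmul_def by (rule imageI)
      also have "nmul p k (slice y) = slice (red p (smul k y))"
        using A.cls_nmul [OF ck False yc] A_cls [OF yc] A_cls [of "red p (smul k y)"] by (simp add: red_in_cyl)
      finally have "v \<in> slice (red p (smul k y))" unfolding e(2) .
      then have "shift p (\<delta> * (m - k)) v \<in> slice (shift p (\<delta> * (m - k)) (red p (smul k y)))"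
        by (simp only: slice_shift [OF red_in_cyl [OF p_pos]])
      moreover have "shift p (\<delta> * (m - k)) (red p (smul k y)) = (- (int p * m), (j * k) mod int p)"
        unfolding conjunct2 [OF *] by (simp add: yj shift_def red_def smul_def algebra_simps)
      ultimately have "w \<in> slice (- (int p * m), (j * k) mod int p)" using del(2) by simp
      moreover have zc: "(- (int p * m), (j * k) mod int p) \<in> cyl p" by (simp add: in_cylI)
      ultimately have "w \<in> cls (- (int p * m), (j * k) mod int p)"
        using m by (intro slice_imp_cls) simp_all
      then have "cls w = cls (- (int p * m), (j * k) mod int p)" by (rule cls_cong [OF zc])
      then show ?thesis using cls_cong [OF x(1) w(1)] cls_in(2) [OF zc] by simp
    qed
  qed
  with cj show ?thesis by blast
qed

lemma reflection_level_zero: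
  assumes "\<And>m k. \<lbrakk>m \<noteq> 0; 0 \<le> k; k < int p\<rbrakk> \<Longrightarrow> (- (int p * m), (j * k) mod int p) \<in> cls (int p * m, k)"
    and u: "u \<in> cyl p" "fst u = 0"
  shows "aut p (- 1) c j u \<in> cls u"
proof (rule cls_level_zero [OF u])
  have "(- (int p * 1), (j * snd u) mod int p) \<in> cls (int p * 1, snd u)"
    by (rule assms(1)) (use u in \<open>simp_all add: in_cylI\<close>)
  moreover have "shift p (- 1) (aut p (- 1) c j u) = (- (int p * 1), (j * snd u) mod int p)"
    "shift p 1 u = (int p * 1, snd u)"
    using u by (simp_all add: shift_def aut_def)
  ultimately show "shift p 1 (aut p (- 1) c j u) \<in> cls (shift p 1 u) \<or> shift p (- 1) (aut p (- 1) c j u) \<in> cls (shift p 1 u)"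
    by simp
qed (use u in simp)

lemma reflection_multiple_level:
  assumes "\<And>m k. \<lbrakk>m \<noteq> 0; 0 \<le> k; k < int p\<rbrakk> \<Longrightarrow> (- (int p * m), (j * k) mod int p) \<in> cls (int p * m, k)"
    and u: "u \<in> cyl p" "int p dvd fst u"
  shows "aut p (- 1) c j u \<in> cls u"
proof (cases "fst u = 0")
  case True
  then show ?thesis using reflection_level_zero assms by blast
next
  case False
  obtain m where m: "fst u = int p * m" using u(2) by blast
  have "(- (int p * m), (j * snd u) mod int p) \<in> cls (int p * m, snd u)"
    by (rule assms(1)) (use u m False in \<open>auto simp: in_cylI\<close>)
  moreover have "(c * (int p * m) + j * snd u) mod int p = (j * snd u) mod int p"
  proof -
    have "c * (int p * m) + j * snd u = j * snd u + int p * (c * m)" by simp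
    then show ?thesis by (simp only: mod_mult_self2)
  qed
  then have "aut p (- 1) c j u = (- (int p * m), (j * snd u) mod int p)" using m by (simp add: aut_def)
  moreover have "u = (int p * m, snd u)" using m by (simp add: prod_eq_iff)
  ultimately show ?thesis by simp
qed

text \<open>The multiplier j is known from the levels divisible by p. If the remaining levels are
  single slices, c = 0 serves; otherwise c is dictated by the partner of a singleton slice at level
  1.\<close>

lemma reflection:
  assumes np: "{(int p, 0)} \<notin> D" and dich: "lev p 1 \<in> slices \<or> (\<exists>b. {(1, b)} \<in> slices)"
  shows "\<exists>c j. coprime j (int p) \<and> preserves (aut p (- 1) c j)"
proof -
  obtain j where j: "coprime j (int p)"
    "\<And>m k. \<lbrakk>m \<noteq> 0; 0 \<le> k; k < int p\<rbrakk> \<Longrightarrow> (- (int p * m), (j * k) mod int p) \<in> cls (int p * m, k)"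
    using reflection_p_levels [OF np] by blast
  have partner: "\<exists>w\<in>cls u. fst w = - fst u" "fst u \<noteq> 0" if "u \<in> cyl p" "\<not> int p dvd fst u" for u
  proof -
    show "fst u \<noteq> 0" using that by auto
    then show "\<exists>w\<in>cls u. fst w = - fst u" by (rule both_levels [OF np that(1)])
  qed
  have finish: "aut p (- 1) c j u \<in> cls u"
    if u: "u \<in> cyl p" "\<not> int p dvd fst u" and w: "w \<in> cls u" "aut p (- 1) c j u \<in> slice w" "fst w = - fst u" for c u w
  proof -
    have wc: "w \<in> cyl p" by (rule subsetD [OF cls_subset_cyl [OF u(1)] w(1)])
    have "aut p (- 1) c j u \<in> cls w"
      by (rule slice_imp_cls [OF wc _ w(2)]) (use partner(2) [OF u] w(3) in simp)
    then show ?thesis using cls_cong [OF u(1) w(1)] by simp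
  qed
  from dich show ?thesis
  proof
    assume full: "lev p 1 \<in> slices"
    have "preserves (aut p (- 1) 0 j)"
    proof (rule preservesI)
      fix u assume u: "u \<in> cyl p"
      show "aut p (- 1) 0 j u \<in> cls u"
      proof (cases "int p dvd fst u")
        case True
        show ?thesis by (rule reflection_multiple_level [OF _ u True]) (rule j(2))
      next
        case False
        obtain w where w: "w \<in> cls u" "fst w = - fst u" using partner(1) [OF u False] by blast
        have wc: "w \<in> cyl p" by (rule subsetD [OF cls_subset_cyl [OF u] w(1)])
        have "lev p (fst w) \<in> slices" by (rule A.lev_class_multiple [OF full]) (use False w(2) in simp)
        then have "A.cls w = lev p (fst w)" by (rule A.cls_eq) (simp add: lev_iff wc)
        then have "slice w = lev p (fst w)" using A_cls [OF wc] by simp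
        then have "aut p (- 1) 0 j u \<in> slice w" using w(2) by (simp add: lev_iff aut_in_cyl)
        then show ?thesis by (rule finish [OF u False w(1) _ w(2)])
      qed
    qed
    with j(1) show ?thesis by blast
  next
    assume "\<exists>b. {(1, b)} \<in> slices"
    then obtain b where b: "{(1, b)} \<in> slices" by blast
    have x1: "(1, b) \<in> cyl p" using A.class_subset [OF b] by simp
    have tb1: "slice (1, b) = {(1, b)}" using A_cls [OF x1] A.cls_eq [OF b, of "(1, b)"] by simp
    have "\<not> int p dvd fst (1 :: int, b)" using p_gt_1 by simp
    then obtain w1 where w1: "w1 \<in> cls (1, b)" "fst w1 = - 1" using partner(1) [OF x1] by auto
    define b' where "b' = snd w1"
    have w1b: "w1 = (- 1, b')" using w1(2) by (simp add: b'_def prod_eq_iff)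
    have w1c: "w1 \<in> cyl p" by (rule subsetD [OF cls_subset_cyl [OF x1] w1(1)])
    \<comment> \<open>Slices of one class at opposite levels have equal size, so the partner of a
      singleton is a singleton.\<close>
    have "card (slice w1) = card (slice (1, b))" by (rule card_slice_eq [OF x1 _ w1(1)]) (simp_all add: w1(2))
    then have "card (slice w1) = 1" unfolding tb1 by simp
    then obtain t where "slice w1 = {t}" by (auto simp: card_1_singleton_iff)
    then have tbw: "slice w1 = {w1}" using slice_self [OF w1c] by simp
    have w1D: "{w1} \<in> slices" unfolding slices_def tbw [symmetric] by (rule imageI [OF w1c])
    have blk1: "cls (1, b) \<subseteq> {(1, b), w1}"
    proof
      fix u assume u: "u \<in> cls (1, b)"
      then have "fst u = 1 \<or> fst u = - 1" using fst_cls [OF x1 u] by simp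
      then show "u \<in> {(1, b), w1}"
      proof
        assume "fst u = 1"
        then have "u \<in> slice (1, b)" by (intro cls_imp_slice [OF x1 _ u]) simp_all
        then show ?thesis unfolding tb1 by simp
      next
        assume f: "fst u = - 1"
        have uw: "u \<in> cls w1" using u cls_cong [OF x1 w1(1)] by simp
        have "u \<in> slice w1" by (rule cls_imp_slice [OF w1c _ uw]) (simp_all add: f w1(2))
        then show ?thesis unfolding tbw by simp
      qed
    qed
    \<comment> \<open>With this c the reflection sends (1, b) to its partner (-1, b').\<close>
    define c where "c = b' - j * b"
    have "preserves (aut p (- 1) c j)"
    proof (rule preservesI)
      fix u assume u: "u \<in> cyl p"
      show "aut p (- 1) c j u \<in> cls u"
      proof (cases "int p dvd fst u")
        case True
        show ?thesis by (rule reflection_multiple_level [OF _ u True]) (rule j(2))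
      next
        case False
        obtain w where w: "w \<in> cls u" "fst w = - fst u" using partner(1) [OF u False] by blast
        \<comment> \<open>Splits u into the \<open>a\<close>-th power of (1, b) and an element (p,
          i) of level p, where the reflection is already known; \<open>a\<close> is prime to p
          because \<open>fst u\<close> is.\<close>
        define a where "a = fst u - int p"
        have a: "\<not> int p dvd a" unfolding a_def using False by (metis diff_add_cancel dvd_add dvd_refl)
        then have ca: "coprime a (int p)" "a \<noteq> 0" using A.coprime_iff_not_dvd by auto
        define i where "i = (snd u - a * b) mod int p"
        have i: "0 \<le> i" "i < int p" by (simp_all add: i_def)
        have ic: "(int p, i) \<in> cyl p" using i by (simp add: in_cylI)
        let ?A1 = "nmul p a (cls (1, b))" and ?E = "cls (int p, i)"
        have S: "S_set (sset p ?A1 ?E)"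
          by (intro S_set_sset S_set_nmul_coprime ca finite_cls S_set_class cls_in x1 ic)
        have "red p (smul a (1, b)) \<in> ?A1" unfolding nmul_def by (rule imageI) (rule cls_in(2) [OF x1])
        moreover have "u = red p (red p (smul a (1, b)) + (int p, i))"
          using u by (simp add: red_def smul_def i_def a_def prod_eq_iff in_cylI mod_simps)
        ultimately have "u \<in> sset p ?A1 ?E" using cls_in(2) [OF ic] by (intro S_set_sset_memI)
        from subsetD [OF S_set_cls_subset [OF S this] w(1)]
        obtain v e where v: "v \<in> ?A1" and e: "e \<in> ?E" and we: "w = red p (v + e)" by (rule sset_memE)
        have "v \<in> {red p (smul a (1, b)), red p (smul a w1)}"
          using v blk1 unfolding nmul_def by auto
        then have fv: "fst v = a \<or> fst v = - a \<and> v = red p (smul a w1)" using w1(2) by auto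
        have fe: "fst e = int p \<or> fst e = - int p" using fst_cls [OF ic e] by simp
        have fw: "fst v + fst e = - a - int p" using we w(2) by (simp add: a_def)
        \<comment> \<open>Of the four sign choices only -a and -p add up to the level -a - p of the
          partner w, as a is neither 0 nor -p.\<close>
        have "a \<noteq> - int p" using a by auto
        then have vw: "v = red p (smul a w1)" "fst e = - int p"
          using fv fe fw ca(2) by auto
        let ?e = "(- int p, (j * i) mod int p)"
        have ec: "e \<in> cyl p" by (rule subsetD [OF cls_subset_cyl [OF ic] e])
        have e'c: "?e \<in> cyl p" by (simp add: in_cylI)
        have "?e \<in> ?E" using j(2) [of 1 i] i by simp
        then have ee: "?e \<in> cls e" using cls_cong [OF ic e] by simp
        have "?e \<in> slice e" by (rule cls_imp_slice [OF ec _ ee]) (use vw(2) in simp_all)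
        then have "?e \<in> A.cls e" using A_cls [OF ec] by simp
        then have "red p (?e + v) \<in> A.cls (red p (e + v))"
          unfolding vw(1) by (rule A.class_shift_imp [OF A.singleton_multiple [OF w1D] ec])
        then have "red p (?e + v) \<in> slice (red p (e + v))" using A_cls [of "red p (e + v)"] by (simp add: red_in_cyl)
        moreover have "red p (e + v) = w" using we by (simp add: add.commute)
        moreover have "red p (?e + v) = aut p (- 1) c j u"
        proof -
          have "(j * i + a * b') mod int p = (j * (snd u - a * b) + a * b') mod int p"
            unfolding i_def by (metis mod_add_left_eq mod_mult_right_eq)
          also have "\<dots> = (c * a + j * snd u) mod int p" by (simp add: c_def algebra_simps)
          also have "\<dots> = (c * a + j * snd u + int p * c) mod int p" by (rule mod_mult_self2 [symmetric])
          also have "\<dots> = (c * fst u + j * snd u) mod int p" by (simp add: a_def algebra_simps)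
          finally have "(j * i + a * b') mod int p = (c * fst u + j * snd u) mod int p" .
          then show ?thesis unfolding vw(1) w1b
            by (simp add: red_def smul_def aut_def a_def mod_simps)
        qed
        ultimately have "aut p (- 1) c j u \<in> slice w" by simp
        then show ?thesis by (rule finish [OF u False w(1) _ w(2)])
      qed
    qed
    with j(1) show ?thesis by blast
  qed
qed

lemma preserves_aut_comp:
  assumes "preserves (aut p e b i)" "preserves (aut p e' b' i')"
  shows "preserves (aut p (e * e') (b * e' + i * b') (i * i'))"
proof (rule preservesI)
  fix u assume u: "u \<in> cyl p"
  have "aut p e' b' i' u \<in> cls u" by (rule preservesD [OF assms(2) u])
  then have "cls (aut p e' b' i' u) = cls u" by (rule cls_cong [OF u])
  then have "aut p e b i (aut p e' b' i' u) \<in> cls u"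
    using preservesD [OF assms(1) aut_in_cyl [OF p_pos, of e' b' i' u]] by simp
  then show "aut p (e * e') (b * e' + i * b') (i * i') u \<in> cls u" unfolding aut_aut .
qed

text \<open>The element y lies in the slice of x or of its mirror image, so at most one reflection
  followed by an automorphism with \<open>e = 1\<close> reaches it.\<close>

lemma transitive:
  assumes "fermat_prime p \<or> safe_prime p" and x: "x \<in> cyl p" and y: "y \<in> cls x"
  shows "\<exists>e b i. (e = 1 \<or> e = - 1) \<and> coprime i (int p) \<and> aut p e b i x = y \<and> preserves (aut p e b i)"
proof -
  have dich: "lev p 1 \<in> slices \<or> (\<exists>b. {(1, b)} \<in> slices)" by (rule A.level_one [OF assms(1)])
  have pos: ?thesis if "y \<in> slice x"
    using transitive_slices [OF dich x that] by blast
  show ?thesis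
  proof (cases "{(int p, 0)} \<in> D")
    case True
    then show ?thesis using pos slice_if_p_class [OF _ x y] by blast
  next
    case np: False
    obtain c j where j: "coprime j (int p)" "preserves (aut p (- 1) c j)" using reflection [OF np dich] by blast
    let ?r = "aut p (- 1) c j x"
    have r: "?r \<in> cyl p" "?r \<in> cls x" by (rule aut_in_cyl [OF p_pos]) (rule preservesD [OF j(2) x])
    have neg: ?thesis if yr: "y \<in> slice ?r"
    proof -
      obtain b i where i: "coprime i (int p)" "aut p 1 b i ?r = y" "preserves (aut p 1 b i)"
        using transitive_slices [OF dich r(1) yr] by blast
      have "preserves (aut p (1 * - 1) (b * - 1 + i * c) (i * j))" by (rule preserves_aut_comp [OF i(3) j(2)])
      moreover have "aut p (1 * - 1) (b * - 1 + i * c) (i * j) x = y" using i(2) unfolding aut_aut .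
      moreover have "coprime (i * j) (int p)" using i(1) j(1) by simp
      ultimately show ?thesis by (intro exI [of _ "1 * - 1"] exI [of _ "b * - 1 + i * c"] exI [of _ "i * j"]) simp
    qed
    have fy: "fst y = fst x \<or> fst y = - fst x" by (rule fst_cls [OF x y])
    have yc: "y \<in> cyl p" by (rule subsetD [OF cls_subset_cyl [OF x] y])
    show ?thesis
    proof (cases "fst x = 0")
      case False
      from fy show ?thesis
      proof
        assume "fst y = fst x"
        then show ?thesis by (intro pos cls_imp_slice [OF x False y])
      next
        assume f: "fst y = - fst x"
        have "y \<in> cls ?r" using y cls_cong [OF x r(2)] by simp
        then show ?thesis by (intro neg cls_imp_slice [OF r(1)]) (use False f in simp_all)
      qed
    next
      case True
      \<comment> \<open>Level 0 is its own opposite, so the level of y does not decide whether to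
        reflect. The class of z^p x does: z^p y or z^-p y lies in it.\<close>
      let ?x = "shift p 1 x"
      have xc: "?x \<in> cyl p" "fst ?x = int p" using x True by simp_all
      have S: "S_set (sset p (cls ?x) (pm p 1))" by (intro S_set_sset S_set_pm S_set_class cls_in xc)
      have "shift p (- 1) ?x \<in> sset p (cls ?x) (pm p 1)"
        by (rule sset_pm_memI(2) [OF cls_in(2) [OF xc(1)] xc(1)])
      then have "x \<in> sset p (cls ?x) (pm p 1)" by simp
      from subsetD [OF S_set_cls_subset [OF S this] y]
      obtain w where w: "w \<in> cls ?x" "y = shift p 1 w \<or> y = shift p (- 1) w"
        by (rule sset_pm_memE [OF _ cls_subset_cyl [OF xc(1)]])
      have fy0: "fst y = 0" using fy True by simp
      from w(2) show ?thesis
      proof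
        assume yw: "y = shift p (- 1) w"
        then have "shift p 1 y \<in> cls ?x" using w(1) by simp
        then have "shift p 1 y \<in> slice ?x" by (intro cls_imp_slice [OF xc(1)]) (use xc(2) fy0 in simp_all)
        then have "y \<in> slice x" unfolding slice_shift [OF x] .
        then show ?thesis by (rule pos)
      next
        assume yw: "y = shift p 1 w"
        then have yb: "shift p (- 1) y \<in> cls ?x" using w(1) by simp
        have "aut p (- 1) c j ?x = shift p (- 1) ?r"
        proof -
          have "c * int p + j * snd x = j * snd x + int p * c" by simp
          then have "(c * int p + j * snd x) mod int p = (j * snd x) mod int p" by (simp only: mod_mult_self2)
          then show ?thesis using True by (simp add: aut_def shift_def)
        qed
        then have rb: "shift p (- 1) ?r \<in> cls ?x" using preservesD [OF j(2) xc(1)] by simp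
        have "shift p (- 1) y \<in> cls (shift p (- 1) ?r)" using yb cls_cong [OF xc(1) rb] by simp
        then have "shift p (- 1) y \<in> slice (shift p (- 1) ?r)"
          by (intro cls_imp_slice) (use r(1) True fy0 in simp_all)
        then have "y \<in> slice ?r" unfolding slice_shift [OF r(1)] .
        then show ?thesis by (rule neg)
      qed
    qed
  qed
qed

end

section \<open>The automorphism group\<close>

lemma carrier_ZxZp: "p > 0 \<Longrightarrow> carrier (ZxZp p) = cyl p"
  by (simp add: ZxZp_def DirProd_def cyl_def carrier_integer_mod_group)

lemma mult_ZxZp: "p > 0 \<Longrightarrow> x \<otimes>\<^bsub>ZxZp p\<^esub> y = red p (x + y)"
  by (simp add: ZxZp_def DirProd_def red_def case_prod_beta)

lemma one_ZxZp: "\<one>\<^bsub>ZxZp p\<^esub> = 0"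
  by (simp add: ZxZp_def zero_prod_def)

lemma group_ZxZp: "group (ZxZp p)"
  unfolding ZxZp_def by (intro DirProd_group group_integer_group group_integer_mod_group)

lemma inv_ZxZp: assumes "p > 0" "x \<in> cyl p" shows "inv\<^bsub>ZxZp p\<^esub> x = red p (- x)"
proof (rule group.inv_equality [OF group_ZxZp])
  have "red p (red p (- x) + x) = red p (- x + x)" by (rule red_simps)
  then show "red p (- x) \<otimes>\<^bsub>ZxZp p\<^esub> x = \<one>\<^bsub>ZxZp p\<^esub>"
    unfolding mult_ZxZp [OF assms(1)] one_ZxZp by (simp add: red_def zero_prod_def)
qed (use assms in \<open>simp_all add: carrier_ZxZp red_in_cyl\<close>)

lemma aut_red_add: "aut p e b i (red p (x + y)) = red p (aut p e b i x + aut p e b i y)"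
proof -
  have "(b * (fst x + fst y) + i * ((snd x + snd y) mod int p)) mod int p =
      (b * (fst x + fst y) + i * (snd x + snd y)) mod int p"
    by (metis mod_add_right_eq mod_mult_right_eq)
  also have "\<dots> = ((b * fst x + i * snd x) + (b * fst y + i * snd y)) mod int p"
    by (simp add: algebra_simps)
  finally show ?thesis by (simp add: aut_def red_def distrib_left mod_add_eq)
qed

context schur_cyl
begin

lemma inj_on_aut:
  assumes e: "e = 1 \<or> e = - 1" and i: "coprime i (int p)"
  shows "inj_on (aut p e b i) (cyl p)"
proof (rule inj_onI)
  fix x y assume x: "x \<in> cyl p" and y: "y \<in> cyl p" and eq: "aut p e b i x = aut p e b i y"
  have "e * fst x = e * fst y" using eq by (simp add: aut_def)
  then have f: "fst x = fst y" using e by auto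
  have "(b * fst x + i * snd x) mod int p = (b * fst y + i * snd y) mod int p" using eq by (simp add: aut_def)
  then have "int p dvd (b * fst x + i * snd x) - (b * fst y + i * snd y)" by (simp only: mod_eq_dvd_iff)
  moreover have "(b * fst x + i * snd x) - (b * fst y + i * snd y) = i * (snd x - snd y)"
    using f by (simp add: algebra_simps)
  ultimately have "int p dvd snd x - snd y" using i by (simp add: coprime_commute coprime_dvd_mult_right_iff)
  then have "snd x mod int p = snd y mod int p" by (simp only: mod_eq_dvd_iff)
  then show "x = y" using x y f by (simp add: in_cylI prod_eq_iff)
qed

lemma preserves_image:
  assumes "inj_on f (cyl p)" "preserves f" "C \<in> D" shows "f ` C = C"
proof (rule card_subset_eq [OF finite_class [OF assms(3)]])
  show "f ` C \<subseteq> C"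
  proof (rule image_subsetI)
    fix x assume x: "x \<in> C"
    have "f x \<in> cls x" by (rule preservesD [OF assms(2) subsetD [OF class_subset [OF assms(3)] x]])
    then show "f x \<in> C" using cls_eq [OF assms(3) x] by simp
  qed
  show "card (f ` C) = card C" by (rule card_image [OF inj_on_subset [OF assms(1) class_subset [OF assms(3)]]])
qed

text \<open>The full group of automorphisms fixing every class setwise, in place of the subgroup
  generated by the maps found above; closure is then immediate.\<close>

definition class_auts :: "(int \<times> int \<Rightarrow> int \<times> int) set" where
  "class_auts = {\<sigma> \<in> auto (ZxZp p). \<forall>C\<in>D. \<sigma> ` C = C}"

lemma class_auts_I: "\<lbrakk>\<sigma> \<in> auto (ZxZp p); \<And>C. C \<in> D \<Longrightarrow> \<sigma> ` C = C\<rbrakk> \<Longrightarrow> \<sigma> \<in> class_auts"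
  unfolding class_auts_def by simp

text \<open>Elements of \<open>AutoGroup\<close> are extensional functions, hence the restriction to
  the carrier.\<close>

lemma aut_in_class_auts:
  assumes e: "e = 1 \<or> e = - 1" and i: "coprime i (int p)" and pr: "preserves (aut p e b i)"
  shows "restrict (aut p e b i) (cyl p) \<in> class_auts"
proof -
  let ?f = "aut p e b i"
  have inj: "inj_on ?f (cyl p)" by (rule inj_on_aut [OF e i])
  have img: "?f ` C = C" if "C \<in> D" for C by (rule preserves_image [OF inj pr that])
  have U: "\<Union> D = cyl p" using partition by (simp add: partition_on_def)
  have surj: "?f ` cyl p = cyl p"
    unfolding U [symmetric] image_Union by (rule arg_cong [where f = Union]) (simp add: img)
  have "restrict ?f (cyl p) \<in> auto (ZxZp p)"
    unfolding auto_def Bij_def carrier_ZxZp [OF p_pos]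
  proof (intro IntI CollectI)
    show "restrict ?f (cyl p) \<in> hom (ZxZp p) (ZxZp p)"
      unfolding hom_def carrier_ZxZp [OF p_pos] mult_ZxZp [OF p_pos]
      by (simp add: aut_in_cyl red_in_cyl aut_red_add)
    have "bij_betw ?f (cyl p) (cyl p)" by (rule bij_betw_imageI [OF inj surj])
    then show "bij_betw (restrict ?f (cyl p)) (cyl p) (cyl p)" by (simp only: bij_betw_restrict_eq)
  qed simp
  moreover have "restrict ?f (cyl p) ` C = C" if C: "C \<in> D" for C
  proof -
    have "restrict ?f (cyl p) ` C = ?f ` C"
      by (rule image_cong [OF refl]) (simp add: subsetD [OF class_subset [OF C]])
    then show ?thesis using img [OF C] by simp
  qed
  ultimately show ?thesis by (rule class_auts_I)
qed

lemma subgroup_class_auts: "subgroup class_auts (AutoGroup (ZxZp p))"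
proof -
  interpret G: group "ZxZp p" by (rule group_ZxZp)
  interpret AG: group "AutoGroup (ZxZp p)" by (rule G.AutoGroup)
  have carr: "carrier (AutoGroup (ZxZp p)) = auto (ZxZp p)" by (simp add: AutoGroup_def)
  have one: "\<one>\<^bsub>AutoGroup (ZxZp p)\<^esub> = restrict (\<lambda>x. x) (cyl p)"
    by (simp add: AutoGroup_def BijGroup_def carrier_ZxZp)
  have mult: "a \<otimes>\<^bsub>AutoGroup (ZxZp p)\<^esub> b = compose (cyl p) a b" if "a \<in> auto (ZxZp p)" "b \<in> auto (ZxZp p)" for a b
    using that by (simp add: AutoGroup_def BijGroup_def auto_def carrier_ZxZp)
  have comp: "compose (cyl p) a b ` C = a ` (b ` C)" if "C \<in> D" for a b :: "int \<times> int \<Rightarrow> int \<times> int" and C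
  proof -
    have "compose (cyl p) a b ` C = (\<lambda>x. a (b x)) ` C"
      by (rule image_cong [OF refl]) (simp add: compose_eq subsetD [OF class_subset [OF that]])
    then show ?thesis by (simp add: image_image)
  qed
  have id: "restrict (\<lambda>x. x) (cyl p) ` C = C" if "C \<in> D" for C
  proof -
    have "restrict (\<lambda>x. x) (cyl p) ` C = (\<lambda>x. x) ` C"
      by (rule image_cong [OF refl]) (simp add: subsetD [OF class_subset [OF that]])
    then show ?thesis by simp
  qed
  show ?thesis
  proof (rule AG.subgroupI)
    show "class_auts \<subseteq> carrier (AutoGroup (ZxZp p))" unfolding carr class_auts_def by (rule subsetI) simp
    have "\<one>\<^bsub>AutoGroup (ZxZp p)\<^esub> \<in> auto (ZxZp p)" using AG.one_closed carr by simp
    then have "\<one>\<^bsub>AutoGroup (ZxZp p)\<^esub> \<in> class_auts" by (rule class_auts_I) (unfold one, rule id)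
    then show "class_auts \<noteq> {}" by auto
    fix a assume "a \<in> class_auts"
    then have a: "a \<in> auto (ZxZp p)" "\<And>C. C \<in> D \<Longrightarrow> a ` C = C" by (simp_all add: class_auts_def)
    let ?i = "inv\<^bsub>AutoGroup (ZxZp p)\<^esub> a"
    have ia: "?i \<in> auto (ZxZp p)" using AG.inv_closed a(1) carr by simp
    have "?i ` C = C" if C: "C \<in> D" for C
    proof -
      have "?i ` C = ?i ` (a ` C)" using a(2) [OF C] by simp
      also have "\<dots> = compose (cyl p) ?i a ` C" by (rule comp [OF C, symmetric])
      also have "compose (cyl p) ?i a = \<one>\<^bsub>AutoGroup (ZxZp p)\<^esub>"
        using AG.l_inv [of a] a(1) carr mult [OF ia a(1)] by simp
      finally show ?thesis using id [OF C] one by simp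
    qed
    with ia show "?i \<in> class_auts" by (rule class_auts_I)
    fix b assume "b \<in> class_auts"
    then have b: "b \<in> auto (ZxZp p)" "\<And>C. C \<in> D \<Longrightarrow> b ` C = C" by (simp_all add: class_auts_def)
    have "a \<otimes>\<^bsub>AutoGroup (ZxZp p)\<^esub> b \<in> auto (ZxZp p)" using AG.m_closed a(1) b(1) carr by simp
    then show "a \<otimes>\<^bsub>AutoGroup (ZxZp p)\<^esub> b \<in> class_auts"
      by (rule class_auts_I) (simp only: mult [OF a(1) b(1)] comp a(2) b(2))
  qed
qed

lemma auto_determined:
  assumes \<sigma>: "\<sigma> \<in> auto (ZxZp p)" and x: "x \<in> cyl p"
  shows "\<sigma> x = red p (smul (fst x) (\<sigma> (1, 0)) + smul (snd x) (\<sigma> (0, 1)))"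
proof -
  have add: "\<sigma> (red p (u + v)) = red p (\<sigma> u + \<sigma> v)" if "u \<in> cyl p" "v \<in> cyl p" for u v
    using \<sigma> that by (simp add: auto_def hom_def carrier_ZxZp mult_ZxZp)
  have mem: "\<sigma> u \<in> cyl p" if "u \<in> cyl p" for u
    using \<sigma> that by (auto simp: auto_def hom_def carrier_ZxZp)
  have c: "(1, 0) \<in> cyl p" "(0, 1) \<in> cyl p" "(0, 0) \<in> cyl p" using p_gt_1 by (simp_all add: in_cylI)
  have zero: "\<sigma> (0, 0) = 0"
  proof -
    have "red p ((0, 0) + (0, 0)) = (0, 0)" by (simp add: red_def)
    then have "\<sigma> (0, 0) = red p (\<sigma> (0, 0) + \<sigma> (0, 0))" using add [OF c(3,3)] by simp
    then have eq: "red p (\<sigma> (0, 0)) = red p (\<sigma> (0, 0) + \<sigma> (0, 0))" using red_id [OF mem [OF c(3)]] by simp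
    have "red p (red p (\<sigma> (0, 0)) - \<sigma> (0, 0)) = red p (red p (\<sigma> (0, 0) + \<sigma> (0, 0)) - \<sigma> (0, 0))"
      unfolding eq ..
    then have "red p 0 = red p (\<sigma> (0, 0))" by simp
    also have "\<dots> = \<sigma> (0, 0)" by (rule red_id [OF mem [OF c(3)]])
    finally show ?thesis by (simp add: red_def zero_prod_def)
  qed
  have level: "\<sigma> (m, 0) = red p (smul m (\<sigma> (1, 0)))" for m
  proof (induction m rule: int_induct [where k = 0])
    case base
    show ?case by (simp add: zero) (simp add: red_def zero_prod_def)
  next
    case (step1 m)
    have "\<sigma> (m + 1, 0) = \<sigma> (red p ((m, 0) + (1, 0)))" by (simp add: red_def)
    also have "\<dots> = red p (\<sigma> (m, 0) + \<sigma> (1, 0))" by (rule add) (simp_all add: in_cylI)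
    also have "\<dots> = red p (smul m (\<sigma> (1, 0)) + \<sigma> (1, 0))" unfolding step1.IH by (rule red_simps)
    also have "smul m (\<sigma> (1, 0)) + \<sigma> (1, 0) = smul (m + 1) (\<sigma> (1, 0))" by (simp add: prod_eq_iff algebra_simps)
    finally show ?case .
  next
    case (step2 m)
    have "\<sigma> (m, 0) = \<sigma> (red p ((m - 1, 0) + (1, 0)))" by (simp add: red_def)
    also have "\<dots> = red p (\<sigma> (m - 1, 0) + \<sigma> (1, 0))" by (rule add) (simp_all add: in_cylI)
    finally have "red p (\<sigma> (m, 0) - \<sigma> (1, 0)) = red p (\<sigma> (m - 1, 0))" by simp
    also have "\<dots> = \<sigma> (m - 1, 0)" by (rule red_id [OF mem]) (simp add: in_cylI)
    finally have "\<sigma> (m - 1, 0) = red p (smul m (\<sigma> (1, 0)) - \<sigma> (1, 0))" unfolding step2.IH by simp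
    also have "smul m (\<sigma> (1, 0)) - \<sigma> (1, 0) = smul (m - 1) (\<sigma> (1, 0))" by (simp add: prod_eq_iff algebra_simps)
    finally show ?case .
  qed
  have tors: "\<sigma> (0, int k) = red p (smul (int k) (\<sigma> (0, 1)))" if "k < p" for k
    using that
  proof (induction k)
    case 0
    show ?case by (simp add: zero) (simp add: red_def zero_prod_def)
  next
    case (Suc k)
    have "\<sigma> (0, int (Suc k)) = \<sigma> (red p ((0, int k) + (0, 1)))" using Suc.prems by (simp add: red_def add.commute)
    also have "\<dots> = red p (\<sigma> (0, int k) + \<sigma> (0, 1))" by (rule add) (use Suc.prems c in \<open>simp_all add: in_cylI\<close>)
    also have "\<dots> = red p (smul (int k) (\<sigma> (0, 1)) + \<sigma> (0, 1))" using Suc by simp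
    also have "smul (int k) (\<sigma> (0, 1)) + \<sigma> (0, 1) = smul (int (Suc k)) (\<sigma> (0, 1))" by (simp add: prod_eq_iff algebra_simps)
    finally show ?case .
  qed
  obtain k where k: "snd x = int k" "k < p"
    using x zero_le_imp_eq_int [of "snd x"] by (auto simp: in_cylI)
  have "x = red p ((fst x, 0) + (0, snd x))" using x by (simp add: red_def in_cylI prod_eq_iff)
  then have "\<sigma> x = \<sigma> (red p ((fst x, 0) + (0, snd x)))" by (rule arg_cong)
  also have "\<dots> = red p (\<sigma> (fst x, 0) + \<sigma> (0, snd x))"
    by (rule add) (use x in \<open>simp_all add: in_cylI\<close>)
  also have "\<sigma> (0, snd x) = red p (smul (snd x) (\<sigma> (0, 1)))" unfolding k(1) by (rule tors [OF k(2)])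
  also have "\<sigma> (fst x, 0) = red p (smul (fst x) (\<sigma> (1, 0)))" by (rule level)
  finally show ?thesis unfolding k(1) red_simps .
qed

text \<open>The generators z and a must stay in their finite classes, and their images determine the
  automorphism.\<close>

lemma finite_class_auts: "finite class_auts"
proof (rule finite_imageD)
  let ?ev = "\<lambda>\<sigma> :: int \<times> int \<Rightarrow> int \<times> int. (\<sigma> (1, 0), \<sigma> (0, 1))"
  have c: "(1, 0) \<in> cyl p" "(0, 1) \<in> cyl p" using p_gt_1 by (simp_all add: in_cylI)
  have "?ev ` class_auts \<subseteq> cls (1, 0) \<times> cls (0, 1)"
  proof (rule image_subsetI)
    fix \<sigma> assume "\<sigma> \<in> class_auts"
    then have img: "\<sigma> ` cls u = cls u" if "u \<in> cyl p" for u using cls_in(1) [OF that] by (simp add: class_auts_def)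
    have "\<sigma> u \<in> cls u" if u: "u \<in> cyl p" for u
      using imageI [OF cls_in(2) [OF u], of \<sigma>] img [OF u] by simp
    then show "?ev \<sigma> \<in> cls (1, 0) \<times> cls (0, 1)" using c by simp
  qed
  then show "finite (?ev ` class_auts)" by (rule finite_subset) (intro finite_cartesian_product finite_cls c)
  show "inj_on ?ev class_auts"
  proof (rule inj_onI)
    fix \<sigma> \<tau> assume s: "\<sigma> \<in> class_auts" and t: "\<tau> \<in> class_auts" and eq: "?ev \<sigma> = ?ev \<tau>"
    have sa: "\<sigma> \<in> auto (ZxZp p)" and ta: "\<tau> \<in> auto (ZxZp p)" using s t by (simp_all add: class_auts_def)
    have "\<sigma> \<in> extensional (cyl p)" "\<tau> \<in> extensional (cyl p)"
      using sa ta by (simp_all add: auto_def Bij_def carrier_ZxZp)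
    then show "\<sigma> = \<tau>"
    proof (rule extensionalityI)
      fix x assume x: "x \<in> cyl p"
      show "\<sigma> x = \<tau> x" unfolding auto_determined [OF sa x] auto_determined [OF ta x] using eq by simp
    qed
  qed
qed

lemma automorphic_if_transitive:
  assumes "\<And>x y. \<lbrakk>x \<in> cyl p; y \<in> cls x\<rbrakk> \<Longrightarrow>
    \<exists>e b i. (e = 1 \<or> e = - 1) \<and> coprime i (int p) \<and> aut p e b i x = y \<and> preserves (aut p e b i)"
  shows "automorphic (ZxZp p) D"
proof -
  have orbit: "{\<sigma> x | \<sigma>. \<sigma> \<in> class_auts} = cls x" if x: "x \<in> cyl p" for x
  proof (intro Set.set_eqI iffI)
    fix y assume "y \<in> {\<sigma> x | \<sigma>. \<sigma> \<in> class_auts}"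
    then obtain \<sigma> where s: "y = \<sigma> x" "\<sigma> \<in> class_auts" by blast
    have "\<sigma> ` cls x = cls x" using s(2) cls_in(1) [OF x] by (simp add: class_auts_def)
    then show "y \<in> cls x" using imageI [OF cls_in(2) [OF x], of \<sigma>] s(1) by simp
  next
    fix y assume "y \<in> cls x"
    then obtain e b i where a: "e = 1 \<or> e = - 1" "coprime i (int p)" "aut p e b i x = y" "preserves (aut p e b i)"
      using assms [OF x] by blast
    have "restrict (aut p e b i) (cyl p) \<in> class_auts" by (rule aut_in_class_auts [OF a(1,2,4)])
    moreover have "y = restrict (aut p e b i) (cyl p) x" using a(3) x by simp
    ultimately show "y \<in> {\<sigma> x | \<sigma>. \<sigma> \<in> class_auts}" by blast
  qed
  have "D = {{\<sigma> x | \<sigma>. \<sigma> \<in> class_auts} | x. x \<in> carrier (ZxZp p)}"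
  proof (intro Set.set_eqI iffI)
    fix C assume C: "C \<in> D"
    obtain x where x: "x \<in> C" using class_nonempty [OF C] by blast
    have xc: "x \<in> cyl p" by (rule subsetD [OF class_subset [OF C] x])
    have "C = {\<sigma> x | \<sigma>. \<sigma> \<in> class_auts}" unfolding orbit [OF xc] by (rule cls_eq [OF C x, symmetric])
    then show "C \<in> {{\<sigma> x | \<sigma>. \<sigma> \<in> class_auts} | x. x \<in> carrier (ZxZp p)}"
      unfolding carrier_ZxZp [OF p_pos] using xc by blast
  next
    fix C assume "C \<in> {{\<sigma> x | \<sigma>. \<sigma> \<in> class_auts} | x. x \<in> carrier (ZxZp p)}"
    then obtain x where "C = {\<sigma> x | \<sigma>. \<sigma> \<in> class_auts}" "x \<in> cyl p" unfolding carrier_ZxZp [OF p_pos] by blast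
    then show "C \<in> D" using orbit cls_in(1) by simp
  qed
  with subgroup_class_auts finite_class_auts show ?thesis unfolding automorphic_def by blast
qed

end

text \<open>A combination of class sums takes equal values at elements of one class; in
  characteristic 0 \<open>of_nat\<close> is injective, which turns this into an equality of
  counts.\<close>

lemma schur_cyl_NI:
  fixes p :: nat and D :: "(int \<times> int) set set"
  assumes p: "Factorial_Ring.prime p"
    and S: "Schur_partition TYPE('f::field_char_0) (ZxZp p) D"
    and N: "S_subgroup (ZxZp p) D {(int p * m, 0) | m. True}"
  shows "schur_cyl_N p D"
proof -
  have pp: "p > 0" using p by (rule prime_gt_0_nat)
  have part: "partition_on (cyl p) D" and fin: "\<And>C. C \<in> D \<Longrightarrow> finite C" and one: "{0} \<in> D"
    and inv: "\<And>C. C \<in> D \<Longrightarrow> (\<lambda>x. inv\<^bsub>ZxZp p\<^esub> x) ` C \<in> D"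
    using S unfolding Schur_partition_def carrier_ZxZp [OF pp] one_ZxZp by simp_all
  have sub: "C \<subseteq> cyl p" if "C \<in> D" for C using that part by (auto simp: partition_on_def)
  have uniq: "K = C" if "K \<in> D" "C \<in> D" "g \<in> K" "g \<in> C" for K C g
    using that part unfolding partition_on_def disjoint_def by blast
  have prod: "prod_coeff (ZxZp p) C E g = prod_coeff (ZxZp p) C E h"
    if C: "C \<in> D" and E: "E \<in> D" and K: "K \<in> D" and g: "g \<in> K" and h: "h \<in> K" for C E K g h
  proof -
    obtain c :: "(int \<times> int) set \<Rightarrow> 'f" where c: "\<And>g. g \<in> cyl p \<Longrightarrow>
        of_nat (prod_coeff (ZxZp p) C E g) = (\<Sum>K\<in>{K \<in> D. c K \<noteq> 0}. c K * (if g \<in> K then 1 else 0))"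
      using S C E unfolding Schur_partition_def carrier_ZxZp [OF pp] by blast
    have iff: "g \<in> L \<longleftrightarrow> h \<in> L" if "L \<in> D" for L
      using uniq [OF K that] g h by metis
    have "(of_nat (prod_coeff (ZxZp p) C E g) :: 'f) = of_nat (prod_coeff (ZxZp p) C E h)"
      unfolding c [OF subsetD [OF sub [OF K] g]] c [OF subsetD [OF sub [OF K] h]]
      by (rule sum.cong [OF refl]) (simp add: iff)
    then show ?thesis by (simp only: of_nat_eq_iff)
  qed
  have schur: "schur_cyl p D"
  proof
    show "Factorial_Ring.prime p" by (rule p)
    show "partition_on (cyl p) D" by (rule part)
    show "{0} \<in> D" by (rule one)
    show "finite C" if "C \<in> D" for C by (rule fin [OF that])
    show "nmul p (- 1) C \<in> D" if C: "C \<in> D" for C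
    proof -
      have "nmul p (- 1) C = (\<lambda>x. inv\<^bsub>ZxZp p\<^esub> x) ` C"
        unfolding nmul_def by (rule image_cong [OF refl]) (simp add: inv_ZxZp [OF pp] subsetD [OF sub [OF C]])
      then show ?thesis using inv [OF C] by simp
    qed
    fix C E K g h assume "C \<in> D" "E \<in> D" "K \<in> D" "g \<in> K" "h \<in> K"
    from prod [OF this]
    show "card {(x, y). x \<in> C \<and> y \<in> E \<and> red p (x + y) = g} = card {(x, y). x \<in> C \<and> y \<in> E \<and> red p (x + y) = h}"
      unfolding prod_coeff_def mult_ZxZp [OF pp] .
  qed
  interpret schur_cyl p D by (rule schur)
  have "S_set {(int p * m, 0) | m. True}"
  proof -
    have eq: "{(int p * m, 0) | m. True} = \<Union> {C \<in> D. C \<subseteq> {(int p * m, 0) | m. True}}"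
      using N unfolding S_subgroup_def by blast
    have "S_set (\<Union>C\<in>{C \<in> D. C \<subseteq> {(int p * m, 0) | m. True}}. C)"
      by (rule S_set_UN) (rule S_set_class, simp)
    then show ?thesis by (subst eq) simp
  qed
  then show ?thesis by unfold_locales
qed

theorem theorem4p1:
  fixes p :: nat and D :: "(int \<times> int) set set"
  assumes "fermat_prime p \<or> safe_prime p"
    and "Schur_partition TYPE('f::field_char_0) (ZxZp p) D"
    and "S_subgroup (ZxZp p) D {(int p * m, 0) | m. True}"
  shows "automorphic (ZxZp p) D"
proof -
  have "Factorial_Ring.prime p"
    using assms(1) unfolding fermat_prime_def safe_prime_def by blast
  then interpret schur_cyl_N p D by (rule schur_cyl_NI [OF _ assms(2,3)])
  show ?thesis by (rule automorphic_if_transitive) (rule transitive [OF assms(1)])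
qed

end
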